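(* For every $m\ge 1$ there is a constant $C_m<\infty$, depending only on $m$, such that the following holds. Let $\mu$ be a non-trivial probability measure on $\partial\mathbb{D}$ with absolutely continuous density $w$ and Verblunsky coefficients $\{\alpha_k\}_{k\ge0}$ satisfying $\sum_{k\ge 0}|\alpha_k|^2<\infty$, and let $w_m=\int_0^{2\pi}e^{-im\theta}\log w(\theta)\frac{d\theta}{2\pi}$. Then $$w_m=\alpha_{m-1}-\sum_{k\ge 0}\alpha_{k+m}\bar\alpha_k+R_m(\mu)$$ with $$|R_m(\mu)|\le C_m\bigg(\sum_{k=0}^{m-1}|\alpha_k|^2+\sum_{k=m}^\infty|\alpha_k|^4\bigg).$$
   Context: $\mathbb{D}=\{|z|<1\}$. A probability measure $\mu$ on $\partial\mathbb{D}$ is non-trivial if its support is infinite. $\partial\mathbb{D}$ is identified with $[0,2\pi)$ via $\theta\mapsto e^{i\theta}$, and $d\mu=w(\theta)\frac{d\theta}{2\pi}+d\mu_{\rm sing}$ with $\mu_{\rm sing}$ singular with respect to Lebesgue measure. $\Phi_n$ ($n\ge 0$) are the monic orthogonal polynomials of $\mu$, $\Phi_n^*(z)=z^n\overline{\Phi_n(1/\bar z)}$ the reversed polynomials, and the Verblunsky coefficients $\alpha_n\in\mathbb{D}$, $n\ge0$, are defined by $\Phi_{n+1}(z)=z\Phi_n(z)-\bar\alpha_n\Phi_n^*(z)$. By Szegő's theorem $\sum_{k\ge0}|\alpha_k|^2<\infty$ if and only if $\log w\in L^1(d\theta)$, so $w_m$ is well defined. *)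

theory Defs
  imports "HOL-Probability.Probability" "HOL-Computational_Algebra.Polynomial"
begin

text \<open>Probability measures on the unit circle are Borel measures on the complex plane that are
  concentrated on \<^term>\<open>sphere 0 1 :: complex set\<close>.\<close>

definition circle_prob_measure :: "complex measure \<Rightarrow> bool" where
  "circle_prob_measure \<mu> \<longleftrightarrow>
     prob_space \<mu> \<and> sets \<mu> = sets borel \<and> emeasure \<mu> (- sphere 0 1) = 0"

definition measure_support :: "'a::topological_space measure \<Rightarrow> 'a set" where
  "measure_support \<mu> = {x. \<forall>U. open U \<and> x \<in> U \<longrightarrow> emeasure \<mu> U > 0}"

definition nontrivial_measure :: "complex measure \<Rightarrow> bool" where
  "nontrivial_measure \<mu> \<longleftrightarrow> infinite (measure_support \<mu>)"


definition is_monic_OP :: "complex measure \<Rightarrow> nat \<Rightarrow> complex poly \<Rightarrow> bool" where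
  "is_monic_OP \<mu> n p \<longleftrightarrow>
     degree p = n \<and> lead_coeff p = 1 \<and>
     (\<forall>q. degree q < n \<longrightarrow> (LINT z|\<mu>. cnj (poly q z) * poly p z) = 0)"

definition monic_OP :: "complex measure \<Rightarrow> nat \<Rightarrow> complex poly" where
  "monic_OP \<mu> n = (THE p. is_monic_OP \<mu> n p)"

text \<open>The reversal is taken with respect to the actual degree of the polynomial, which is \<open>n\<close> for
  the \<open>n\<close>-th orthogonal polynomial.\<close>

definition reversed_poly :: "complex poly \<Rightarrow> complex poly" where
  "reversed_poly p = reflect_poly (map_poly cnj p)"

lemma poly_map_poly_cnj: "poly (map_poly cnj p) z = cnj (poly p (cnj z))"
  by (induction p) (auto simp: map_poly_pCons)

lemma poly_reversed_poly:
  assumes "z \<noteq> 0"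
  shows "poly (reversed_poly p) z = z ^ degree p * cnj (poly p (1 / cnj z))"
  using assms
  by (simp add: reversed_poly_def poly_reflect_poly_nz poly_map_poly_cnj degree_map_poly
      inverse_eq_divide)

definition verblunsky :: "complex measure \<Rightarrow> nat \<Rightarrow> complex" where
  "verblunsky \<mu> n =
     (THE a. monic_OP \<mu> (Suc n) =
        [:0, 1:] * monic_OP \<mu> n - smult (cnj a) (reversed_poly (monic_OP \<mu> n)))"


text \<open>The measure \<open>d\<theta> / 2\<pi>\<close> on \<open>[0, 2\<pi>)\<close>.\<close>

definition angle_measure :: "real measure" where
  "angle_measure = uniform_measure lborel {0..<2 * pi}"

text \<open>\<open>w\<close> is (a Borel version of) the density in the Lebesgue decomposition
  \<open>d\<mu> = w(\<theta>) d\<theta>/2\<pi> + d\<mu>\<^sub>s\<close>; only its values on \<open>[0, 2\<pi>)\<close> matter.\<close>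

definition ac_density :: "complex measure \<Rightarrow> (real \<Rightarrow> real) \<Rightarrow> bool" where
  "ac_density \<mu> w \<longleftrightarrow>
     w \<in> borel_measurable borel \<and> (\<forall>\<theta>. 0 \<le> w \<theta>) \<and>
     (\<exists>\<mu>s. sets \<mu>s = sets borel \<and>
        (\<forall>A\<in>sets borel.
           emeasure \<mu> A = emeasure (distr (density angle_measure (\<lambda>\<theta>. ennreal (w \<theta>))) borel cis) A + emeasure \<mu>s A) \<and>
        (\<exists>N\<in>sets borel. emeasure (distr angle_measure borel cis) N = 0 \<and> emeasure \<mu>s (- N) = 0))"

text \<open>In HOL, \<^prop>\<open>ln 0 = (0::real)\<close> and the integral of a non-integrable function is \<open>0\<close>. Neither
  convention is visible when the logarithm of \<open>w\<close> is integrable in the usual sense (which forces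
  \<open>w > 0\<close> almost everywhere), and by Szego's theorem this is the case whenever the Verblunsky
  coefficients are square summable.\<close>

definition log_coeff :: "(real \<Rightarrow> real) \<Rightarrow> nat \<Rightarrow> complex" where
  "log_coeff w m =
     (LINT \<theta>|angle_measure. exp (- \<i> * of_nat m * of_real \<theta>) * of_real (ln (w \<theta>)))"

end

theory Submission
  imports Defs "HOL-Complex_Analysis.Complex_Analysis"
begin

text \<open>
  Write \<open>P\<^sub>n = \<Phi>\<^sub>n\<^sup>*\<close>, \<open>\<beta>\<^sub>n = \<parallel>\<Phi>\<^sub>n\<parallel>\<^sup>2 = \<Prod>\<^sub>k\<^sub><\<^sub>n (1 - |\<alpha>\<^sub>k|\<^sup>2)\<close> and \<open>b = lim \<beta>\<^sub>n\<close>, which is positive because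
  \<open>\<alpha>\<close> is square summable. The polynomial \<open>P\<^sub>n\<close> has no zero in the closed disc. The proof has an analytic
  and an algebraic half.

  The analytic half says that \<open>w\<^sub>m\<close> is the limit of the Taylor coefficients \<open>- [z\<^sup>m] log P\<^sub>n(z)\<close>
  (\<open>log_coeff_limit\<close>). By the extremal property of \<open>P\<^sub>n\<close>, \<open>\<parallel>q\<parallel>\<^sup>2 \<ge> |q(0)|\<^sup>2 b\<close> for every polynomial
  \<open>q\<close>. Applied to the partial sums of \<open>exp h\<close> this gives \<open>\<integral> exp (2 Re h) d\<mu> \<ge> b exp (2 Re h(0))\<close> for
  every polynomial \<open>h\<close>, hence \<open>\<integral> exp u d\<mu> \<ge> b exp (\<integral> u d\<theta>/2\<pi>)\<close> for continuous \<open>u\<close> by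
  Stone--Weierstrass, and for bounded Borel \<open>u\<close> by regularity of measures. Taking for \<open>u\<close> a truncation of
  \<open>- log w\<close> (very negative on the set that carries the singular part) and removing the truncation by
  Fatou's lemma yields the nontrivial half of Szego's theorem: \<open>log w\<close> is integrable and its mean is
  at least \<open>log b\<close>. Now let \<open>g\<^sub>n = log (|P\<^sub>n|\<^sup>2 w / \<beta>\<^sub>n)\<close>. Since \<open>log |P\<^sub>n|\<close> has mean zero, the mean of
  \<open>g\<^sub>n\<close> is at least \<open>log b - log \<beta>\<^sub>n\<close>, while \<open>exp g\<^sub>n\<close> has mean at most \<open>1\<close>. Hence the nonnegative
  function \<open>exp g\<^sub>n - 1 - g\<^sub>n\<close> tends to zero in mean, and therefore so does \<open>|g\<^sub>n|\<close>. Taking \<open>m\<close>-th Fourier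
  coefficients gives the limit formula.

  The algebraic half estimates \<open>[z\<^sup>m] log P\<^sub>n\<close> uniformly in \<open>n\<close> (\<open>log_increment_sum_estimate\<close>). With
  \<open>B\<^sub>n = \<Phi>\<^sub>n / P\<^sub>n\<close> the recursion reads \<open>P\<^sub>n\<^sub>+\<^sub>1 = P\<^sub>n (1 - \<alpha>\<^sub>n z B\<^sub>n)\<close> and
  \<open>B\<^sub>n\<^sub>+\<^sub>1 (1 - \<alpha>\<^sub>n z B\<^sub>n) = z B\<^sub>n - cnj \<alpha>\<^sub>n\<close>, so \<open>- log P\<^sub>N\<close> is the sum over \<open>n < N\<close> of
  \<open>- log (1 - \<alpha>\<^sub>n z B\<^sub>n)\<close>. For \<open>n > k\<close> the \<open>k\<close>-th coefficient of \<open>B\<^sub>n\<close> is \<open>- cnj \<alpha>\<^bsub>n-1-k\<^esub>\<close> up to an error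
  that is cubic in \<open>\<alpha>\<^bsub>n-1\<^esub>, \<dots>, \<alpha>\<^bsub>n-1-k\<^esub>\<close>. Thus for \<open>n \<ge> m\<close> the \<open>n\<close>-th term contributes
  \<open>- \<alpha>\<^sub>n cnj \<alpha>\<^bsub>n-m\<^esub>\<close> up to a quartic error. The term \<open>n = m - 1\<close> contributes \<open>\<alpha>\<^bsub>m-1\<^esub>\<close> up to a quadratic
  error, because \<open>B\<^bsub>m-1\<^esub>\<close> deviates from \<open>z\<^bsup>m-1\<^esup>\<close> by terms of first order, and the terms \<open>n < m - 1\<close>
  are themselves quadratic.
\<close>

unbundle no vec_syntax

section \<open>Coefficients of the inverse Schur iterates\<close>

text \<open>The recursion satisfied by the power series of \<open>\<Phi>\<^sub>n / \<Phi>\<^sub>n\<^sup>*\<close>, with parameters \<open>a\<close> of modulus at most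
  one. It is written without quotients and determines \<open>B\<close> from \<open>a\<close>. All bounds below have constants
  that depend only on the index of the coefficient.\<close>
definition inverse_schur_iterates :: "(nat \<Rightarrow> complex) \<Rightarrow> (nat \<Rightarrow> complex fps) \<Rightarrow> bool" where
  "inverse_schur_iterates a B \<longleftrightarrow> B 0 = 1 \<and> (\<forall>n. cmod (a n) \<le> 1) \<and>
     (\<forall>n. B (Suc n) * (1 - fps_const (a n) * fps_X * B n) = fps_X * B n - fps_const (cnj (a n)))"

lemma cmod_fps_mult_nth_le:
  fixes f g :: "complex fps"
  assumes "\<And>i. i \<le> k \<Longrightarrow> cmod (f $ i) \<le> F" "\<And>i. i \<le> k \<Longrightarrow> cmod (g $ i) \<le> G"
  shows "cmod ((f * g) $ k) \<le> real (Suc k) * (F * G)"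
proof -
  have F0: "0 \<le> F" using assms(1)[of 0] norm_ge_zero order_trans by blast
  have "cmod ((f * g) $ k) \<le> (\<Sum>i=0..k. cmod (f $ i * g $ (k - i)))"
    unfolding fps_mult_nth by (rule norm_sum)
  also have "\<dots> \<le> (\<Sum>i=0..k. F * G)"
    by (intro sum_mono) (auto simp: norm_mult intro!: mult_mono assms F0)
  finally show ?thesis by simp
qed

context
  fixes a :: "nat \<Rightarrow> complex" and B :: "nat \<Rightarrow> complex fps"
  assumes iter: "inverse_schur_iterates a B"
begin



lemma iterate_0: "B 0 = 1"
  and coeff_le_1: "cmod (a n) \<le> 1"
  using iter by (auto simp: inverse_schur_iterates_def)

lemma iterate_Suc:
  "B (Suc n) = fps_X * (B n + fps_const (a n) * (B n * B (Suc n))) - fps_const (cnj (a n))"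
proof -
  have "B (Suc n) * (1 - fps_const (a n) * fps_X * B n) = fps_X * B n - fps_const (cnj (a n))"
    using iter by (auto simp: inverse_schur_iterates_def)
  thus ?thesis by (simp add: algebra_simps)
qed

lemma iterate_Suc_nth_0: "B (Suc n) $ 0 = - cnj (a n)"
  by (subst iterate_Suc) simp

lemma iterate_Suc_nth_Suc:
  "B (Suc n) $ Suc k = B n $ k + a n * (B n * B (Suc n)) $ k"
proof -
  have "B (Suc n) $ Suc k =
      (fps_X * (B n + fps_const (a n) * (B n * B (Suc n))) - fps_const (cnj (a n))) $ Suc k"
    using iterate_Suc by metis
  thus ?thesis by simp
qed

end

text \<open>Although \<open>|B\<^sub>n| \<le> 1\<close> in the disc gives the sharp bound \<open>1\<close>, a crude bound by induction on the index
  of the coefficient is enough and stays within formal power series.\<close>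
lemma iterate_nth_bounded:
  "\<exists>K\<ge>1. \<forall>a B n j. inverse_schur_iterates a B \<and> j \<le> k \<longrightarrow> cmod (B n $ j) \<le> K"
proof (induction k)
  case 0
  have "cmod (B n $ 0) \<le> 1" if "inverse_schur_iterates a B" for a B n
    using iterate_0[OF that] iterate_Suc_nth_0[OF that] coeff_le_1[OF that]
    by (cases n) auto
  thus ?case by (intro exI[of _ 1]) auto
next
  case (Suc k)
  then obtain K where K: "K \<ge> 1"
    "\<And>a B n j. inverse_schur_iterates a B \<Longrightarrow> j \<le> k \<Longrightarrow> cmod (B n $ j) \<le> K" by blast
  let ?K = "K + real (Suc k) * (K * K)"
  have "cmod (B n $ j) \<le> ?K" if "inverse_schur_iterates a B" "j \<le> Suc k" for a B n j
  proof (cases "j = Suc k")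
    case False
    hence "cmod (B n $ j) \<le> K" using that K by auto
    thus ?thesis using K(1) by (smt (verit) mult_nonneg_nonneg of_nat_0_le_iff)
  next
    case True
    show ?thesis
    proof (cases n)
      case 0
      thus ?thesis using iterate_0[OF that(1)] True K(1) by auto
    next
      case (Suc n')
      have "cmod ((B n' * B n) $ k) \<le> real (Suc k) * (K * K)"
        by (rule cmod_fps_mult_nth_le) (auto intro: K that)
      hence "cmod (a n' * (B n' * B n) $ k) \<le> 1 * (real (Suc k) * (K * K))"
        unfolding norm_mult by (intro mult_mono) (use coeff_le_1[OF that(1)] in auto)
      moreover have "cmod (B n' $ k) \<le> K" using K(2)[OF that(1)] by simp
      ultimately show ?thesis
        using iterate_Suc_nth_Suc[OF that(1), of n' k] True Suc norm_triangle_ineq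
        by (smt (verit))
    qed
  qed
  moreover have "?K \<ge> 1" using K(1) by (smt (verit) mult_nonneg_nonneg of_nat_0_le_iff)
  ultimately show ?case by blast
qed

text \<open>The sum of the moduli of the last \<open>l\<close> parameters before \<open>n\<close>. Subtraction of naturals truncates, so
  for \<open>l \<ge> n\<close> the window is all of \<open>{..<n}\<close>, which is what the case of few iterates needs.\<close>
definition window_sum :: "(nat \<Rightarrow> complex) \<Rightarrow> nat \<Rightarrow> nat \<Rightarrow> real" where
  "window_sum a n l = (\<Sum>j\<in>{n - l..<n}. cmod (a j))"

lemma window_sum_nonneg: "0 \<le> window_sum a n l"
  unfolding window_sum_def by (intro sum_nonneg) auto

lemma window_sum_Suc_Suc: "window_sum a (Suc n) (Suc l) = window_sum a n l + cmod (a n)"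
  unfolding window_sum_def by simp

lemma window_sum_mono: "l \<le> l' \<Longrightarrow> window_sum a n l \<le> window_sum a n l'"
  unfolding window_sum_def by (intro sum_mono2) auto

text \<open>For vanishing parameters \<open>B\<^sub>n = z\<^sup>n\<close>; the deviation from this is of first order.\<close>
lemma iterate_nth_deviation:
  "\<exists>L\<ge>0. \<forall>a B n. inverse_schur_iterates a B \<longrightarrow>
     cmod (B n $ k - (if n = k then 1 else 0)) \<le> L * window_sum a n (Suc k)"
proof (induction k)
  case 0
  have "cmod (B n $ 0 - (if n = 0 then 1 else 0)) \<le> 1 * window_sum a n 1"
    if "inverse_schur_iterates a B" for a B n
    using iterate_0[OF that] iterate_Suc_nth_0[OF that]
    by (cases n) (auto simp: window_sum_def)
  thus ?case by (intro exI[of _ 1]) auto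
next
  case (Suc k)
  then obtain L where L: "L \<ge> 0" "\<And>a B n. inverse_schur_iterates a B \<Longrightarrow>
     cmod (B n $ k - (if n = k then 1 else 0)) \<le> L * window_sum a n (Suc k)" by blast
  obtain K where K: "K \<ge> 1"
    "\<And>a B n j. inverse_schur_iterates a B \<Longrightarrow> j \<le> k \<Longrightarrow> cmod (B n $ j) \<le> K"
    using iterate_nth_bounded by meson
  define M where "M = L + real (Suc k) * (K * K)"
  have M: "L \<le> M" "real (Suc k) * (K * K) \<le> M" "0 \<le> M"
    using L K unfolding M_def by auto
  have "cmod (B n $ Suc k - (if n = Suc k then 1 else 0)) \<le> M * window_sum a n (Suc (Suc k))"
    if it: "inverse_schur_iterates a B" for a B n
  proof (cases n)
    case 0
    thus ?thesis using iterate_0[OF it] M window_sum_nonneg[of a n] by (auto simp: window_sum_def)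
  next
    case (Suc n')
    have "cmod ((B n' * B n) $ k) \<le> real (Suc k) * (K * K)"
      by (rule cmod_fps_mult_nth_le) (auto intro: K it)
    hence 1: "cmod (a n' * (B n' * B n) $ k) \<le> cmod (a n') * M"
      unfolding norm_mult using M(2) by (intro mult_left_mono) auto
    have "cmod (B n' $ k - (if n' = k then 1 else 0)) \<le> L * window_sum a n' (Suc k)"
      by (rule L(2)[OF it])
    also have "\<dots> \<le> M * window_sum a n' (Suc k)"
      by (intro mult_right_mono M window_sum_nonneg)
    finally have 2: "cmod (B n' $ k - (if n' = k then 1 else 0)) \<le> M * window_sum a n' (Suc k)" .
    have "B n $ Suc k - (if n = Suc k then 1 else 0) =
        (B n' $ k - (if n' = k then 1 else 0)) + a n' * (B n' * B n) $ k"
      using iterate_Suc_nth_Suc[OF it, of n' k] Suc by simp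
    hence "cmod (B n $ Suc k - (if n = Suc k then 1 else 0)) \<le>
        M * window_sum a n' (Suc k) + cmod (a n') * M"
      using 1 2 norm_triangle_ineq by (smt (verit))
    also have "\<dots> = M * window_sum a n (Suc (Suc k))"
      unfolding Suc window_sum_Suc_Suc by (simp add: algebra_simps)
    finally show ?thesis .
  qed
  thus ?case using M(3) by blast
qed

lemma iterate_nth_small:
  "\<exists>L\<ge>0. \<forall>a B n j. inverse_schur_iterates a B \<and> j \<le> k \<and> k < n \<longrightarrow>
     cmod (B n $ j) \<le> L * window_sum a n (Suc k)"
proof -
  have "\<forall>j. \<exists>L\<ge>0. \<forall>a B n. inverse_schur_iterates a B \<longrightarrow>
     cmod (B n $ j - (if n = j then 1 else 0)) \<le> L * window_sum a n (Suc j)"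
    using iterate_nth_deviation by blast
  then obtain L where L: "\<And>j. L j \<ge> 0" "\<And>j a B n. inverse_schur_iterates a B \<Longrightarrow>
     cmod (B n $ j - (if n = j then 1 else 0)) \<le> L j * window_sum a n (Suc j)"
    by metis
  have "cmod (B n $ j) \<le> (\<Sum>i\<le>k. L i) * window_sum a n (Suc k)"
    if "inverse_schur_iterates a B" "j \<le> k" "k < n" for a B n j
  proof -
    have "cmod (B n $ j) \<le> L j * window_sum a n (Suc j)"
      using L(2)[OF that(1), of n j] that by auto
    also have "\<dots> \<le> (\<Sum>i\<le>k. L i) * window_sum a n (Suc k)"
      using that L(1) by (intro mult_mono member_le_sum window_sum_mono window_sum_nonneg sum_nonneg) auto
    finally show ?thesis .
  qed
  moreover have "(\<Sum>i\<le>k. L i) \<ge> 0" using L(1) by (intro sum_nonneg) auto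
  ultimately show ?thesis by blast
qed

text \<open>The linear part of the \<open>k\<close>-th coefficient is the single term \<open>- cnj (a (n - 1 - k))\<close>. There is no
  quadratic term, because the recursion multiplies \<open>a n\<close> by products of two coefficients of index below \<open>n\<close>, each
  of which is of first order.\<close>
lemma iterate_nth_cubic:
  "\<exists>L\<ge>0. \<forall>a B n. inverse_schur_iterates a B \<and> k < n \<longrightarrow>
     cmod (B n $ k + cnj (a (n - Suc k))) \<le> L * window_sum a n (Suc k) ^ 3"
proof (induction k)
  case 0
  have "cmod (B n $ 0 + cnj (a (n - 1))) \<le> 0 * window_sum a n 1 ^ 3"
    if "inverse_schur_iterates a B" "0 < n" for a B n
    using iterate_Suc_nth_0[OF that(1), of "n - 1"] that(2) by simp
  thus ?case by (intro exI[of _ 0]) auto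
next
  case (Suc k)
  then obtain L where L: "L \<ge> 0" "\<And>a B n. inverse_schur_iterates a B \<Longrightarrow> k < n \<Longrightarrow>
     cmod (B n $ k + cnj (a (n - Suc k))) \<le> L * window_sum a n (Suc k) ^ 3" by blast
  obtain S where S: "S \<ge> 0" "\<And>a B n j. inverse_schur_iterates a B \<Longrightarrow> j \<le> k \<Longrightarrow> k < n \<Longrightarrow>
     cmod (B n $ j) \<le> S * window_sum a n (Suc k)"
    using iterate_nth_small by meson
  define M where "M = L + real (Suc k) * (S * S)"
  have "cmod (B n $ Suc k + cnj (a (n - Suc (Suc k)))) \<le> M * window_sum a n (Suc (Suc k)) ^ 3"
    if it: "inverse_schur_iterates a B" and n: "Suc k < n" for a B n
  proof -
    obtain n' where Suc: "n = Suc n'" using n by (cases n) auto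
    hence n': "k < n'" using n by simp
    define W where "W = window_sum a n (Suc (Suc k))"
    have W: "window_sum a n' (Suc k) \<le> W" "cmod (a n') \<le> W" "window_sum a n (Suc k) \<le> W" "0 \<le> W"
      using window_sum_nonneg[of a n'] window_sum_nonneg[of a n] window_sum_mono[of "Suc k" "Suc (Suc k)" a n]
      unfolding W_def Suc window_sum_Suc_Suc[of a n' "Suc k"] by auto
    have 0: "cmod ((B n' * B n) $ k) \<le> real (Suc k) * ((S * W) * (S * W))"
    proof (rule cmod_fps_mult_nth_le)
      fix i assume "i \<le> k"
      show "cmod (B n' $ i) \<le> S * W" "cmod (B n $ i) \<le> S * W"
        using S(2)[OF it \<open>i \<le> k\<close> n'] S(2)[OF it \<open>i \<le> k\<close>, of n] n W S(1)
        by (meson Suc_lessD mult_left_mono order_trans)+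
    qed
    have 1: "cmod (a n' * (B n' * B n) $ k) \<le> W * (real (Suc k) * ((S * W) * (S * W)))"
      unfolding norm_mult using W by (intro mult_mono 0) auto
    have "cmod (B n' $ k + cnj (a (n' - Suc k))) \<le> L * window_sum a n' (Suc k) ^ 3"
      by (rule L(2)[OF it n'])
    also have "\<dots> \<le> L * W ^ 3"
      by (intro mult_left_mono power_mono L W window_sum_nonneg)
    finally have 2: "cmod (B n' $ k + cnj (a (n' - Suc k))) \<le> L * W ^ 3" .
    have "B n $ Suc k + cnj (a (n - Suc (Suc k))) =
        (B n' $ k + cnj (a (n' - Suc k))) + a n' * (B n' * B n) $ k"
      using iterate_Suc_nth_Suc[OF it, of n' k] Suc by simp
    hence "cmod (B n $ Suc k + cnj (a (n - Suc (Suc k)))) \<le>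
        L * W ^ 3 + W * (real (Suc k) * ((S * W) * (S * W)))"
      using 1 2 norm_triangle_ineq by (smt (verit))
    also have "\<dots> = M * W ^ 3"
      unfolding M_def by (simp add: algebra_simps power3_eq_cube)
    finally show ?thesis unfolding W_def .
  qed
  moreover have "0 \<le> M" using L S unfolding M_def by auto
  ultimately show ?case by blast
qed

text \<open>The derivative of \<open>- log (1 - a\<^sub>n z B\<^sub>n)\<close>. Using the logarithmic derivative avoids logarithms of
  formal power series; its coefficient at \<open>m - 1\<close> is \<open>m\<close> times the coefficient at \<open>m\<close> of the logarithm.\<close>
definition log_increment :: "(nat \<Rightarrow> complex) \<Rightarrow> (nat \<Rightarrow> complex fps) \<Rightarrow> nat \<Rightarrow> complex fps" where
  "log_increment a B n = fps_deriv (fps_const (a n) * fps_X * B n) *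
     inverse (1 - fps_const (a n) * fps_X * B n)"

lemma inverse_one_minus_nth_bounded:
  "\<exists>K\<ge>0. \<forall>a B n j. inverse_schur_iterates a B \<and> j \<le> k \<longrightarrow>
     cmod (inverse (1 - fps_const (a n) * fps_X * B n) $ j) \<le> K"
proof (induction k)
  case 0
  show ?case by (intro exI[of _ 1]) auto
next
  case (Suc k)
  then obtain G where G: "G \<ge> 0" "\<And>a B n j. inverse_schur_iterates a B \<Longrightarrow> j \<le> k \<Longrightarrow>
      cmod (inverse (1 - fps_const (a n) * fps_X * B n) $ j) \<le> G" by blast
  obtain K where K: "K \<ge> 1"
    "\<And>a B n j. inverse_schur_iterates a B \<Longrightarrow> j \<le> k \<Longrightarrow> cmod (B n $ j) \<le> K"
    using iterate_nth_bounded by meson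
  let ?M = "G + real (Suc k) * (K * G)"
  have "cmod (inverse (1 - fps_const (a n) * fps_X * B n) $ j) \<le> ?M"
    if it: "inverse_schur_iterates a B" and j: "j \<le> Suc k" for a B n j
  proof (cases "j = Suc k")
    case False
    hence "cmod (inverse (1 - fps_const (a n) * fps_X * B n) $ j) \<le> G" using j G(2)[OF it] by auto
    thus ?thesis using K(1) G(1) by (smt (verit) mult_nonneg_nonneg of_nat_0_le_iff)
  next
    case True
    define H where "H = inverse (1 - fps_const (a n) * fps_X * B n)"
    have "(1 - fps_const (a n) * fps_X * B n) * H = 1"
      unfolding H_def by (subst inverse_mult_eq_1') auto
    hence H: "H = 1 + fps_X * (fps_const (a n) * (B n * H))" by (simp add: algebra_simps)
    have "H $ Suc k = a n * (B n * H) $ k" by (subst H) simp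
    moreover have "cmod ((B n * H) $ k) \<le> real (Suc k) * (K * G)"
      by (rule cmod_fps_mult_nth_le) (auto simp: H_def intro: K G it)
    hence "cmod (a n * (B n * H) $ k) \<le> 1 * (real (Suc k) * (K * G))"
      unfolding norm_mult by (intro mult_mono) (use coeff_le_1[OF it] in auto)
    ultimately show ?thesis using True G(1) unfolding H_def by auto
  qed
  moreover have "?M \<ge> 0" using G K by auto
  ultimately show ?case by blast
qed

text \<open>With \<open>u = a\<^sub>n z B\<^sub>n\<close>, this is \<open>u' / (1 - u) = u' + u u' / (1 - u)\<close>: a main term that is linear in \<open>B\<^sub>n\<close>
  and a remainder with the factor \<open>a\<^sub>n\<^sup>2\<close>.\<close>
lemma log_increment_nth:
  assumes m: "m \<ge> 1"
  shows "log_increment a B n $ (m - 1) = of_nat m * a n * B n $ (m - 1) +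
     (a n)\<^sup>2 * (if m = 1 then 0 else (B n * (fps_deriv (fps_X * B n) * inverse (1 - fps_const (a n) * fps_X * B n))) $ (m - 2))"
proof -
  define H where "H = inverse (1 - fps_const (a n) * fps_X * B n)"
  have "(1 - fps_const (a n) * fps_X * B n) * H = 1"
    unfolding H_def by (subst inverse_mult_eq_1') auto
  hence H: "H = 1 + fps_X * (fps_const (a n) * (B n * H))" by (simp add: algebra_simps)
  have u: "fps_deriv (fps_const (a n) * fps_X * B n) = fps_const (a n) * fps_deriv (fps_X * B n)"
    by (simp only: mult.assoc) (simp add: algebra_simps)
  have "log_increment a B n = fps_const (a n) * fps_deriv (fps_X * B n) * H"
    unfolding log_increment_def H_def u ..
  also have "\<dots> = fps_const (a n) * fps_deriv (fps_X * B n) * (1 + fps_X * (fps_const (a n) * (B n * H)))"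
    using H by metis
  also have "\<dots> = fps_const (a n) * fps_deriv (fps_X * B n) +
      fps_X * (fps_const ((a n)\<^sup>2) * (B n * (fps_deriv (fps_X * B n) * H)))"
    by (simp add: algebra_simps power2_eq_square flip: fps_const_mult)
  finally have D: "log_increment a B n = \<dots>" .
  obtain k where k: "m = Suc k" using m by (cases m) auto
  have 1: "(fps_const (a n) * fps_deriv (fps_X * B n)) $ k = of_nat m * a n * B n $ k"
    by (simp add: k del: fps_deriv_mult)
  show ?thesis
    unfolding D using 1 unfolding H_def k by (cases k) (simp_all del: fps_deriv_mult)
qed

section \<open>Estimate of the logarithmic derivative\<close>

lemma sum_power4_le:
  fixes f :: "'a \<Rightarrow> real"
  shows "(\<Sum>i\<in>A. f i) ^ 4 \<le> real (card A) ^ 3 * (\<Sum>i\<in>A. f i ^ 4)"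
proof -
  have "(\<Sum>i\<in>A. f i) ^ 4 = ((\<Sum>i\<in>A. f i)\<^sup>2)\<^sup>2" by simp
  also have "\<dots> \<le> ((\<Sum>i\<in>A. (f i)\<^sup>2) * real (card A))\<^sup>2"
    by (intro power_mono sum_squared_le_sum_of_squares) auto
  also have "\<dots> = real (card A) ^ 2 * (\<Sum>i\<in>A. (f i)\<^sup>2)\<^sup>2" by (simp add: power_mult_distrib)
  also have "\<dots> \<le> real (card A) ^ 2 * ((\<Sum>i\<in>A. ((f i)\<^sup>2)\<^sup>2) * real (card A))"
    by (intro mult_left_mono sum_squared_le_sum_of_squares) auto
  finally show ?thesis by (simp add: power3_eq_cube power2_eq_square power4_eq_xxxx algebra_simps)
qed

lemma log_increment_remainder_bound:
  fixes m :: nat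
  shows "\<exists>K\<ge>0. \<forall>a B n. inverse_schur_iterates a B \<longrightarrow> 
     cmod ((B n * (fps_deriv (fps_X * B n) * inverse (1 - fps_const (a n) * fps_X * B n))) $ m) \<le> K"
proof -
  obtain K where K: "K \<ge> 1"
    "\<And>a B n j. inverse_schur_iterates a B \<Longrightarrow> j \<le> m \<Longrightarrow> cmod (B n $ j) \<le> K"
    using iterate_nth_bounded by meson
  obtain G where G: "G \<ge> 0" "\<And>a B n j. inverse_schur_iterates a B \<Longrightarrow> j \<le> m \<Longrightarrow>
      cmod (inverse (1 - fps_const (a n) * fps_X * B n) $ j) \<le> G"
    using inverse_one_minus_nth_bounded by meson
  let ?E = "real (Suc m) * (real (Suc m) * K * G)"
  have "cmod ((B n * (fps_deriv (fps_X * B n) * inverse (1 - fps_const (a n) * fps_X * B n))) $ m)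
     \<le> real (Suc m) * (K * ?E)" if it: "inverse_schur_iterates a B" for a B n
  proof (rule cmod_fps_mult_nth_le)
    fix i assume i: "i \<le> m"
    show "cmod (B n $ i) \<le> K" using K it i by auto
    have "cmod ((fps_deriv (fps_X * B n) * inverse (1 - fps_const (a n) * fps_X * B n)) $ i)
        \<le> real (Suc i) * (real (Suc m) * K * G)"
    proof (rule cmod_fps_mult_nth_le)
      fix j assume j: "j \<le> i"
      have "cmod (fps_deriv (fps_X * B n) $ j) = real (Suc j) * cmod (B n $ j)"
        by (simp add: norm_mult del: fps_deriv_mult of_nat_Suc of_nat_add)
      also have "\<dots> \<le> real (Suc m) * K" using i j K(2)[OF it, of j n] K(1) by (intro mult_mono) auto
      finally show "cmod (fps_deriv (fps_X * B n) $ j) \<le> real (Suc m) * K" .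
      show "cmod (inverse (1 - fps_const (a n) * fps_X * B n) $ j) \<le> G"
        using G(2)[OF it, of j n] i j by simp
    qed
    also have "\<dots> \<le> ?E" using i K G by (intro mult_right_mono) auto
    finally show "cmod ((fps_deriv (fps_X * B n) * inverse (1 - fps_const (a n) * fps_X * B n)) $ i) \<le> ?E" .
  qed
  moreover have "real (Suc m) * (K * ?E) \<ge> 0" using K G by auto
  ultimately show ?thesis by blast
qed

lemma log_increment_remainder_small:
  fixes m :: nat
  shows "\<exists>K\<ge>0. \<forall>a B n. inverse_schur_iterates a B \<and> m < n \<longrightarrow> 
     cmod ((B n * (fps_deriv (fps_X * B n) * inverse (1 - fps_const (a n) * fps_X * B n))) $ m)
       \<le> K * (window_sum a n (Suc m))\<^sup>2"
proof -
  obtain K where K: "K \<ge> 0"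
    "\<And>a B n j. inverse_schur_iterates a B \<Longrightarrow> j \<le> m \<Longrightarrow> m < n \<Longrightarrow>
       cmod (B n $ j) \<le> K * window_sum a n (Suc m)"
    using iterate_nth_small by meson
  obtain G where G: "G \<ge> 0" "\<And>a B n j. inverse_schur_iterates a B \<Longrightarrow> j \<le> m \<Longrightarrow>
      cmod (inverse (1 - fps_const (a n) * fps_X * B n) $ j) \<le> G"
    using inverse_one_minus_nth_bounded by meson
  let ?M = "real (Suc m) * (K * (real (Suc m) * (real (Suc m) * K * G)))"
  have "cmod ((B n * (fps_deriv (fps_X * B n) * inverse (1 - fps_const (a n) * fps_X * B n))) $ m)
     \<le> ?M * (window_sum a n (Suc m))\<^sup>2" if it: "inverse_schur_iterates a B" and n: "m < n" for a B n
  proof -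
    define W where "W = window_sum a n (Suc m)"
    have W: "W \<ge> 0" unfolding W_def by (rule window_sum_nonneg)
    let ?E = "real (Suc m) * (real (Suc m) * (K * W) * G)"
    have "cmod ((B n * (fps_deriv (fps_X * B n) * inverse (1 - fps_const (a n) * fps_X * B n))) $ m)
     \<le> real (Suc m) * ((K * W) * ?E)"
    proof (rule cmod_fps_mult_nth_le)
      fix i assume i: "i \<le> m"
      show "cmod (B n $ i) \<le> K * W" using K it i n unfolding W_def by auto
      have "cmod ((fps_deriv (fps_X * B n) * inverse (1 - fps_const (a n) * fps_X * B n)) $ i)
          \<le> real (Suc i) * (real (Suc m) * (K * W) * G)"
      proof (rule cmod_fps_mult_nth_le)
        fix j assume j: "j \<le> i"
        have "cmod (fps_deriv (fps_X * B n) $ j) = real (Suc j) * cmod (B n $ j)"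
          by (simp add: norm_mult del: fps_deriv_mult of_nat_Suc of_nat_add)
        also have "\<dots> \<le> real (Suc m) * (K * W)"
          using i j n K(2)[OF it, of j n] K(1) W by (intro mult_mono) (auto simp: W_def)
        finally show "cmod (fps_deriv (fps_X * B n) $ j) \<le> real (Suc m) * (K * W)" .
        show "cmod (inverse (1 - fps_const (a n) * fps_X * B n) $ j) \<le> G"
          using G(2)[OF it, of j n] i j by simp
      qed
      also have "\<dots> \<le> ?E" using i K G W by (intro mult_right_mono) auto
      finally show "cmod ((fps_deriv (fps_X * B n) * inverse (1 - fps_const (a n) * fps_X * B n)) $ i) \<le> ?E" .
    qed
    thus ?thesis by (simp add: W_def power2_eq_square algebra_simps)
  qed
  moreover have "?M \<ge> 0" using K G by auto
  ultimately show ?thesis by blast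
qed

text \<open>The terms with \<open>n < m\<close>, where the errors are only quadratic.\<close>
lemma log_increment_early:
  fixes m :: nat
  assumes m: "m \<ge> 1"
  shows "\<exists>C\<ge>0. \<forall>a B n. inverse_schur_iterates a B \<and> n < m \<longrightarrow>
     cmod (log_increment a B n $ (m - 1) - of_nat m * (if n = m - 1 then a n else 0))
       \<le> C * (\<Sum>k<m. (cmod (a k))\<^sup>2)"
proof -
  obtain L where L: "L \<ge> 0" "\<And>a B n. inverse_schur_iterates a B \<Longrightarrow>
     cmod (B n $ (m - 1) - (if n = m - 1 then 1 else 0)) \<le> L * window_sum a n (Suc (m - 1))"
    using iterate_nth_deviation by meson
  obtain K where K: "K \<ge> 0" "\<And>a B n. inverse_schur_iterates a B \<Longrightarrow>
     cmod ((B n * (fps_deriv (fps_X * B n) * inverse (1 - fps_const (a n) * fps_X * B n))) $ (m - 2)) \<le> K"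
    using log_increment_remainder_bound by meson
  define C where "C = real m * L * real m + K"
  have "cmod (log_increment a B n $ (m - 1) - of_nat m * (if n = m - 1 then a n else 0))
       \<le> C * (\<Sum>k<m. (cmod (a k))\<^sup>2)" if it: "inverse_schur_iterates a B" and n: "n < m" for a B n
  proof -
    define E where "E = (if m = 1 then 0 else (B n * (fps_deriv (fps_X * B n) * inverse (1 - fps_const (a n) * fps_X * B n))) $ (m - 2))"
    define S where "S = (\<Sum>k<m. (cmod (a k))\<^sup>2)"
    define T where "T = (\<Sum>k<m. cmod (a k))"
    have aT: "cmod (a n) \<le> T" unfolding T_def by (rule member_le_sum) (use n in auto)
    have aS: "(cmod (a n))\<^sup>2 \<le> S" unfolding S_def by (rule member_le_sum) (use n in auto)
    have TS: "T\<^sup>2 \<le> S * real m"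
      unfolding T_def S_def using sum_squared_le_sum_of_squares[of "\<lambda>k. cmod (a k)" "{..<m}"] by simp
    have T0: "0 \<le> T" unfolding T_def by (intro sum_nonneg) auto
    have WT: "window_sum a n (Suc (m - 1)) \<le> T"
      unfolding window_sum_def T_def using n by (intro sum_mono2) auto
    have E: "cmod E \<le> K" using K it unfolding E_def by auto
    have "log_increment a B n $ (m - 1) - of_nat m * (if n = m - 1 then a n else 0) =
        of_nat m * a n * (B n $ (m - 1) - (if n = m - 1 then 1 else 0)) + (a n)\<^sup>2 * E"
      unfolding log_increment_nth[OF m] E_def[symmetric] by (simp add: algebra_simps)
    also have "cmod \<dots> \<le> real m * (cmod (a n) * cmod (B n $ (m - 1) - (if n = m - 1 then 1 else 0)))
        + (cmod (a n))\<^sup>2 * cmod E"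
      by (rule order_trans[OF norm_triangle_ineq]) (simp add: norm_mult norm_power)
    also have "\<dots> \<le> real m * (T * (L * T)) + S * K"
    proof (intro add_mono mult_left_mono mult_mono)
      show "cmod (B n $ (m - 1) - (if n = m - 1 then 1 else 0)) \<le> L * T"
        using L(2)[OF it, of n] mult_left_mono[OF WT L(1)] by linarith
    qed (use aT aS E T0 in \<open>auto simp: S_def intro: sum_nonneg\<close>)
    also have "real m * (T * (L * T)) = real m * L * T\<^sup>2" by (simp add: power2_eq_square)
    also have "\<dots> \<le> real m * L * (S * real m)" by (intro mult_left_mono TS) (use L in auto)
    finally show ?thesis unfolding C_def S_def[symmetric] by (simp add: algebra_simps)
  qed
  moreover have "C \<ge> 0" using L K unfolding C_def by auto
  ultimately show ?thesis by blast
qed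

text \<open>The terms with \<open>n \<ge> m\<close>, where the errors are quartic.\<close>
lemma log_increment_late:
  fixes m :: nat
  assumes m: "m \<ge> 1"
  shows "\<exists>C\<ge>0. \<forall>a B n. inverse_schur_iterates a B \<and> m \<le> n \<longrightarrow>
     cmod (log_increment a B n $ (m - 1) + of_nat m * (a n * cnj (a (n - m))))
       \<le> C * (\<Sum>k\<in>{n-m..n}. cmod (a k) ^ 4)"
proof -
  obtain L where L: "L \<ge> 0" "\<And>a B n. inverse_schur_iterates a B \<Longrightarrow> m - 1 < n \<Longrightarrow>
     cmod (B n $ (m - 1) + cnj (a (n - Suc (m - 1)))) \<le> L * window_sum a n (Suc (m - 1)) ^ 3"
    using iterate_nth_cubic by meson
  obtain K where K: "K \<ge> 0" "\<And>a B n. inverse_schur_iterates a B \<Longrightarrow> m - 2 < n \<Longrightarrow>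
     cmod ((B n * (fps_deriv (fps_X * B n) * inverse (1 - fps_const (a n) * fps_X * B n))) $ (m - 2))
       \<le> K * (window_sum a n (Suc (m - 2)))\<^sup>2"
    using log_increment_remainder_small by meson
  define C where "C = (real m * L + K) * real (Suc m) ^ 3"
  have "cmod (log_increment a B n $ (m - 1) + of_nat m * (a n * cnj (a (n - m))))
       \<le> C * (\<Sum>k\<in>{n-m..n}. cmod (a k) ^ 4)" if it: "inverse_schur_iterates a B" and n: "m \<le> n" for a B n
  proof -
    define E where "E = (if m = 1 then 0 else (B n * (fps_deriv (fps_X * B n) * inverse (1 - fps_const (a n) * fps_X * B n))) $ (m - 2))"
    define W where "W = (\<Sum>k\<in>{n-m..n}. cmod (a k))"
    have W0: "0 \<le> W" unfolding W_def by (intro sum_nonneg) auto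
    have aW: "cmod (a n) \<le> W" unfolding W_def by (rule member_le_sum) auto
    have wW: "window_sum a n l \<le> W" if "l \<le> m" for l
      unfolding window_sum_def W_def using that by (intro sum_mono2) auto
    have E: "cmod E \<le> K * W\<^sup>2"
    proof (cases "m = 1")
      case True
      thus ?thesis using K(1) unfolding E_def by simp
    next
      case False
      have "cmod E \<le> K * (window_sum a n (Suc (m - 2)))\<^sup>2"
        using False K(2)[OF it, of n] m n unfolding E_def by simp
      also have "\<dots> \<le> K * W\<^sup>2"
        by (intro mult_left_mono power_mono wW window_sum_nonneg K) (use m False in auto)
      finally show ?thesis .
    qed
    have D: "cmod (B n $ (m - 1) + cnj (a (n - m))) \<le> L * W ^ 3"
    proof -
      have "cmod (B n $ (m - 1) + cnj (a (n - m))) \<le> L * window_sum a n m ^ 3"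
        using L(2)[OF it, of n] m n by simp
      also have "\<dots> \<le> L * W ^ 3"
        by (intro mult_left_mono power_mono wW window_sum_nonneg L) auto
      finally show ?thesis .
    qed
    have "log_increment a B n $ (m - 1) + of_nat m * (a n * cnj (a (n - m))) =
        of_nat m * a n * (B n $ (m - 1) + cnj (a (n - m))) + (a n)\<^sup>2 * E"
      unfolding log_increment_nth[OF m] E_def[symmetric] by (simp add: algebra_simps)
    also have "cmod \<dots> \<le> real m * (cmod (a n) * cmod (B n $ (m - 1) + cnj (a (n - m))))
        + (cmod (a n))\<^sup>2 * cmod E"
      by (rule order_trans[OF norm_triangle_ineq]) (simp add: norm_mult norm_power)
    also have "\<dots> \<le> real m * (W * (L * W ^ 3)) + W\<^sup>2 * (K * W\<^sup>2)"
      by (intro add_mono mult_left_mono mult_mono D E aW power_mono) (use W0 in auto)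
    also have "\<dots> = (real m * L + K) * W ^ 4"
      by (simp add: power4_eq_xxxx power2_eq_square power3_eq_cube algebra_simps)
    also have "\<dots> \<le> (real m * L + K) * (real (Suc m) ^ 3 * (\<Sum>k\<in>{n-m..n}. cmod (a k) ^ 4))"
    proof (intro mult_left_mono)
      have "card {n-m..n} = Suc m" using n by auto
      thus "W ^ 4 \<le> real (Suc m) ^ 3 * (\<Sum>k\<in>{n-m..n}. cmod (a k) ^ 4)"
        unfolding W_def using sum_power4_le[of "\<lambda>k. cmod (a k)" "{n-m..n}"] by simp
    qed (use L K in auto)
    finally show ?thesis unfolding C_def by (simp add: algebra_simps)
  qed
  moreover have "C \<ge> 0" using L K unfolding C_def by auto
  ultimately show ?thesis by blast
qed

lemma sum_windows_le:
  fixes f :: "nat \<Rightarrow> real"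
  assumes "\<And>k. 0 \<le> f k"
  shows "(\<Sum>n=m..<N. \<Sum>k\<in>{n-m..n}. f k) \<le> real (Suc m) * (\<Sum>k<N. f k)"
proof -
  have "(\<Sum>n=m..<N. \<Sum>k\<in>{n-m..n}. f k) = (\<Sum>n=m..<N. \<Sum>i\<le>m. f (n - i))"
  proof (rule sum.cong[OF refl])
    fix n assume "n \<in> {m..<N}"
    thus "(\<Sum>k\<in>{n-m..n}. f k) = (\<Sum>i\<le>m. f (n - i))"
      by (intro sum.reindex_bij_witness[of _ "\<lambda>i. n - i" "\<lambda>k. n - k"]) auto
  qed
  also have "\<dots> = (\<Sum>i\<le>m. \<Sum>n=m..<N. f (n - i))" by (rule sum.swap)
  also have "\<dots> \<le> (\<Sum>i\<le>m. \<Sum>k<N. f k)"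
  proof (rule sum_mono)
    fix i assume i: "i \<in> {..m}"
    have "(\<Sum>n=m..<N. f (n - i)) = sum f ((\<lambda>n. n - i) ` {m..<N})"
      using i by (subst sum.reindex) (auto simp: inj_on_def)
    also have "\<dots> \<le> (\<Sum>k<N. f k)" by (rule sum_mono2) (use assms in auto)
    finally show "(\<Sum>n=m..<N. f (n - i)) \<le> (\<Sum>k<N. f k)" .
  qed
  finally show ?thesis by simp
qed

proposition log_increment_sum_estimate:
  fixes m :: nat
  assumes m: "m \<ge> 1"
  shows "\<exists>C\<ge>0. \<forall>a B N. inverse_schur_iterates a B \<and> m \<le> N \<longrightarrow>
     cmod ((\<Sum>n<N. log_increment a B n $ (m - 1)) / of_nat m
            - (a (m - 1) - (\<Sum>n=m..<N. a n * cnj (a (n - m)))))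
       \<le> C * ((\<Sum>k<m. (cmod (a k))\<^sup>2) + (\<Sum>k=m..<N. cmod (a k) ^ 4))"
proof -
  obtain C1 where C1: "C1 \<ge> 0" "\<And>a B n. inverse_schur_iterates a B \<Longrightarrow> n < m \<Longrightarrow>
     cmod (log_increment a B n $ (m - 1) - of_nat m * (if n = m - 1 then a n else 0))
       \<le> C1 * (\<Sum>k<m. (cmod (a k))\<^sup>2)"
    using log_increment_early[OF m] by meson
  obtain C2 where C2: "C2 \<ge> 0" "\<And>a B n. inverse_schur_iterates a B \<Longrightarrow> m \<le> n \<Longrightarrow>
     cmod (log_increment a B n $ (m - 1) + of_nat m * (a n * cnj (a (n - m))))
       \<le> C2 * (\<Sum>k\<in>{n-m..n}. cmod (a k) ^ 4)"
    using log_increment_late[OF m] by meson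
  define C where "C = real m * C1 + C2 * real (Suc m)"
  have C: "C \<ge> 0" using C1 C2 unfolding C_def by auto
  have "cmod ((\<Sum>n<N. log_increment a B n $ (m - 1)) / of_nat m
            - (a (m - 1) - (\<Sum>n=m..<N. a n * cnj (a (n - m)))))
       \<le> C * ((\<Sum>k<m. (cmod (a k))\<^sup>2) + (\<Sum>k=m..<N. cmod (a k) ^ 4))"
    if it: "inverse_schur_iterates a B" and N: "m \<le> N" for a B N
  proof -
    define S where "S = (\<Sum>k<m. (cmod (a k))\<^sup>2)"
    define T where "T = (\<Sum>k=m..<N. cmod (a k) ^ 4)"
    let ?t = "\<lambda>n. log_increment a B n $ (m - 1)"
    have S0: "S \<ge> 0" unfolding S_def by (intro sum_nonneg) auto
    have split: "(\<Sum>n<N. g n) = (\<Sum>n<m. g n) + (\<Sum>n=m..<N. g n)" for g :: "nat \<Rightarrow> 'b::comm_monoid_add"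
      using N sum.atLeastLessThan_concat[of 0 m N g] by (simp add: atLeast0LessThan)
    have "(\<Sum>k<N. cmod (a k) ^ 4) \<le> S + T"
    proof -
      have "cmod (a k) ^ 4 \<le> (cmod (a k))\<^sup>2" for k
        using coeff_le_1[OF it, of k] by (intro power_decreasing) auto
      thus ?thesis unfolding split S_def T_def by (intro add_mono sum_mono) auto
    qed
    hence "real (Suc m) * (\<Sum>k<N. cmod (a k) ^ 4) \<le> real (Suc m) * (S + T)"
      by (rule mult_left_mono) simp
    moreover have "(\<Sum>n=m..<N. \<Sum>k\<in>{n-m..n}. cmod (a k) ^ 4) \<le> real (Suc m) * (\<Sum>k<N. cmod (a k) ^ 4)"
      by (rule sum_windows_le) simp
    ultimately have late: "(\<Sum>n=m..<N. \<Sum>k\<in>{n-m..n}. cmod (a k) ^ 4) \<le> real (Suc m) * (S + T)"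
      by linarith
    have "(\<Sum>n<m. of_nat m * (if n = m - 1 then a n else 0)) =
        of_nat m * (\<Sum>n<m. if n = m - 1 then a n else 0)" by (rule sum_distrib_left[symmetric])
    also have "(\<Sum>n<m. if n = m - 1 then a n else 0) = a (m - 1)" using m by simp
    finally have am: "(\<Sum>n<m. of_nat m * (if n = m - 1 then a n else 0)) = of_nat m * a (m - 1)" .
    have "(\<Sum>n<N. ?t n) - of_nat m * (a (m - 1) - (\<Sum>n=m..<N. a n * cnj (a (n - m)))) =
        ((\<Sum>n<m. ?t n) - of_nat m * a (m - 1)) +
        ((\<Sum>n=m..<N. ?t n) + of_nat m * (\<Sum>n=m..<N. a n * cnj (a (n - m))))"
    proof -
      have "x1 + x2 - M * (A - Y) = (x1 - M * A) + (x2 + M * Y)" for x1 x2 M A Y :: complex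
        by (simp add: algebra_simps)
      thus ?thesis unfolding split[of ?t] by blast
    qed
    also have "(\<Sum>n<m. ?t n) - of_nat m * a (m - 1) =
        (\<Sum>n<m. ?t n - of_nat m * (if n = m - 1 then a n else 0))"
      by (simp only: sum_subtractf am)
    also have "(\<Sum>n=m..<N. ?t n) + of_nat m * (\<Sum>n=m..<N. a n * cnj (a (n - m))) =
        (\<Sum>n=m..<N. ?t n + of_nat m * (a n * cnj (a (n - m))))"
      by (simp only: sum.distrib sum_distrib_left)
    finally have decomp: "(\<Sum>n<N. ?t n) - of_nat m * (a (m - 1) - (\<Sum>n=m..<N. a n * cnj (a (n - m)))) =
        (\<Sum>n<m. ?t n - of_nat m * (if n = m - 1 then a n else 0)) +
        (\<Sum>n=m..<N. ?t n + of_nat m * (a n * cnj (a (n - m))))" .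
    have "cmod ((\<Sum>n<N. ?t n) - of_nat m * (a (m - 1) - (\<Sum>n=m..<N. a n * cnj (a (n - m))))) \<le> (\<Sum>n<m. C1 * S) + (\<Sum>n=m..<N. C2 * (\<Sum>k\<in>{n-m..n}. cmod (a k) ^ 4))"
      unfolding decomp
    proof (rule order_trans[OF norm_triangle_ineq], rule add_mono)
      show "cmod (\<Sum>n<m. ?t n - of_nat m * (if n = m - 1 then a n else 0)) \<le> (\<Sum>n<m. C1 * S)"
        unfolding S_def by (rule sum_norm_le, rule C1(2)[OF it]) simp
      show "cmod (\<Sum>n=m..<N. ?t n + of_nat m * (a n * cnj (a (n - m))))
          \<le> (\<Sum>n=m..<N. C2 * (\<Sum>k\<in>{n-m..n}. cmod (a k) ^ 4))"
        by (rule sum_norm_le, rule C2(2)[OF it]) simp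
    qed
    also have "\<dots> = real m * C1 * S + C2 * (\<Sum>n=m..<N. \<Sum>k\<in>{n-m..n}. cmod (a k) ^ 4)"
      by (simp add: sum_distrib_left)
    also have "\<dots> \<le> real m * C1 * (S + T) + C2 * (real (Suc m) * (S + T))"
      by (intro add_mono mult_left_mono late C2) (auto simp: T_def C1 intro!: sum_nonneg)
    also have "\<dots> = C * (S + T)" unfolding C_def by (simp add: algebra_simps)
    finally have main: "cmod ((\<Sum>n<N. ?t n) - of_nat m * (a (m - 1) - (\<Sum>n=m..<N. a n * cnj (a (n - m))))) \<le> C * (S + T)" .
    have "(\<Sum>n<N. ?t n) / of_nat m - (a (m - 1) - (\<Sum>n=m..<N. a n * cnj (a (n - m)))) =
      ((\<Sum>n<N. ?t n) - of_nat m * (a (m - 1) - (\<Sum>n=m..<N. a n * cnj (a (n - m))))) / of_nat m"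
      using m by (simp add: field_simps)
    also have "cmod \<dots> \<le> cmod ((\<Sum>n<N. ?t n) - of_nat m * (a (m - 1) - (\<Sum>n=m..<N. a n * cnj (a (n - m))))) / 1"
      unfolding norm_divide using m by (intro divide_left_mono) auto
    finally show ?thesis using main unfolding S_def T_def by simp
  qed
  thus ?thesis using C by blast
qed

lemma log_derivative_telescope:
  assumes P0: "P 0 = 1"
    and P: "\<And>n. P (Suc n) = P n * (1 - fps_const (a n) * fps_X * B n)"
  shows "P N $ 0 = 1"
    and "- (fps_deriv (P N) * inverse (P N)) = (\<Sum>n<N. log_increment a B n)"
proof -
  have nz: "P n $ 0 = 1" for n by (induction n) (auto simp: P0 P)
  show "P N $ 0 = 1" by (rule nz)
  show "- (fps_deriv (P N) * inverse (P N)) = (\<Sum>n<N. log_increment a B n)"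
  proof (induction N)
    case (Suc N)
    define v where "v = 1 - fps_const (a N) * fps_X * B N"
    have v: "v $ 0 = 1" "inverse v * v = 1"
      unfolding v_def by (simp, subst inverse_mult_eq_1, auto)
    have PP: "inverse (P N) * P N = 1" using nz[of N] by (intro inverse_mult_eq_1) auto
    have dv: "fps_deriv v = - fps_deriv (fps_const (a N) * fps_X * B N)"
      unfolding v_def by (simp del: fps_deriv_mult)
    have incr: "log_increment a B N = - (fps_deriv v * inverse v)"
      unfolding log_increment_def v_def[symmetric] dv by (simp del: fps_deriv_mult)
    have regroup: "(p * dv + dp * v') * (q * r) = dv * r * (q * p) + dp * q * (r * v')"
      for p dv dp v' q r :: "complex fps" by (simp add: algebra_simps)
    have "fps_deriv (P (Suc N)) = P N * fps_deriv v + fps_deriv (P N) * v"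
      unfolding P v_def[symmetric] by (rule fps_deriv_mult)
    moreover have "inverse (P (Suc N)) = inverse (P N) * inverse v"
      unfolding P v_def[symmetric] by (rule fps_inverse_mult)
    ultimately have "fps_deriv (P (Suc N)) * inverse (P (Suc N)) =
        fps_deriv v * inverse v + fps_deriv (P N) * inverse (P N)"
      by (simp only: regroup PP v mult_1_right)
    hence "- (fps_deriv (P (Suc N)) * inverse (P (Suc N))) =
        - (fps_deriv (P N) * inverse (P N)) - fps_deriv v * inverse v"
      by simp
    also have "\<dots> = (\<Sum>n<Suc N. log_increment a B n)"
      by (simp only: Suc.IH incr sum.lessThan_Suc) simp
    finally show ?case .
  qed (simp add: P0)
qed

section \<open>Orthogonal polynomials on the unit circle\<close>

lemma cmod_symmetry_identity:
  fixes x y a :: complex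
  shows "(cmod (x - a * y))\<^sup>2 - (cmod (y - cnj a * x))\<^sup>2 = (1 - (cmod a)\<^sup>2) * ((cmod x)\<^sup>2 - (cmod y)\<^sup>2)"
  unfolding cmod_power2 by (simp add: power2_eq_square algebra_simps)

lemma mult_cnj_self: "z * cnj z = complex_of_real ((cmod z)\<^sup>2)"
  by (rule complex_norm_square[symmetric])

lemma degree_reversed_poly_le: "degree (reversed_poly p) \<le> degree p"
  unfolding reversed_poly_def using degree_reflect_poly_le[of "map_poly cnj p"]
  by (simp add: degree_map_poly)

lemma poly_reversed_poly_circle:
  "cmod z = 1 \<Longrightarrow> poly (reversed_poly p) z = z ^ degree p * cnj (poly p z)"
proof -
  assume z: "cmod z = 1"
  hence "z * cnj z = 1" by (simp add: mult_cnj_self)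
  moreover have nz: "z \<noteq> 0" using z by auto
  ultimately have "1 / cnj z = z" by (simp add: divide_eq_eq)
  thus ?thesis using nz poly_reversed_poly[of z p] by simp
qed

text \<open>The defining properties of \<^const>\<open>circle_prob_measure\<close> as a locale; it is used both for the measure \<open>\<mu>\<close>
  of the theorem and for normalised Lebesgue measure on the circle.\<close>
locale circle_measure = prob_space M for M :: "complex measure" +
  assumes sets_M [simp, measurable_cong]: "sets M = sets borel"
    and null_off_circle: "emeasure M (- sphere 0 1) = 0"
begin

lemma space_M [simp]: "space M = UNIV"
  using sets_eq_imp_space_eq[OF sets_M] by simp

lemma AE_circle: "AE z in M. cmod z = 1"
  by (rule AE_I[of _ _ "- sphere 0 1"]) (auto simp: null_off_circle)

lemma integrable_on_circle:
  fixes f :: "complex \<Rightarrow> 'b::{banach, second_countable_topology}"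
  assumes "f \<in> borel_measurable borel" "\<And>z. cmod z = 1 \<Longrightarrow> norm (f z) \<le> C"
  shows "integrable M f"
proof (rule integrable_const_bound)
  show "AE z in M. norm (f z) \<le> C"
    using AE_circle by eventually_elim (rule assms(2))
qed (use assms(1) in \<open>simp add: measurable_cong_sets[OF sets_M refl]\<close>)

lemma integrable_continuous:
  fixes f :: "complex \<Rightarrow> 'b::{banach, second_countable_topology}"
  assumes "continuous_on UNIV f"
  shows "integrable M f"
proof -
  have "compact (f ` sphere 0 1)"
    by (intro compact_continuous_image continuous_on_subset[OF assms]) auto
  then obtain C where "\<forall>x\<in>f ` sphere 0 1. norm x \<le> C"
    using compact_imp_bounded bounded_iff by metis
  thus ?thesis
    by (intro integrable_on_circle[of f C] borel_measurable_continuous_onI assms) auto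
qed

lemma integral_cong_circle:
  fixes f g :: "complex \<Rightarrow> 'b::{banach, second_countable_topology}"
  assumes "continuous_on UNIV f" "continuous_on UNIV g" "\<And>z. cmod z = 1 \<Longrightarrow> f z = g z"
  shows "(LINT z|M. f z) = (LINT z|M. g z)"
proof (rule integral_cong_AE)
  show "AE z in M. f z = g z" using AE_circle by eventually_elim (rule assms(3))
qed (simp_all add: measurable_cong_sets[OF sets_M refl] borel_measurable_continuous_onI assms)

text \<open>The inner product of \<open>L\<^sup>2(\<mu>)\<close> on polynomials, conjugate linear in the first argument as in
  \<^const>\<open>is_monic_OP\<close>.\<close>
definition ip :: "complex poly \<Rightarrow> complex poly \<Rightarrow> complex" where
  "ip p q = (LINT z|M. cnj (poly p z) * poly q z)"

text \<open>The squared norm of a polynomial in \<open>L\<^sup>2(\<mu>)\<close>.\<close>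
definition sqnorm :: "complex poly \<Rightarrow> real" where
  "sqnorm p = (LINT z|M. (cmod (poly p z))\<^sup>2)"

lemma cnj_integral: "cnj (LINT z|M. f z) = (LINT z|M. cnj (f z))"
  by simp

lemma integrable_ip [simp]: "integrable M (\<lambda>z. cnj (poly p z) * poly q z)"
  by (intro integrable_continuous continuous_intros)

lemma integrable_sqnorm [simp]: "integrable M (\<lambda>z. (cmod (poly p z))\<^sup>2)"
  by (intro integrable_continuous continuous_intros)

lemma ip_add_right: "ip p (q + r) = ip p q + ip p r"
  unfolding ip_def poly_add distrib_left by (rule Bochner_Integration.integral_add) simp_all

lemma ip_diff_right: "ip p (q - r) = ip p q - ip p r"
  unfolding ip_def poly_diff right_diff_distrib by (rule Bochner_Integration.integral_diff) simp_all

lemma ip_smult_right: "ip p (smult c q) = c * ip p q"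
  by (simp add: ip_def mult.left_commute)

lemma ip_commute: "ip p q = cnj (ip q p)"
  unfolding ip_def cnj_integral by (simp only: complex_cnj_mult complex_cnj_cnj mult.commute)

lemma ip_add_left: "ip (q + r) p = ip q p + ip r p"
  using ip_commute[of "q + r" p] ip_commute[of q p] ip_commute[of r p] by (simp add: ip_add_right)

lemma ip_diff_left: "ip (q - r) p = ip q p - ip r p"
  using ip_commute[of "q - r" p] ip_commute[of q p] ip_commute[of r p] by (simp add: ip_diff_right)

lemma ip_smult_left: "ip (smult c q) p = cnj c * ip q p"
  by (simp add: ip_def mult.assoc)

lemma ip_0 [simp]: "ip 0 p = 0" "ip p 0 = 0"
  by (simp_all add: ip_def)

lemma ip_self: "ip p p = of_real (sqnorm p)"
  unfolding ip_def sqnorm_def integral_complex_of_real[symmetric]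
  by (intro Bochner_Integration.integral_cong refl)
    (simp add: mult.commute[of "cnj _"] mult_cnj_self)

lemma ip_shift: "ip (pCons 0 p) (pCons 0 q) = ip p q"
  unfolding ip_def
proof (intro integral_cong_circle continuous_intros)
  fix z :: complex assume "cmod z = 1"
  hence "cnj z * z = 1" by (simp add: mult_cnj_self mult.commute)
  hence "cnj z * z * (cnj (poly p z) * poly q z) = cnj (poly p z) * poly q z" by simp
  thus "cnj (poly (pCons 0 p) z) * poly (pCons 0 q) z = cnj (poly p z) * poly q z"
    by (simp add: mult_ac)
qed

lemma sqnorm_nonneg: "0 \<le> sqnorm p"
  unfolding sqnorm_def by (rule Bochner_Integration.integral_nonneg) auto

lemma sqnorm_reversed: "sqnorm (reversed_poly p) = sqnorm p"
  unfolding sqnorm_def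
  by (intro integral_cong_circle continuous_intros)
    (simp add: poly_reversed_poly_circle norm_mult norm_power)

text \<open>The disjunct \<open>q = 0\<close> covers \<open>n = 0\<close>, where no polynomial has degree below \<open>n\<close>.\<close>
lemma is_monic_OP_orthogonal:
  assumes "is_monic_OP M n p" "q = 0 \<or> degree q < n"
  shows "ip q p = 0"
  using assms unfolding is_monic_OP_def ip_def by auto

text \<open>The reversed polynomial \<open>\<Phi>\<^sub>n\<^sup>*\<close> is orthogonal to \<open>z, \<dots>, z\<^sup>n\<close>.\<close>
lemma ip_reversed_monic_OP:
  assumes p: "is_monic_OP M n p" and q: "degree q \<le> n"
  shows "ip q (reversed_poly p) = cnj (poly q 0) * of_real (sqnorm p)"
proof -
  have n: "degree p = n" "coeff p n = 1" using p by (auto simp: is_monic_OP_def)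
  obtain c r where qcr: "q = pCons c r" by (cases q)
  have "ip [:1:] (reversed_poly p) = cnj (ip (monom 1 n) p)"
    unfolding ip_def cnj_integral
    by (intro integral_cong_circle continuous_intros)
      (simp add: poly_reversed_poly_circle n poly_monom)
  also have "ip (monom 1 n) p = ip p p + ip (monom 1 n - p) p" by (simp add: ip_diff_left)
  also have "ip (monom 1 n - p) p = 0"
  proof (rule is_monic_OP_orthogonal[OF p])
    have "degree (monom 1 n - p) \<le> n" using n by (intro degree_diff_le) (auto simp: degree_monom_le)
    moreover have "coeff (monom 1 n - p) n = 0" using n by simp
    ultimately show "monom 1 n - p = 0 \<or> degree (monom 1 n - p) < n"
      using eq_zero_or_degree_less by metis
  qed
  finally have 1: "ip [:1:] (reversed_poly p) = of_real (sqnorm p)" by (simp add: ip_self)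
  have 2: "ip (pCons 0 r) (reversed_poly p) = 0"
  proof (cases "r = 0")
    case False
    hence r: "degree r < n" using q qcr by auto
    \<comment> \<open>on the circle \<open>s = z\<^bsup>n-1\<^esup> cnj r\<close>; the power of \<open>z\<close> makes up for \<open>degree r < n - 1\<close>\<close>
    define s where "s = monom 1 (n - 1 - degree r) * reversed_poly r"
    have "degree s \<le> (n - 1 - degree r) + degree (reversed_poly r)"
      unfolding s_def by (rule order_trans[OF degree_mult_le]) (simp add: degree_monom_le)
    also have "\<dots> \<le> (n - 1 - degree r) + degree r"
      using degree_reversed_poly_le[of r] by simp
    finally have s: "degree s < n" using r by simp
    have "ip (pCons 0 r) (reversed_poly p) = cnj (ip s p)"
      unfolding ip_def cnj_integral
    proof (intro integral_cong_circle continuous_intros)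
      fix z :: complex assume z: "cmod z = 1"
      have zz: "cnj z * z = 1" using z by (simp add: mult_cnj_self mult.commute)
      have "z ^ (n - 1 - degree r) * z ^ degree r = z ^ (n - 1)"
        using r by (simp flip: power_add)
      hence sz: "poly s z = z ^ (n - 1) * cnj (poly r z)"
        using z by (simp add: s_def poly_monom poly_reversed_poly_circle mult.assoc[symmetric])
      have "z ^ n = z * z ^ (n - 1)" using r by (cases n) auto
      hence "cnj z * z ^ n = z ^ (n - 1)" using zz by (simp add: mult.assoc[symmetric])
      thus "cnj (poly (pCons 0 r) z) * poly (reversed_poly p) z = cnj (cnj (poly s z) * poly p z)"
        using z by (simp add: sz poly_reversed_poly_circle n mult_ac)
    qed
    thus ?thesis using is_monic_OP_orthogonal[OF p] s by simp
  qed simp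
  have "q = smult c [:1:] + pCons 0 r" using qcr by simp
  hence "ip q (reversed_poly p) = cnj c * ip [:1:] (reversed_poly p) + ip (pCons 0 r) (reversed_poly p)"
    by (simp only: ip_add_left ip_smult_left)
  thus ?thesis using 1 2 qcr by simp
qed

end

locale nontrivial_circle_measure = circle_measure +
  assumes nontrivial: "nontrivial_measure M"
begin

lemma sqnorm_pos:
  assumes "p \<noteq> 0"
  shows "0 < sqnorm p"
proof (rule ccontr)
  assume "\<not> 0 < sqnorm p"
  hence "sqnorm p = 0" using sqnorm_nonneg[of p] by simp
  hence "AE z in M. (cmod (poly p z))\<^sup>2 = 0"
    unfolding sqnorm_def by (subst (asm) Bochner_Integration.integral_nonneg_eq_0_iff_AE) auto
  hence AE: "AE z in M. z \<in> {z. poly p z = 0}" by simp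
  have fin: "finite {z. poly p z = 0}" using assms by (rule poly_roots_finite)
  hence op: "open (- {z. poly p z = 0})" by (simp add: finite_imp_closed open_Compl)
  have "emeasure M (- {z. poly p z = 0}) = 0"
    using AE op by (subst (asm) AE_iff_measurable[OF _ refl]) (auto simp: Compl_eq)
  hence "measure_support M \<subseteq> {z. poly p z = 0}"
    using op unfolding measure_support_def by force
  hence "finite (measure_support M)" using fin finite_subset by blast
  thus False using nontrivial by (simp add: nontrivial_measure_def)
qed

lemma is_monic_OP_unique:
  assumes p: "is_monic_OP M n p" and q: "is_monic_OP M n q"
  shows "p = q"
proof (rule ccontr)
  assume "p \<noteq> q"
  hence nz: "p - q \<noteq> 0" by simp
  have "degree (p - q) \<le> n" using p q by (intro degree_diff_le) (auto simp: is_monic_OP_def)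
  moreover have "coeff (p - q) n = 0" using p q by (auto simp: is_monic_OP_def)
  ultimately have "p - q = 0 \<or> degree (p - q) < n" using eq_zero_or_degree_less by metis
  hence "ip (p - q) p = 0" "ip (p - q) q = 0"
    using is_monic_OP_orthogonal p q by auto
  hence "ip (p - q) (p - q) = 0" by (simp add: ip_diff_right)
  thus False using sqnorm_pos[OF nz] by (simp add: ip_self)
qed

text \<open>The Szego recursion constructs the next orthogonal polynomial, which gives both existence and the
  recursion itself.\<close>
lemma is_monic_OP_Suc:
  assumes p: "is_monic_OP M n p"
  shows "\<exists>a. is_monic_OP M (Suc n) (pCons 0 p - smult (cnj a) (reversed_poly p))"
proof -
  have n: "degree p = n" "coeff p n = 1" using p by (auto simp: is_monic_OP_def)
  hence p0: "p \<noteq> 0" by auto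
  \<comment> \<open>the choice of \<open>a\<close> makes the new polynomial orthogonal to the constants\<close>
  define a where "a = cnj (ip [:1:] (pCons 0 p) / of_real (sqnorm p))"
  let ?q = "pCons 0 p - smult (cnj a) (reversed_poly p)"
  have a: "cnj a * of_real (sqnorm p) = ip [:1:] (pCons 0 p)"
    using sqnorm_pos[OF p0] by (simp add: a_def)
  have "degree (smult (cnj a) (reversed_poly p)) < Suc n"
    using degree_reversed_poly_le[of p] degree_smult_le[of "cnj a" "reversed_poly p"] n by linarith
  moreover have "degree (pCons 0 p) = Suc n" using n p0 by simp
  ultimately have deg: "degree ?q = Suc n"
    using degree_add_eq_left[of "- smult (cnj a) (reversed_poly p)" "pCons 0 p"] by simp
  have lead: "coeff ?q (Suc n) = 1"
    using n degree_reversed_poly_le[of p] by (simp add: coeff_eq_0)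
  have "ip q ?q = 0" if q: "degree q < Suc n" for q
  proof -
    obtain c r where qcr: "q = pCons c r" by (cases q)
    have "r = 0 \<or> degree r < n" using q qcr by (auto split: if_splits)
    hence r: "ip r p = 0" using is_monic_OP_orthogonal[OF p] by auto
    have "q = smult c [:1:] + pCons 0 r" using qcr by simp
    hence "ip q (pCons 0 p) = cnj c * ip [:1:] (pCons 0 p) + ip (pCons 0 r) (pCons 0 p)"
      by (simp only: ip_add_left ip_smult_left)
    hence "ip q (pCons 0 p) = cnj c * (cnj a * of_real (sqnorm p))"
      unfolding ip_shift r a by simp
    thus ?thesis
      using ip_reversed_monic_OP[OF p, of q] q qcr by (simp add: ip_diff_right ip_smult_right)
  qed
  hence "is_monic_OP M (Suc n) ?q" using deg lead unfolding is_monic_OP_def ip_def by simp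
  thus ?thesis by blast
qed

lemma is_monic_OP_monic_OP: "is_monic_OP M n (monic_OP M n)"
proof -
  have ex: "\<exists>p. is_monic_OP M n p"
  proof (induction n)
    case 0
    show ?case by (intro exI[of _ 1]) (simp add: is_monic_OP_def)
  next
    case (Suc n)
    thus ?case using is_monic_OP_Suc by blast
  qed
  then obtain p where p: "is_monic_OP M n p" by blast
  thus ?thesis unfolding monic_OP_def by (rule theI) (rule is_monic_OP_unique[OF _ p])
qed

text \<open>Short names for the monic orthogonal polynomials, their reversals, the Verblunsky coefficients and
  the squared norms of the orthogonal polynomials.\<close>
definition \<Phi> :: "nat \<Rightarrow> complex poly" where "\<Phi> n = monic_OP M n"
definition \<Phi>s :: "nat \<Rightarrow> complex poly" where "\<Phi>s n = reversed_poly (\<Phi> n)"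
definition \<alpha> :: "nat \<Rightarrow> complex" where "\<alpha> n = verblunsky M n"
definition \<beta> :: "nat \<Rightarrow> real" where "\<beta> n = sqnorm (\<Phi> n)"

lemma \<Phi>_OP: "is_monic_OP M n (\<Phi> n)" unfolding \<Phi>_def by (rule is_monic_OP_monic_OP)

lemma degree_\<Phi> [simp]: "degree (\<Phi> n) = n" and lead_\<Phi> [simp]: "coeff (\<Phi> n) n = 1"
  using \<Phi>_OP[of n] by (auto simp: is_monic_OP_def)

lemma \<Phi>_nz [simp]: "\<Phi> n \<noteq> 0" using lead_\<Phi>[of n] by fastforce

lemma degree_\<Phi>s: "degree (\<Phi>s n) \<le> n"
  using degree_reversed_poly_le[of "\<Phi> n"] by (simp add: \<Phi>s_def)

lemma poly_\<Phi>s_0 [simp]: "poly (\<Phi>s n) 0 = 1"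
proof -
  have "degree (map_poly cnj (\<Phi> n)) = n" by (simp add: degree_map_poly)
  thus ?thesis by (simp add: \<Phi>s_def reversed_poly_def coeff_map_poly)
qed

lemma \<Phi>_0 [simp]: "\<Phi> 0 = 1"
proof -
  have "is_monic_OP M 0 1" by (simp add: is_monic_OP_def)
  thus ?thesis using is_monic_OP_unique[OF \<Phi>_OP] by blast
qed

lemma \<Phi>s_0 [simp]: "\<Phi>s 0 = 1"
  by (simp add: \<Phi>s_def reversed_poly_def)

lemma \<Phi>_Suc: "\<Phi> (Suc n) = pCons 0 (\<Phi> n) - smult (cnj (\<alpha> n)) (\<Phi>s n)"
proof -
  obtain a where "is_monic_OP M (Suc n) (pCons 0 (\<Phi> n) - smult (cnj a) (\<Phi>s n))"
    using is_monic_OP_Suc[OF \<Phi>_OP] unfolding \<Phi>s_def by blast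
  hence a: "\<Phi> (Suc n) = pCons 0 (\<Phi> n) - smult (cnj a) (\<Phi>s n)"
    using is_monic_OP_unique[OF \<Phi>_OP] by blast
  have "\<alpha> n = a" unfolding \<alpha>_def verblunsky_def
  proof (rule the_equality)
    show "monic_OP M (Suc n) = [:0, 1:] * monic_OP M n - smult (cnj a) (reversed_poly (monic_OP M n))"
      using a by (simp add: \<Phi>_def \<Phi>s_def)
  next
    fix b
    assume "monic_OP M (Suc n) = [:0, 1:] * monic_OP M n - smult (cnj b) (reversed_poly (monic_OP M n))"
    hence "\<Phi> (Suc n) = pCons 0 (\<Phi> n) - smult (cnj b) (\<Phi>s n)" by (simp add: \<Phi>_def \<Phi>s_def)
    hence "smult (cnj b) (\<Phi>s n) = smult (cnj a) (\<Phi>s n)" using a by (simp add: algebra_simps)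
    hence "cnj b * poly (\<Phi>s n) 0 = cnj a * poly (\<Phi>s n) 0" by (metis poly_smult)
    thus "b = a" by simp
  qed
  thus ?thesis using a by simp
qed

lemma \<Phi>s_Suc: "\<Phi>s (Suc n) = \<Phi>s n - smult (\<alpha> n) (pCons 0 (\<Phi> n))"
proof -
  have "poly (\<Phi>s (Suc n)) z = poly (\<Phi>s n - smult (\<alpha> n) (pCons 0 (\<Phi> n))) z" for z
  proof (cases "z = 0")
    case True
    thus ?thesis by simp
  next
    case False
    have 1: "poly (\<Phi>s n) (1 / cnj z) = (1 / cnj z) ^ n * cnj (poly (\<Phi> n) z)"
      unfolding \<Phi>s_def using False by (subst poly_reversed_poly) auto
    have "poly (\<Phi>s (Suc n)) z = z ^ Suc n * cnj (poly (\<Phi> (Suc n)) (1 / cnj z))"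
      unfolding \<Phi>s_def using False by (subst poly_reversed_poly) auto
    also have "\<dots> = z ^ n * cnj (poly (\<Phi> n) (1 / cnj z)) - \<alpha> n * z * poly (\<Phi> n) z"
      unfolding \<Phi>_Suc using False by (simp add: 1 field_simps power_one_over)
    also have "z ^ n * cnj (poly (\<Phi> n) (1 / cnj z)) = poly (\<Phi>s n) z"
      unfolding \<Phi>s_def using False by (subst poly_reversed_poly) auto
    finally show ?thesis by (simp add: mult_ac)
  qed
  thus ?thesis by (simp add: poly_eq_poly_eq_iff[symmetric] fun_eq_iff)
qed

lemma \<beta>_pos: "0 < \<beta> n" unfolding \<beta>_def by (rule sqnorm_pos) simp

lemma \<beta>_0: "\<beta> 0 = 1"
  using prob_space by (simp add: \<beta>_def sqnorm_def)

lemma sqnorm_\<Phi>s: "sqnorm (\<Phi>s n) = \<beta> n"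
  by (simp add: \<Phi>s_def sqnorm_reversed \<beta>_def)

lemma \<beta>_Suc: "\<beta> (Suc n) = (1 - (cmod (\<alpha> n))\<^sup>2) * \<beta> n"
proof -
  have o: "ip (\<Phi>s n) (\<Phi> (Suc n)) = 0"
    using degree_\<Phi>s[of n] by (intro is_monic_OP_orthogonal[OF \<Phi>_OP]) auto
  hence o': "ip (\<Phi> (Suc n)) (\<Phi>s n) = 0" using ip_commute by (metis complex_cnj_zero)
  have e: "pCons 0 (\<Phi> n) = \<Phi> (Suc n) + smult (cnj (\<alpha> n)) (\<Phi>s n)" by (simp add: \<Phi>_Suc)
  have "of_real (\<beta> n) = ip (pCons 0 (\<Phi> n)) (pCons 0 (\<Phi> n))"
    by (simp only: ip_shift) (simp add: ip_self \<beta>_def)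
  also have "\<dots> = of_real (\<beta> (Suc n)) + \<alpha> n * cnj (\<alpha> n) * of_real (\<beta> n)"
    unfolding e by (simp only: ip_add_left ip_add_right ip_smult_left ip_smult_right o o')
      (simp add: ip_self sqnorm_\<Phi>s \<beta>_def[symmetric])
  also have "\<dots> = of_real (\<beta> (Suc n) + (cmod (\<alpha> n))\<^sup>2 * \<beta> n)"
    by (simp add: mult_cnj_self)
  finally have "\<beta> n = \<beta> (Suc n) + (cmod (\<alpha> n))\<^sup>2 * \<beta> n" using of_real_eq_iff by blast
  thus ?thesis by (simp add: algebra_simps)
qed

lemma cmod_\<alpha>: "cmod (\<alpha> n) < 1"
proof -
  have "0 < (1 - (cmod (\<alpha> n))\<^sup>2)" using \<beta>_Suc[of n] \<beta>_pos[of n] \<beta>_pos[of "Suc n"]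
    by (metis zero_less_mult_pos2)
  thus ?thesis by (simp add: power2_less_1_iff abs_square_less_1)
qed

lemma \<beta>_prod: "\<beta> n = (\<Prod>k<n. 1 - (cmod (\<alpha> k))\<^sup>2)"
  by (induction n) (simp_all add: \<beta>_0 \<beta>_Suc mult.commute)

text \<open>The extremal property: among polynomials of degree at most \<open>n\<close> with value \<open>1\<close> at the origin,
  \<open>\<Phi>\<^sub>n\<^sup>*\<close> has the least norm.\<close>
lemma \<Phi>s_minimal:
  assumes "degree q \<le> n"
  shows "(cmod (poly q 0))\<^sup>2 * \<beta> n \<le> sqnorm q"
proof -
  define c where "c = poly q 0"
  have 1: "ip q (\<Phi>s n) = cnj c * of_real (\<beta> n)"
    using ip_reversed_monic_OP[OF \<Phi>_OP assms] by (simp add: \<Phi>s_def \<beta>_def c_def)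
  hence 2: "ip (\<Phi>s n) q = c * of_real (\<beta> n)" by (subst ip_commute) simp
  \<comment> \<open>the distance from \<open>q\<close> to \<open>c \<Phi>\<^sub>n\<^sup>*\<close> is nonnegative\<close>
  have "of_real (sqnorm (q - smult c (\<Phi>s n))) =
      of_real (sqnorm q) - c * cnj c * of_real (\<beta> n)"
    unfolding ip_self[symmetric]
    by (simp add: ip_diff_left ip_diff_right ip_smult_left ip_smult_right 1 2)
      (simp add: ip_self sqnorm_\<Phi>s algebra_simps)
  also have "\<dots> = of_real (sqnorm q - (cmod c)\<^sup>2 * \<beta> n)"
    by (simp add: mult_cnj_self)
  finally have "sqnorm (q - smult c (\<Phi>s n)) = sqnorm q - (cmod c)\<^sup>2 * \<beta> n"
    using of_real_eq_iff by blast
  thus ?thesis using sqnorm_nonneg[of "q - smult c (\<Phi>s n)"] unfolding c_def by linarith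
qed

lemma \<Phi>s_dominates:
  assumes "cmod z \<le> 1"
  shows "cmod (poly (\<Phi> n) z) \<le> cmod (poly (\<Phi>s n) z) \<and> poly (\<Phi>s n) z \<noteq> 0"
proof (induction n)
  case 0
  show ?case by simp
next
  case (Suc n)
  define x where "x = poly (\<Phi>s n) z"
  define y where "y = z * poly (\<Phi> n) z"
  have "cmod y \<le> 1 * cmod (poly (\<Phi> n) z)"
    unfolding y_def norm_mult using assms by (intro mult_right_mono) auto
  hence yx: "cmod y \<le> cmod x" using Suc by (simp add: x_def)
  have x0: "cmod x > 0" using Suc by (simp add: x_def)
  have s: "poly (\<Phi>s (Suc n)) z = x - \<alpha> n * y" by (simp add: \<Phi>s_Suc x_def y_def)
  have p: "poly (\<Phi> (Suc n)) z = y - cnj (\<alpha> n) * x" by (simp add: \<Phi>_Suc x_def y_def)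
  have a1: "(cmod (\<alpha> n))\<^sup>2 \<le> 1" using cmod_\<alpha>[of n] by (simp add: power_le_one)
  have "(cmod y)\<^sup>2 \<le> (cmod x)\<^sup>2" using yx by (intro power_mono) auto
  hence "0 \<le> (1 - (cmod (\<alpha> n))\<^sup>2) * ((cmod x)\<^sup>2 - (cmod y)\<^sup>2)" using a1 by simp
  hence "(cmod (y - cnj (\<alpha> n) * x))\<^sup>2 \<le> (cmod (x - \<alpha> n * y))\<^sup>2"
    using cmod_symmetry_identity[of x "\<alpha> n" y] by linarith
  hence "cmod (y - cnj (\<alpha> n) * x) \<le> cmod (x - \<alpha> n * y)" by (rule power2_le_imp_le) simp
  moreover have "cmod (\<alpha> n * y) < cmod x"
  proof -
    have "cmod (\<alpha> n * y) \<le> cmod (\<alpha> n) * cmod x" unfolding norm_mult using yx by (intro mult_left_mono) auto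
    also have "\<dots> < 1 * cmod x" using cmod_\<alpha> x0 by (intro mult_strict_right_mono) auto
    finally show ?thesis by simp
  qed
  hence "x - \<alpha> n * y \<noteq> 0" by auto
  ultimately show ?case by (simp add: s p)
qed

lemma \<beta>_tendsto:
  assumes "summable (\<lambda>k. (cmod (\<alpha> k))\<^sup>2)"
  obtains b where "b > 0" "\<beta> \<longlonglongrightarrow> b" "\<And>n. b \<le> \<beta> n"
proof -
  let ?f = "\<lambda>k. 1 - (cmod (\<alpha> k))\<^sup>2"
  have pos: "0 < ?f k" for k using cmod_\<alpha>[of k] by (simp add: abs_square_less_1)
  have "abs_convergent_prod ?f" using assms by (subst abs_convergent_prod_conv_summable) simp
  hence conv: "convergent_prod ?f" by (rule abs_convergent_prod_imp_convergent_prod)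
  define b where "b = prodinf ?f"
  have "(\<lambda>n. \<Prod>k\<le>n. ?f k) \<longlonglongrightarrow> b" unfolding b_def by (rule convergent_prod_LIMSEQ[OF conv])
  hence "(\<lambda>n. \<beta> (Suc n)) \<longlonglongrightarrow> b" by (simp add: \<beta>_prod lessThan_Suc_atMost)
  hence lim: "\<beta> \<longlonglongrightarrow> b" by (simp add: filterlim_sequentially_Suc)
  have dec: "decseq \<beta>"
    by (rule decseq_SucI) (use \<beta>_pos in \<open>simp add: \<beta>_Suc mult_left_le_one_le less_imp_le cmod_\<alpha> power_le_one\<close>)
  have le: "b \<le> \<beta> n" for n using decseq_ge[OF dec lim] .
  have "b \<noteq> 0" unfolding b_def by (rule prodinf_nonzero[OF conv]) (use pos in \<open>metis less_irrefl\<close>)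
  moreover have "0 \<le> b" by (rule LIMSEQ_le_const[OF lim]) (use \<beta>_pos less_imp_le in blast)
  ultimately show ?thesis by (intro that[of b] lim le) simp
qed

end

section \<open>Lebesgue measure on the circle\<close>

lemma sets_angle_measure [simp, measurable_cong]: "sets angle_measure = sets borel"
  by (simp add: angle_measure_def)

lemma space_angle_measure [simp]: "space angle_measure = UNIV"
  by (simp add: angle_measure_def)

lemma prob_space_angle_measure: "prob_space angle_measure"
  unfolding angle_measure_def by (rule prob_space_uniform_measure) auto

interpretation angle: prob_space angle_measure
  by (rule prob_space_angle_measure)

lemma angle_measure_density:
  "angle_measure = density lborel (\<lambda>\<theta>. ennreal (indicator {0..<2*pi} \<theta> / (2 * pi)))"
  unfolding angle_measure_def uniform_measure_def
  by (intro arg_cong[where f = "density lborel"] ext)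
    (auto simp: indicator_def divide_ennreal[symmetric] zero_ennreal_def[symmetric])

lemma AE_angle_measure: "AE \<theta> in angle_measure. 0 \<le> \<theta> \<and> \<theta> < 2 * pi"
  unfolding angle_measure_def by (rule AE_uniform_measureI) auto

lemma integral_angle_measure_Icc:
  fixes f :: "real \<Rightarrow> 'a::euclidean_space"
  assumes [measurable]: "f \<in> borel_measurable borel"
  shows "(LINT \<theta>|angle_measure. f \<theta>) = (1 / (2 * pi)) *\<^sub>R (LINT \<theta>|lborel. indicator {0..2*pi} \<theta> *\<^sub>R f \<theta>)"
proof -
  have "(LINT \<theta>|angle_measure. f \<theta>) = (LINT \<theta>|lborel. (indicator {0..<2*pi} \<theta> / (2 * pi)) *\<^sub>R f \<theta>)"
    unfolding angle_measure_density by (rule integral_density) auto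
  also have "\<dots> = (LINT \<theta>|lborel. (1 / (2 * pi)) *\<^sub>R (indicator {0..2*pi} \<theta> *\<^sub>R f \<theta>))"
  proof (rule integral_cong_AE)
    have "AE \<theta> in lborel. \<theta> \<noteq> 2 * pi" by (rule AE_lborel_singleton)
    thus "AE \<theta> in lborel. (indicator {0..<2*pi} \<theta> / (2 * pi)) *\<^sub>R f \<theta> =
        (1 / (2 * pi)) *\<^sub>R (indicator {0..2*pi} \<theta> *\<^sub>R f \<theta>)"
      by eventually_elim (auto simp: indicator_def)
  qed auto
  finally show ?thesis by (simp only: integral_scaleR_right)
qed

lemma measurable_cis [measurable]: "cis \<in> borel_measurable borel"
  by (intro borel_measurable_continuous_onI continuous_intros)

lemma integral_cis_power: "(LINT \<theta>|angle_measure. cis \<theta> ^ k) = (if k = 0 then 1 else 0)"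
proof (cases "k = 0")
  case True
  thus ?thesis using angle.prob_space by simp
next
  case False
  let ?F = "\<lambda>\<theta>. cis (real k * \<theta>) / (\<i> * of_nat k)"
  have "(LINT \<theta>|lborel. indicator {0..2*pi} \<theta> *\<^sub>R cis (real k * \<theta>)) = ?F (2*pi) - ?F 0"
  proof (rule integral_FTC_Icc)
    fix x :: real
    have "((\<lambda>z. exp (\<i> * (of_nat k * z)) / (\<i> * of_nat k)) has_field_derivative
        exp (\<i> * (of_nat k * of_real x))) (at (of_real x))"
      using False by (auto intro!: derivative_eq_intros simp: algebra_simps)
    from has_vector_derivative_real_field[OF this]
    show "(?F has_vector_derivative cis (real k * x)) (at x within {0..2*pi})"
      by (simp add: cis_conv_exp)
  qed (auto intro!: continuous_intros)
  also have "\<dots> = 0"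
    using cis_multiple_2pi[of "real k"] by (simp add: mult.commute mult.left_commute)
  finally show ?thesis using False
    by (simp add: Complex.DeMoivre integral_angle_measure_Icc)
qed

text \<open>Normalised Lebesgue measure on the unit circle, as a measure on the complex plane.\<close>
definition circle_lebesgue :: "complex measure" where
  "circle_lebesgue = distr angle_measure borel cis"

lemma circle_measure_lebesgue: "circle_measure circle_lebesgue"
proof -
  have "prob_space circle_lebesgue"
    unfolding circle_lebesgue_def by (rule angle.prob_space_distr) simp
  moreover have "emeasure circle_lebesgue (- sphere 0 1) = 0"
    unfolding circle_lebesgue_def by (subst emeasure_distr) (auto simp: vimage_def)
  ultimately show ?thesis
    unfolding circle_measure_def circle_measure_axioms_def
    by (simp add: circle_lebesgue_def)
qed

interpretation lam: circle_measure circle_lebesgue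
  by (rule circle_measure_lebesgue)

lemma integral_circle_lebesgue:
  fixes f :: "complex \<Rightarrow> 'b::{banach, second_countable_topology}"
  assumes "f \<in> borel_measurable borel"
  shows "(LINT z|circle_lebesgue. f z) = (LINT \<theta>|angle_measure. f (cis \<theta>))"
  unfolding circle_lebesgue_def by (rule integral_distr) (use assms in auto)

lemma integral_poly_circle_lebesgue: "(LINT z|circle_lebesgue. poly h z) = poly h 0"
proof -
  have "(LINT z|circle_lebesgue. poly h z) =
      (LINT z|circle_lebesgue. (\<Sum>i\<le>degree h. coeff h i * z ^ i))"
    by (simp add: poly_altdef)
  also have "\<dots> = (\<Sum>i\<le>degree h. coeff h i * (LINT z|circle_lebesgue. z ^ i))"
    by (subst Bochner_Integration.integral_sum)
      (auto intro!: lam.integrable_continuous continuous_intros)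
  also have "\<dots> = (\<Sum>i\<le>degree h. coeff h i * (if i = 0 then 1 else 0))"
    by (subst integral_circle_lebesgue) (auto simp: integral_cis_power)
  also have "\<dots> = poly h 0" by (simp add: sum.delta poly_0_coeff_0 if_distrib cong: if_cong)
  finally show ?thesis .
qed

section \<open>An exponential inequality for bounded functions\<close>

text \<open>On the circle \<open>cnj z = 1 / z\<close>, so every real trigonometric polynomial is the real part of a polynomial
  in \<open>z\<close>.\<close>
lemma Re_poly_mult_cnj_poly_circle:
  "\<exists>h. \<forall>z. cmod z = 1 \<longrightarrow> Re (poly p z * cnj (poly q z)) = Re (poly h z)"
proof (induction p arbitrary: q)
  case 0
  show ?case by (intro exI[of _ 0]) simp
next
  case (pCons a p)
  obtain b q' where q: "q = pCons b q'" by (cases q)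
  obtain h where h: "\<And>z. cmod z = 1 \<Longrightarrow> Re (poly p z * cnj (poly q' z)) = Re (poly h z)"
    using pCons.IH by blast
  \<comment> \<open>expand \<open>p\<close> and \<open>q\<close> by their constant terms; in the product of the two tails \<open>z * cnj z = 1\<close>\<close>
  let ?h = "smult (cnj a) q + smult (cnj b) (pCons 0 p) + h"
  have "Re (poly (pCons a p) z * cnj (poly q z)) = Re (poly ?h z)" if z: "cmod z = 1" for z
  proof -
    have zz: "z * cnj z = 1" using z by (simp add: mult_cnj_self)
    have "poly (pCons a p) z * cnj (poly q z) =
        a * cnj (poly q z) + cnj b * (z * poly p z) + (z * cnj z) * (poly p z * cnj (poly q' z))"
      by (simp add: q algebra_simps)
    also have "Re \<dots> = Re (cnj (cnj a * poly q z)) + Re (cnj b * (z * poly p z)) + Re (poly h z)"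
      unfolding zz using h[OF z] by simp
    also have "\<dots> = Re (poly ?h z)" by (simp add: algebra_simps)
    finally show ?thesis .
  qed
  thus ?case by blast
qed

lemma real_polynomial_function_on_circle:
  assumes "real_polynomial_function (g :: complex \<Rightarrow> real)"
  shows "\<exists>h. \<forall>z. cmod z = 1 \<longrightarrow> g z = Re (poly h z)"
  using assms
proof induction
  case (linear f)
  have "f z = Re (poly [:0, Complex (f 1) (- f \<i>):] z)" for z
  proof -
    have "f z = f (Re z *\<^sub>R 1 + Im z *\<^sub>R \<i>)"
      by (rule arg_cong[where f = f]) (simp add: complex_eq_iff)
    also have "\<dots> = Re z * f 1 + Im z * f \<i>"
      using linear by (simp add: linear_simps bounded_linear.linear linear_add linear_scale)
    finally show ?thesis by (simp add: algebra_simps)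
  qed
  thus ?case by blast
next
  case (const c)
  show ?case by (intro exI[of _ "[:of_real c:]"]) simp
next
  case (add f g)
  then obtain h1 h2 where "\<And>z. cmod z = 1 \<Longrightarrow> f z = Re (poly h1 z)"
    "\<And>z. cmod z = 1 \<Longrightarrow> g z = Re (poly h2 z)" by blast
  thus ?case by (intro exI[of _ "h1 + h2"]) simp
next
  case (mult f g)
  then obtain h1 h2 where h: "\<And>z. cmod z = 1 \<Longrightarrow> f z = Re (poly h1 z)"
    "\<And>z. cmod z = 1 \<Longrightarrow> g z = Re (poly h2 z)" by blast
  obtain h where h': "\<And>z. cmod z = 1 \<Longrightarrow> Re (poly h1 z * cnj (poly h2 z)) = Re (poly h z)"
    using Re_poly_mult_cnj_poly_circle by blast
  have "f z * g z = Re (poly (smult (1/2) (h1 * h2 + h)) z)" if "cmod z = 1" for z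
  proof -
    have "Re x * Re y = (Re (x * y) + Re (x * cnj y)) / 2" for x y by simp
    thus ?thesis using h[OF that] h'[OF that] by simp
  qed
  thus ?case by blast
qed

context nontrivial_circle_measure
begin

text \<open>The extremal property applied to the partial sums of the exponential series of \<open>h\<close>. No zeros have
  to be discussed, because the extremal property holds for all polynomials.\<close>
lemma integral_exp_Re_poly_ge:
  assumes b: "\<And>n. b \<le> \<beta> n"
  shows "b * exp (2 * Re (poly h 0)) \<le> (LINT z|M. exp (2 * Re (poly h z)))"
proof -
  define q where "q K = (\<Sum>k<K. smult (1 / fact k) (h ^ k))" for K
  have pq: "poly (q K) z = (\<Sum>k<K. poly h z ^ k / fact k)" for K z
    by (simp add: q_def poly_sum poly_power)
  have lim: "(\<lambda>K. poly (q K) z) \<longlonglongrightarrow> exp (poly h z)" for z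
  proof -
    have "(\<lambda>k. poly h z ^ k /\<^sub>R fact k) sums exp (poly h z)" by (rule exp_converges)
    hence "(\<lambda>k. poly h z ^ k / fact k) sums exp (poly h z)"
      by (simp add: scaleR_conv_of_real field_simps)
    thus ?thesis unfolding pq sums_def .
  qed
  have sq: "(cmod (exp x))\<^sup>2 = exp (2 * Re x)" for x
    by (simp add: exp_double)
  have "(\<lambda>K. sqnorm (q K)) \<longlonglongrightarrow> (LINT z|M. exp (2 * Re (poly h z)))"
    unfolding sqnorm_def
  proof (rule integral_dominated_convergence)
    show "integrable M (\<lambda>z. (exp (cmod (poly h z)))\<^sup>2)"
      by (intro integrable_continuous continuous_intros)
    show "AE z in M. (\<lambda>K. (cmod (poly (q K) z))\<^sup>2) \<longlonglongrightarrow> exp (2 * Re (poly h z))"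
      unfolding sq[symmetric] by (intro always_eventually allI tendsto_intros lim)
    fix K
    show "AE z in M. norm ((cmod (poly (q K) z))\<^sup>2) \<le> (exp (cmod (poly h z)))\<^sup>2"
    proof (intro always_eventually allI)
      fix z
      have "cmod (poly (q K) z) \<le> (\<Sum>k<K. cmod (poly h z) ^ k / fact k)"
        unfolding pq by (rule sum_norm_le) (simp add: norm_divide norm_power)
      also have "\<dots> \<le> exp (cmod (poly h z))"
      proof -
        have "(\<lambda>k. cmod (poly h z) ^ k /\<^sub>R fact k) sums exp (cmod (poly h z))" by (rule exp_converges)
        hence s: "(\<lambda>k. cmod (poly h z) ^ k / fact k) sums exp (cmod (poly h z))"
          by (simp add: field_simps)
        show ?thesis unfolding sums_unique[OF s]
          by (rule sum_le_suminf[OF sums_summable[OF s]]) auto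
      qed
      finally show "norm ((cmod (poly (q K) z))\<^sup>2) \<le> (exp (cmod (poly h z)))\<^sup>2"
        by (simp add: power_mono)
    qed
  qed (auto simp: measurable_cong_sets[OF sets_M refl] intro!: borel_measurable_continuous_onI continuous_intros)
  moreover have "(\<lambda>K. b * (cmod (poly (q K) 0))\<^sup>2) \<longlonglongrightarrow> b * exp (2 * Re (poly h 0))"
    unfolding sq[symmetric] by (intro tendsto_intros lim)
  moreover have "b * (cmod (poly (q K) 0))\<^sup>2 \<le> sqnorm (q K)" for K
  proof -
    have "b * (cmod (poly (q K) 0))\<^sup>2 \<le> \<beta> (degree (q K)) * (cmod (poly (q K) 0))\<^sup>2"
      by (intro mult_right_mono b) auto
    also have "\<dots> \<le> sqnorm (q K)" using \<Phi>s_minimal[of "q K" "degree (q K)"] by (simp add: mult.commute)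
    finally show ?thesis .
  qed
  ultimately show ?thesis by (meson LIMSEQ_le)
qed

lemma integral_exp_continuous_ge:
  fixes u :: "complex \<Rightarrow> real"
  assumes b: "\<And>n. b \<le> \<beta> n" and b0: "0 \<le> b" and u: "continuous_on UNIV u"
  shows "b * exp (LINT z|circle_lebesgue. u z) \<le> (LINT z|M. exp (u z))"
proof -
  have ineq: "b * exp (LINT z|circle_lebesgue. u z) \<le> exp (2 * e) * (LINT z|M. exp (u z))"
    if e: "e > 0" for e
  proof -
    have "compact (sphere 0 1 :: complex set)" by simp
    then obtain g where g: "real_polynomial_function g" "\<And>z. z \<in> sphere 0 1 \<Longrightarrow> \<bar>u z - g z\<bar> < e"
      using Stone_Weierstrass_real_polynomial_function[OF _ continuous_on_subset[OF u] e] by blast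
    obtain h' where h': "\<And>z. cmod z = 1 \<Longrightarrow> g z = Re (poly h' z)"
      using real_polynomial_function_on_circle[OF g(1)] by blast
    define h where "h = smult (1/2) h'"
    have h: "\<bar>u z - 2 * Re (poly h z)\<bar> < e" if "cmod z = 1" for z
      using g(2)[of z] h'[of z] that by (simp add: h_def)
    have int: "integrable circle_lebesgue u" by (rule lam.integrable_continuous[OF u])
    have inth: "integrable circle_lebesgue (poly h)"
      by (intro lam.integrable_continuous continuous_intros)
    have "(LINT z|circle_lebesgue. u z) - e \<le> (LINT z|circle_lebesgue. u z - e)"
      using int lam.prob_space by simp
    also have "(LINT z|circle_lebesgue. u z - e) \<le> (LINT z|circle_lebesgue. 2 * Re (poly h z))"
    proof (rule integral_mono_AE)
      show "AE z in circle_lebesgue. u z - e \<le> 2 * Re (poly h z)"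
        using lam.AE_circle by eventually_elim (use h in \<open>fastforce simp: abs_less_iff\<close>)
    qed (intro lam.integrable_continuous continuous_intros u)+
    also have "\<dots> = 2 * Re (LINT z|circle_lebesgue. poly h z)"
      using inth by simp
    also have "\<dots> = 2 * Re (poly h 0)" by (simp add: integral_poly_circle_lebesgue)
    finally have 1: "(LINT z|circle_lebesgue. u z) - e \<le> 2 * Re (poly h 0)" .
    have "b * exp ((LINT z|circle_lebesgue. u z) - e) \<le> b * exp (2 * Re (poly h 0))"
      using 1 b0 by (intro mult_left_mono) auto
    also have "\<dots> \<le> (LINT z|M. exp (2 * Re (poly h z)))" by (rule integral_exp_Re_poly_ge[OF b])
    also have "\<dots> \<le> (LINT z|M. exp e * exp (u z))"
    proof (rule integral_mono_AE)
      show "AE z in M. exp (2 * Re (poly h z)) \<le> exp e * exp (u z)"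
        using AE_circle
      proof eventually_elim
        case (elim z)
        hence "2 * Re (poly h z) \<le> e + u z" using h[of z] by (simp add: abs_less_iff)
        thus ?case by (simp flip: exp_add)
      qed
    qed (intro integrable_continuous continuous_intros u)+
    also have "\<dots> = exp e * (LINT z|M. exp (u z))" by simp
    finally have "exp e * (b * exp ((LINT z|circle_lebesgue. u z) - e)) \<le> exp e * (exp e * (LINT z|M. exp (u z)))"
      by (intro mult_left_mono) auto
    moreover have "exp e * (b * exp ((LINT z|circle_lebesgue. u z) - e)) = b * exp (LINT z|circle_lebesgue. u z)"
      by (simp add: exp_diff)
    moreover have "exp (2 * e) = exp e * exp e" by (simp flip: exp_add)
    ultimately show ?thesis by (simp add: mult.assoc)
  qed
  have "((\<lambda>e. exp (2 * e) * (LINT z|M. exp (u z))) \<longlongrightarrow> exp (2 * 0) * (LINT z|M. exp (u z))) (at_right 0)"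
    by (intro tendsto_intros)
  moreover have "\<forall>\<^sub>F e in at_right 0. b * exp (LINT z|circle_lebesgue. u z) \<le> exp (2 * e) * (LINT z|M. exp (u z))"
    using eventually_at_right_less[of "0::real"] by eventually_elim (rule ineq)
  ultimately have "b * exp (LINT z|circle_lebesgue. u z) \<le> exp (2 * 0) * (LINT z|M. exp (u z))"
    by (rule tendsto_lowerbound) simp
  thus ?thesis by simp
qed

end

lemma ex_compact_open_between:
  fixes M :: "'a::{second_countable_topology, complete_space} measure"
  assumes "finite_measure M" and sets: "sets M = sets borel" and A: "A \<in> sets borel" and e: "e > 0"
  shows "\<exists>K U. compact K \<and> open U \<and> K \<subseteq> A \<and> A \<subseteq> U \<and> measure M (U - K) < e"
proof -
  interpret finite_measure M by fact
  have fin: "emeasure M (space M) \<noteq> \<infinity>" by simp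
  have e2: "0 < e / 2" using e by simp
  have "\<exists>K\<in>{K. K \<subseteq> A \<and> compact K}. emeasure M A < emeasure M K + ennreal (e / 2)"
    by (rule SUP_approx_ennreal[OF e2 _ inner_regular[OF sets fin A]]) auto
  then obtain K where K: "K \<subseteq> A" "compact K" "emeasure M A < emeasure M K + ennreal (e / 2)" by blast
  have "\<exists>U\<in>{U. A \<subseteq> U \<and> open U}. emeasure M U < emeasure M A + ennreal (e / 2)"
    by (rule INF_approx_ennreal[OF e2 outer_regular[OF sets fin A]]) auto
  then obtain U where U: "A \<subseteq> U" "open U" "emeasure M U < emeasure M A + ennreal (e / 2)" by blast
  have m: "A \<in> sets M" "K \<in> sets M" "U \<in> sets M" using A K U sets by (auto simp: borel_compact)
  have "measure M A < measure M K + e / 2"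
    using K(3) e by (simp add: emeasure_eq_measure ennreal_plus[symmetric] ennreal_less_iff del: ennreal_plus)
  moreover have "measure M U < measure M A + e / 2"
    using U(3) e by (simp add: emeasure_eq_measure ennreal_plus[symmetric] ennreal_less_iff del: ennreal_plus)
  moreover have "measure M (U - K) = measure M U - measure M K"
    using K U m by (intro finite_measure_Diff) auto
  ultimately have "measure M (U - K) < e" by linarith
  thus ?thesis using K U by blast
qed

text \<open>Two measures are treated at the same time, because the exponential inequality involves both \<open>\<mu>\<close> and
  Lebesgue measure, and these may be mutually singular.\<close>
lemma indicator_continuous_approx:
  fixes M N :: "'a::euclidean_space measure"
  assumes M: "finite_measure M" "sets M = sets borel" and N: "finite_measure N" "sets N = sets borel"
    and A: "A \<in> sets borel" and e: "e > 0"
  shows "\<exists>g::'a \<Rightarrow> real. continuous_on UNIV g \<and> (\<forall>x. 0 \<le> g x \<and> g x \<le> 1) \<and>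
     (LINT x|M. \<bar>indicator A x - g x\<bar>) \<le> e \<and> (LINT x|N. \<bar>indicator A x - g x\<bar>) \<le> e"
proof -
  obtain K1 U1 where 1: "compact K1" "open U1" "K1 \<subseteq> A" "A \<subseteq> U1" "measure M (U1 - K1) < e"
    using ex_compact_open_between[OF M A e] by blast
  obtain K2 U2 where 2: "compact K2" "open U2" "K2 \<subseteq> A" "A \<subseteq> U2" "measure N (U2 - K2) < e"
    using ex_compact_open_between[OF N A e] by blast
  define K where "K = K1 \<union> K2"
  define U where "U = U1 \<inter> U2"
  have K: "compact K" "K \<subseteq> A" and U: "open U" "A \<subseteq> U"
    using 1 2 by (auto simp: K_def U_def)
  have "closed (- U)" "closed K" "- U \<inter> K = {}"
    using K U by (auto simp: compact_imp_closed)
  then obtain g :: "'a \<Rightarrow> real" where g: "continuous_on UNIV g" "\<And>x. g x \<in> closed_segment 0 1"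
    "\<And>x. x \<in> - U \<Longrightarrow> g x = 0" "\<And>x. x \<in> K \<Longrightarrow> g x = 1"
    using Urysohn[of "- U" K 0 1] by metis
  have g01: "0 \<le> g x" "g x \<le> 1" for x using g(2)[of x] by (auto simp: closed_segment_eq_real_ivl)
  have bound: "(LINT x|P. \<bar>indicator A x - g x\<bar>) \<le> e"
    if P: "finite_measure P" "sets P = sets borel" "measure P (V - L) < e"
      and V: "open V" "U \<subseteq> V" "compact L" "L \<subseteq> K" for P V L
  proof -
    interpret finite_measure P by fact
    have gm[measurable]: "g \<in> borel_measurable P"
      using borel_measurable_continuous_onI[OF g(1)] by (simp add: measurable_cong_sets[OF P(2) refl])
    have VL: "V - L \<in> sets P" using V P(2) by (auto simp: compact_imp_closed)
    have [measurable]: "A \<in> sets P" using A P(2) by simp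
    have "(LINT x|P. \<bar>indicator A x - g x\<bar>) \<le> (LINT x|P. indicator (V - L) x)"
    proof (rule integral_mono_AE)
      show "integrable P (\<lambda>x. \<bar>indicator A x - g x\<bar>)"
      proof (rule integrable_const_bound[where B = 1])
        show "AE x in P. norm \<bar>indicator A x - g x\<bar> \<le> 1"
        proof (intro always_eventually allI)
          fix x show "norm \<bar>indicator A x - g x\<bar> \<le> 1" using g01[of x] by (cases "x \<in> A") auto
        qed
      qed simp
      show "AE x in P. \<bar>indicator A x - g x\<bar> \<le> indicator (V - L) x"
      proof (intro always_eventually allI)
        fix x
        show "\<bar>indicator A x - g x\<bar> \<le> (indicator (V - L) x :: real)"
          using g01[of x] g(3,4)[of x] K U V by (cases "x \<in> K"; cases "x \<in> U") (auto simp: indicator_def)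
      qed
    qed (use VL in \<open>auto simp: integrable_indicator_iff emeasure_eq_measure\<close>)
    also have "\<dots> = measure P (V - L)" using VL by simp
    finally show ?thesis using P(3) by linarith
  qed
  have "(LINT x|M. \<bar>indicator A x - g x\<bar>) \<le> e"
    by (rule bound[OF M 1(5,2) _ 1(1)]) (auto simp: U_def K_def)
  moreover have "(LINT x|N. \<bar>indicator A x - g x\<bar>) \<le> e"
    by (rule bound[OF N 2(5,2) _ 2(1)]) (auto simp: U_def K_def)
  ultimately show ?thesis using g(1) g01 by blast
qed

text \<open>The sum counts the \<open>j \<in> {1..n}\<close> with \<open>j \<le> n x\<close>, so the quotient is \<open>\<lfloor>n x\<rfloor> / n\<close>.\<close>
lemma sum_indicator_floor:
  fixes x :: real
  assumes x: "0 \<le> x" "x \<le> 1" and n: "n > 0"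
  shows "\<bar>x - (\<Sum>j=1..n. if real j / real n \<le> x then 1 else 0) / real n\<bar> \<le> 1 / real n"
proof -
  define k where "k = nat \<lfloor>real n * x\<rfloor>"
  have k: "real k \<le> real n * x" "real n * x < real k + 1"
    using x unfolding k_def by simp_all
  have "real n * x \<le> real n" using x n by (simp add: mult_left_le)
  hence kn: "k \<le> n" using k by linarith
  have iff: "real j / real n \<le> x \<longleftrightarrow> j \<le> k" for j
  proof -
    have "real j / real n \<le> x \<longleftrightarrow> real j \<le> real n * x" using n by (simp add: field_simps)
    also have "\<dots> \<longleftrightarrow> j \<le> k"
    proof
      assume "real j \<le> real n * x"
      hence "real j < real k + 1" using k by linarith
      thus "j \<le> k" by linarith
    next
      assume "j \<le> k"
      hence "real j \<le> real k" by simp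
      thus "real j \<le> real n * x" using k by linarith
    qed
    finally show ?thesis .
  qed
  have "(\<Sum>j=1..n. if real j / real n \<le> x then 1 else 0) = real (card {j\<in>{1..n}. j \<le> k})"
    unfolding iff by (simp add: sum.If_cases Int_def)
  also have "{j\<in>{1..n}. j \<le> k} = {1..k}" using kn by auto
  finally have "x - (\<Sum>j=1..n. if real j / real n \<le> x then 1 else 0) / real n = (real n * x - real k) / real n"
    using n by (simp add: field_simps)
  moreover have "\<bar>real n * x - real k\<bar> \<le> 1" using k by linarith
  ultimately show ?thesis using n by (simp add: divide_right_mono)
qed

lemma unit_interval_continuous_approx:
  fixes M N :: "'a::euclidean_space measure" and v :: "'a \<Rightarrow> real"
  assumes M: "prob_space M" "sets M = sets borel" and N: "prob_space N" "sets N = sets borel"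
    and v: "v \<in> borel_measurable borel" "\<And>x. 0 \<le> v x" "\<And>x. v x \<le> 1" and e: "e > 0"
  shows "\<exists>g::'a \<Rightarrow> real. continuous_on UNIV g \<and> (\<forall>x. 0 \<le> g x \<and> g x \<le> 1) \<and>
     (LINT x|M. \<bar>v x - g x\<bar>) \<le> e \<and> (LINT x|N. \<bar>v x - g x\<bar>) \<le> e"
proof -
  obtain n :: nat where n: "n > 0" "1 / real n < e / 2"
    using real_arch_inverse[of "e / 2"] e by (auto simp: inverse_eq_divide)
  define A where "A j = {x. real j / real n \<le> v x}" for j
  have A: "A j \<in> sets borel" for j unfolding A_def using v(1) by measurable
  have e2: "e / 2 > 0" using e by simp
  define approx :: "nat \<Rightarrow> ('a \<Rightarrow> real) \<Rightarrow> bool" where "approx j g \<longleftrightarrow>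
     continuous_on UNIV g \<and> (\<forall>x. 0 \<le> g x \<and> g x \<le> 1) \<and>
     (LINT x|M. \<bar>indicator (A j) x - g x\<bar>) \<le> e / 2 \<and> (LINT x|N. \<bar>indicator (A j) x - g x\<bar>) \<le> e / 2" for j g
  have "\<exists>g. approx j g" for j
    unfolding approx_def
    by (rule indicator_continuous_approx[OF prob_space.axioms(1)[OF M(1)] M(2)
        prob_space.axioms(1)[OF N(1)] N(2) A e2])
  then obtain g where "\<And>j. approx j (g j)" by metis
  hence g: "\<And>j. continuous_on UNIV (g j)"
    "\<And>j x. 0 \<le> g j x" "\<And>j x. g j x \<le> 1"
    "\<And>j. (LINT x|M. \<bar>indicator (A j) x - g j x\<bar>) \<le> e / 2" "\<And>j. (LINT x|N. \<bar>indicator (A j) x - g j x\<bar>) \<le> e / 2"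
    unfolding approx_def by blast+
  \<comment> \<open>\<open>v\<close> differs by at most \<open>1 / n\<close> from the mean of the indicators of its level sets \<open>A j\<close>\<close>
  define u where "u x = (\<Sum>j=1..n. g j x) / real n" for x
  have uc: "continuous_on UNIV u" unfolding u_def by (intro continuous_intros g) (use n in auto)
  have u01: "0 \<le> u x" "u x \<le> 1" for x
  proof -
    show "0 \<le> u x" unfolding u_def by (intro divide_nonneg_nonneg sum_nonneg g) auto
    have "(\<Sum>j=1..n. g j x) \<le> (\<Sum>j=1..n. 1)" by (intro sum_mono g)
    thus "u x \<le> 1" unfolding u_def using n by simp
  qed
  have bound: "(LINT x|P. \<bar>v x - u x\<bar>) \<le> e"
    if P: "prob_space P" "sets P = sets borel" "\<And>j. (LINT x|P. \<bar>indicator (A j) x - g j x\<bar>) \<le> e / 2" for P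
  proof -
    interpret prob_space P by fact
    have mP: "borel_measurable P = borel_measurable borel" by (rule measurable_cong_sets[OF P(2) refl])
    have [measurable]: "\<And>j. g j \<in> borel_measurable P" "u \<in> borel_measurable P" "v \<in> borel_measurable P"
      "\<And>j. A j \<in> sets P"
      unfolding mP P(2) using g uc v A by (auto intro!: borel_measurable_continuous_onI)
    have int1: "integrable P (\<lambda>x. \<bar>indicator (A j) x - g j x\<bar>)" for j
    proof (rule integrable_const_bound[where B = 1])
      show "AE x in P. norm \<bar>indicator (A j) x - g j x\<bar> \<le> 1"
      proof (intro always_eventually allI)
        fix x show "norm \<bar>indicator (A j) x - g j x\<bar> \<le> 1"
          using g(2,3)[of j x] by (cases "x \<in> A j") auto
      qed
    qed simp
    have int2: "integrable P (\<lambda>x. \<bar>v x - u x\<bar>)"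
    proof (rule integrable_const_bound[where B = 1])
      show "AE x in P. norm \<bar>v x - u x\<bar> \<le> 1"
      proof (intro always_eventually allI)
        fix x show "norm \<bar>v x - u x\<bar> \<le> 1"
          using u01[of x] v(2,3)[of x] by (simp add: abs_le_iff)
      qed
    qed simp
    have "(LINT x|P. \<bar>v x - u x\<bar>) \<le> (LINT x|P. 1 / real n + (\<Sum>j=1..n. \<bar>indicator (A j) x - g j x\<bar>) / real n)"
    proof (rule integral_mono_AE[OF int2])
      show "AE x in P. \<bar>v x - u x\<bar> \<le> 1 / real n + (\<Sum>j=1..n. \<bar>indicator (A j) x - g j x\<bar>) / real n"
      proof (intro always_eventually allI)
        fix x
        have "\<bar>v x - (\<Sum>j=1..n. indicator (A j) x) / real n\<bar> \<le> 1 / real n"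
          using sum_indicator_floor[OF v(2,3) n(1), of x] by (simp add: A_def indicator_def of_bool_def)
        moreover have "\<bar>(\<Sum>j=1..n. indicator (A j) x) / real n - u x\<bar> =
           \<bar>\<Sum>j=1..n. indicator (A j) x - g j x\<bar> / real n"
          using n unfolding u_def by (simp add: sum_subtractf diff_divide_distrib[symmetric])
        moreover have "\<bar>\<Sum>j=1..n. indicator (A j) x - g j x\<bar> / real n \<le> (\<Sum>j=1..n. \<bar>indicator (A j) x - g j x\<bar>) / real n"
          by (intro divide_right_mono sum_abs) auto
        ultimately show "\<bar>v x - u x\<bar> \<le> 1 / real n + (\<Sum>j=1..n. \<bar>indicator (A j) x - g j x\<bar>) / real n"
          by linarith
      qed
    qed (use int1 in auto)
    also have "\<dots> = 1 / real n + (\<Sum>j=1..n. (LINT x|P. \<bar>indicator (A j) x - g j x\<bar>)) / real n"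
      using int1 prob_space by simp
    also have "\<dots> \<le> 1 / real n + (\<Sum>j=1..n. e / 2) / real n"
      by (intro add_left_mono divide_right_mono sum_mono P(3)) auto
    also have "\<dots> \<le> e" using n by (simp add: field_simps)
    finally show ?thesis .
  qed
  show ?thesis using uc u01 bound[OF M g(4)] bound[OF N g(5)] by blast
qed

context nontrivial_circle_measure
begin

lemma integral_exp_bounded_ge:
  fixes v :: "complex \<Rightarrow> real"
  assumes b: "\<And>n. b \<le> \<beta> n" and b0: "0 \<le> b"
    and v: "v \<in> borel_measurable borel" "\<And>x. \<bar>v x\<bar> \<le> L"
  shows "b * exp (LINT z|circle_lebesgue. v z) \<le> (LINT z|M. exp (v z))"
proof -
  \<comment> \<open>a strictly larger bound, since the rescaling to \<open>[0, 1]\<close> divides by it and \<open>L\<close> may be \<open>0\<close>\<close>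
  define L' where "L' = L + 1"
  have "0 \<le> L" using v(2)[of 0] by linarith
  hence L': "L' > 0" "\<bar>v x\<bar> \<le> L'" for x using v(2)[of x] unfolding L'_def by linarith+
  have intv: "integrable circle_lebesgue v"
    by (rule lam.integrable_on_circle[OF v(1)]) (use v(2) in simp)
  have intev: "integrable M (\<lambda>z. exp (v z))"
    by (rule integrable_on_circle[where C = "exp L"]) (use v in \<open>auto simp: abs_le_iff\<close>)
  have ineq: "b * exp ((LINT z|circle_lebesgue. v z) - e) \<le> (LINT z|M. exp (v z)) + exp L' * e"
    if e: "e > 0" for e
  proof -
    let ?v = "\<lambda>x. (v x + L') / (2 * L')"
    have "\<exists>g::complex \<Rightarrow> real. continuous_on UNIV g \<and> (\<forall>x. 0 \<le> g x \<and> g x \<le> 1) \<and>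
       (LINT x|M. \<bar>?v x - g x\<bar>) \<le> e / (2 * L') \<and> (LINT x|circle_lebesgue. \<bar>?v x - g x\<bar>) \<le> e / (2 * L')"
    proof (rule unit_interval_continuous_approx)
      show "prob_space M" "prob_space circle_lebesgue" by unfold_locales
      show "0 \<le> ?v x" "?v x \<le> 1" for x using L'(1) L'(2)[of x] by (auto simp: field_simps abs_le_iff)
    qed (use v L' e in auto)
    then obtain g :: "complex \<Rightarrow> real" where g: "continuous_on UNIV g" "\<And>x. 0 \<le> g x" "\<And>x. g x \<le> 1"
       "(LINT x|M. \<bar>?v x - g x\<bar>) \<le> e / (2 * L')" "(LINT x|circle_lebesgue. \<bar>?v x - g x\<bar>) \<le> e / (2 * L')"
      by blast
    define u where "u x = 2 * L' * g x - L'" for x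
    have u: "continuous_on UNIV u" unfolding u_def by (intro continuous_intros g)
    have uL: "u x \<le> L'" for x using mult_left_mono[OF g(3)[of x], of "2 * L'"] L' unfolding u_def by simp
    have dist: "\<bar>v x - u x\<bar> = 2 * L' * \<bar>?v x - g x\<bar>" for x
    proof -
      have "v x - u x = 2 * L' * (?v x - g x)" using L'(1) by (simp add: u_def field_simps)
      thus ?thesis using L'(1) by (simp add: abs_mult)
    qed
    have d1: "(LINT x|M. \<bar>v x - u x\<bar>) \<le> e" unfolding dist using g(4) L'(1) by (simp add: field_simps)
    have d2: "(LINT x|circle_lebesgue. \<bar>v x - u x\<bar>) \<le> e" unfolding dist using g(5) L'(1) by (simp add: field_simps)
    have intu: "integrable circle_lebesgue u" by (rule lam.integrable_continuous[OF u])
    have intMv: "integrable M v" by (rule integrable_on_circle[OF v(1)]) (use v(2) in simp)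
    have intMu: "integrable M u" by (rule integrable_continuous[OF u])
    have "(LINT z|circle_lebesgue. v z) - (LINT z|circle_lebesgue. u z) = (LINT z|circle_lebesgue. v z - u z)"
      using intv intu by simp
    also have "\<dots> \<le> (LINT z|circle_lebesgue. \<bar>v z - u z\<bar>)"
      by (intro integral_mono) (use intv intu in auto)
    finally have 1: "(LINT z|circle_lebesgue. v z) - e \<le> (LINT z|circle_lebesgue. u z)" using d2 by linarith
    have "b * exp ((LINT z|circle_lebesgue. v z) - e) \<le> b * exp (LINT z|circle_lebesgue. u z)"
      using 1 b0 by (intro mult_left_mono) auto
    also have "\<dots> \<le> (LINT z|M. exp (u z))" by (rule integral_exp_continuous_ge[OF b b0 u])
    also have "\<dots> \<le> (LINT z|M. exp (v z) + exp L' * \<bar>v z - u z\<bar>)"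
    proof (rule integral_mono)
      show "integrable M (\<lambda>z. exp (u z))" by (intro integrable_continuous continuous_intros u)
      show "integrable M (\<lambda>z. exp (v z) + exp L' * \<bar>v z - u z\<bar>)" using intev intMv intMu by auto
      fix z
      \<comment> \<open>the tangent of the exponential function at \<open>u z\<close>\<close>
      have "exp (u z) \<le> exp (v z) + exp (u z) * (u z - v z)"
      proof -
        have "1 + (v z - u z) \<le> exp (v z - u z)" by (rule exp_ge_add_one_self)
        hence "exp (u z) * (1 + (v z - u z)) \<le> exp (u z) * exp (v z - u z)" by (intro mult_left_mono) auto
        also have "\<dots> = exp (v z)" by (simp flip: exp_add)
        finally show ?thesis by (simp add: algebra_simps)
      qed
      also have "exp (u z) * (u z - v z) \<le> exp L' * \<bar>v z - u z\<bar>"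
        using uL[of z] by (intro order_trans[OF mult_left_mono[of _ "\<bar>v z - u z\<bar>"] mult_right_mono]) auto
      finally show "exp (u z) \<le> exp (v z) + exp L' * \<bar>v z - u z\<bar>" by simp
    qed
    also have "\<dots> = (LINT z|M. exp (v z)) + exp L' * (LINT z|M. \<bar>v z - u z\<bar>)"
      using intev intMv intMu by simp
    also have "\<dots> \<le> (LINT z|M. exp (v z)) + exp L' * e"
      using d1 by (intro add_left_mono mult_left_mono) auto
    finally show ?thesis .
  qed
  have "((\<lambda>e. (LINT z|M. exp (v z)) + exp L' * e) \<longlongrightarrow> (LINT z|M. exp (v z)) + exp L' * 0) (at_right 0)"
    "((\<lambda>e. b * exp ((LINT z|circle_lebesgue. v z) - e)) \<longlongrightarrow> b * exp ((LINT z|circle_lebesgue. v z) - 0)) (at_right 0)"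
    by (intro tendsto_intros)+
  moreover have "\<forall>\<^sub>F e in at_right 0. b * exp ((LINT z|circle_lebesgue. v z) - e) \<le> (LINT z|M. exp (v z)) + exp L' * e"
    using eventually_at_right_less[of "0::real"] by eventually_elim (rule ineq)
  ultimately have "b * exp ((LINT z|circle_lebesgue. v z) - 0) \<le> (LINT z|M. exp (v z)) + exp L' * 0"
    by (intro tendsto_le[OF trivial_limit_at_right_real])
  thus ?thesis by simp
qed

end

section \<open>Integrability of the logarithm of the density\<close>

lemma nn_integral_add_measure:
  assumes sets: "sets M = sets A" "sets B = sets A"
    and add: "\<And>X. X \<in> sets A \<Longrightarrow> emeasure M X = emeasure A X + emeasure B X"
    and f: "f \<in> borel_measurable A"
  shows "(\<integral>\<^sup>+x. f x \<partial>M) = (\<integral>\<^sup>+x. f x \<partial>A) + (\<integral>\<^sup>+x. f x \<partial>B)"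
proof -
  note meas = measurable_cong_sets[OF sets(1) refl] measurable_cong_sets[OF sets(2) refl]
  have sp: "space M = space A" "space B = space A" using sets by (auto dest: sets_eq_imp_space_eq)
  from f show ?thesis
  proof (induction rule: borel_measurable_induct)
    case (cong f g)
    have "(\<integral>\<^sup>+x. f x \<partial>P) = (\<integral>\<^sup>+x. g x \<partial>P)" if "space P = space A" for P
      by (rule nn_integral_cong) (use cong(3) that in auto)
    thus ?case using cong sp by simp
  next
    case (set X)
    thus ?case using sets add by simp
  next
    case (mult u c)
    thus ?case by (simp add: nn_integral_cmult meas distrib_left)
  next
    case (add u v)
    thus ?case by (simp add: nn_integral_add meas ac_simps)
  next
    case (seq U)
    have SUP: "(\<integral>\<^sup>+x. (SUP i. U i) x \<partial>P) = (SUP i. \<integral>\<^sup>+x. U i x \<partial>P)" if "sets P = sets A" for P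
    proof -
      have "(\<integral>\<^sup>+x. (SUP i. U i x) \<partial>P) = (SUP i. \<integral>\<^sup>+x. U i x \<partial>P)"
        by (rule nn_integral_monotone_convergence_SUP)
          (use seq that in \<open>auto simp: measurable_cong_sets[OF that refl]\<close>)
      thus ?thesis by (simp add: image_image)
    qed
    have inc: "incseq (\<lambda>i. \<integral>\<^sup>+x. U i x \<partial>P)" for P
      using seq(3) by (auto simp: incseq_def le_fun_def intro!: nn_integral_mono)
    show ?case
      unfolding SUP[OF sets(1)] SUP[OF sets(2)] SUP[OF refl]
      by (simp add: seq ennreal_SUP_add[OF inc inc])
  qed
qed

text \<open>On the unit circle, the inverse of \<^const>\<open>cis\<close> with values in \<open>[0, 2\<pi>)\<close>. Cutting the
  real part off to \<open>[-1, 1]\<close> keeps the argument of \<^const>\<open>arccos\<close> in the domain where it is continuous,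
  so that the function is Borel measurable on the whole plane.\<close>
definition circle_arg :: "complex \<Rightarrow> real" where
  "circle_arg z = (if 0 \<le> Im z then arccos (max (-1) (min 1 (Re z)))
                   else 2 * pi - arccos (max (-1) (min 1 (Re z))))"

lemma measurable_circle_arg [measurable]: "circle_arg \<in> borel_measurable borel"
proof -
  have "continuous_on UNIV (\<lambda>z::complex. arccos (max (-1) (min 1 (Re z))))"
    by (intro continuous_on_arccos continuous_intros) auto
  hence [measurable]: "(\<lambda>z::complex. arccos (max (-1) (min 1 (Re z)))) \<in> borel_measurable borel"
    by (rule borel_measurable_continuous_onI)
  show ?thesis unfolding circle_arg_def by measurable
qed

lemma circle_arg_cis:
  assumes "0 \<le> \<theta>" "\<theta> < 2 * pi"
  shows "circle_arg (cis \<theta>) = \<theta>"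
proof (cases "\<theta> \<le> pi")
  case True
  thus ?thesis using assms by (simp add: circle_arg_def sin_ge_zero arccos_cos)
next
  case False
  have "sin \<theta> < 0" using False assms by (intro sin_lt_zero) auto
  moreover have "arccos (cos \<theta>) = 2 * pi - \<theta>"
  proof -
    have "cos \<theta> = cos (2 * pi - \<theta>)" by simp
    thus ?thesis using False assms by (metis arccos_cos diff_ge_0_iff_ge less_imp_le linorder_not_le
       add.commute diff_le_eq mult_2 add_le_cancel_left)
  qed
  ultimately show ?thesis by (simp add: circle_arg_def)
qed

text \<open>For \<open>L \<ge> 0\<close>, the truncation of \<open>x\<close> to the interval from \<open>exp (- L)\<close> to \<open>exp L\<close>. Unlike
  \<^term>\<open>ln (0::real)\<close>, the logarithm of the truncation of \<open>0\<close> has the value \<open>- L\<close> that the limit \<open>L \<rightarrow> \<infinity>\<close> requires.\<close>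
definition clip_exp :: "real \<Rightarrow> real \<Rightarrow> real" where
  "clip_exp L x = max (exp (- L)) (min x (exp L))"

lemma clip_exp_pos: "0 < clip_exp L x"
  by (simp add: clip_exp_def less_max_iff_disj)

lemma ln_clip_exp_bound:
  assumes "0 \<le> L" shows "\<bar>ln (clip_exp L x)\<bar> \<le> L"
proof -
  have "exp (- L) \<le> clip_exp L x" "clip_exp L x \<le> exp L"
    using assms by (auto simp: clip_exp_def)
  hence "ln (exp (- L)) \<le> ln (clip_exp L x)" "ln (clip_exp L x) \<le> ln (exp L)"
    using clip_exp_pos[of L x] by (simp_all only: ln_le_cancel_iff exp_gt_zero)
  thus ?thesis by simp
qed

lemma ln_clip_exp_le:
  assumes "0 \<le> L" "0 \<le> x" shows "ln (clip_exp L x) \<le> x"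
proof (cases "clip_exp L x \<le> 1")
  case True
  hence "ln (clip_exp L x) \<le> 0" using clip_exp_pos[of L x] by simp
  thus ?thesis using assms by linarith
next
  case False
  have "exp (- L) \<le> 1" using assms by simp
  hence "clip_exp L x \<le> x" using False by (auto simp: clip_exp_def max_def min_def split: if_splits)
  moreover have "ln (clip_exp L x) \<le> clip_exp L x - 1" using clip_exp_pos by (rule ln_le_minus_one)
  ultimately show ?thesis by linarith
qed

lemma divide_clip_exp_le:
  assumes "0 \<le> x" shows "x / clip_exp L x \<le> 1 + exp (- L) * x"
proof (cases "x \<le> exp L")
  case True
  hence "x \<le> clip_exp L x" by (simp add: clip_exp_def)
  hence "x / clip_exp L x \<le> 1" using clip_exp_pos[of L x] by simp
  moreover have "0 \<le> exp (- L) * x" using assms by simp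
  ultimately show ?thesis by linarith
next
  case False
  hence "exp L \<le> clip_exp L x" by (simp add: clip_exp_def)
  hence "x / clip_exp L x \<le> x / exp L" using assms by (intro divide_left_mono) (auto simp: clip_exp_pos)
  moreover have "x / exp L = exp (- L) * x" by (simp add: exp_minus divide_inverse)
  ultimately show ?thesis by linarith
qed

lemma clip_exp_eventually_eq:
  assumes "0 < x" shows "\<forall>\<^sub>F n in sequentially. clip_exp (real n) x = x"
proof -
  obtain N :: nat where N: "\<bar>ln x\<bar> \<le> real N" using real_arch_simple by blast
  have "clip_exp (real n) x = x" if "n \<ge> N" for n
  proof -
    have "- real n \<le> ln x" "ln x \<le> real n" using N that by auto
    hence "exp (- real n) \<le> x" "x \<le> exp (real n)" using assms
      by (metis exp_le_cancel_iff exp_ln)+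
    thus ?thesis by (simp add: clip_exp_def)
  qed
  thus ?thesis by (auto simp: eventually_sequentially)
qed

lemma measurable_clip_exp [measurable]: "clip_exp L \<in> borel_measurable borel"
  unfolding clip_exp_def by measurable

context nontrivial_circle_measure
begin

lemma ac_density_nn_integral_le:
  assumes ac: "ac_density M w" and f: "f \<in> borel_measurable borel"
  shows "(\<integral>\<^sup>+\<theta>. ennreal (w \<theta>) * f (cis \<theta>) \<partial>angle_measure) \<le> (\<integral>\<^sup>+z. f z \<partial>M)"
proof -
  obtain \<mu>s where w: "w \<in> borel_measurable borel" and s: "sets \<mu>s = sets borel" and
    add: "\<And>A. A \<in> sets borel \<Longrightarrow> emeasure M A =
       emeasure (distr (density angle_measure (\<lambda>\<theta>. ennreal (w \<theta>))) borel cis) A + emeasure \<mu>s A"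
    using ac unfolding ac_density_def by blast
  have "(\<integral>\<^sup>+z. f z \<partial>M) = (\<integral>\<^sup>+z. f z \<partial>distr (density angle_measure (\<lambda>\<theta>. ennreal (w \<theta>))) borel cis)
       + (\<integral>\<^sup>+z. f z \<partial>\<mu>s)"
    by (rule nn_integral_add_measure) (use s add f in auto)
  also have "(\<integral>\<^sup>+z. f z \<partial>distr (density angle_measure (\<lambda>\<theta>. ennreal (w \<theta>))) borel cis)
      = (\<integral>\<^sup>+\<theta>. ennreal (w \<theta>) * f (cis \<theta>) \<partial>angle_measure)"
    using w f by (subst nn_integral_distr) (auto simp: nn_integral_density)
  finally show ?thesis by simp
qed

lemma ac_density_integrable:
  assumes ac: "ac_density M w"
  shows "integrable angle_measure w" "(LINT \<theta>|angle_measure. w \<theta>) \<le> 1"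
proof -
  have w: "w \<in> borel_measurable borel" "\<And>\<theta>. 0 \<le> w \<theta>" using ac unfolding ac_density_def by auto
  have le: "(\<integral>\<^sup>+\<theta>. ennreal (w \<theta>) \<partial>angle_measure) \<le> 1"
    using ac_density_nn_integral_le[OF ac, of "\<lambda>_. 1"] emeasure_space_1 by simp
  show int: "integrable angle_measure w"
    using w le by (intro integrableI_nonneg) (auto intro: order.strict_trans1)
  have "ennreal (LINT \<theta>|angle_measure. w \<theta>) \<le> ennreal 1"
    using le nn_integral_eq_integral[OF int] w(2) by simp
  thus "(LINT \<theta>|angle_measure. w \<theta>) \<le> 1" by (subst (asm) ennreal_le_iff) auto
qed

text \<open>The exponential inequality for the function \<open>v\<close> that is \<open>- L\<close> on the null set \<open>N\<close> carrying the
  singular part and minus the logarithm of the truncated density elsewhere. The singular part then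
  contributes at most \<open>exp (- L)\<close> to the integral of \<open>exp v\<close>.\<close>
lemma integral_ln_clip_ge:
  assumes ac: "ac_density M w" and b: "\<And>n. b \<le> \<beta> n" and b0: "0 < b" and L: "0 \<le> L"
  shows "ln b - 2 * exp (- L) \<le> (LINT \<theta>|angle_measure. ln (clip_exp L (w \<theta>)))"
proof -
  obtain \<mu>s N where w[measurable]: "w \<in> borel_measurable borel" and w0: "\<And>\<theta>. 0 \<le> w \<theta>"
    and s: "sets \<mu>s = sets borel" and
    add: "\<And>A. A \<in> sets borel \<Longrightarrow> emeasure M A =
       emeasure (distr (density angle_measure (\<lambda>\<theta>. ennreal (w \<theta>))) borel cis) A + emeasure \<mu>s A"
    and N[measurable]: "N \<in> sets borel" and N0: "emeasure (distr angle_measure borel cis) N = 0"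
    and sN: "emeasure \<mu>s (- N) = 0"
    using ac unfolding ac_density_def by blast
  define v where "v z = (if z \<in> N then - L else - ln (clip_exp L (w (circle_arg z))))" for z
  have v[measurable]: "v \<in> borel_measurable borel" unfolding v_def by measurable
  have vL: "\<bar>v z\<bar> \<le> L" for z using ln_clip_exp_bound[OF L] L by (auto simp: v_def)
  have "cis -` N \<in> sets borel" using measurable_sets[OF measurable_cis N] by simp
  hence "AE \<theta> in angle_measure. cis \<theta> \<notin> N"
    using N0 by (intro AE_I[of _ _ "cis -` N"]) (auto simp: emeasure_distr)
  hence AEv: "AE \<theta> in angle_measure. v (cis \<theta>) = - ln (clip_exp L (w \<theta>))"
    using AE_angle_measure by eventually_elim (auto simp: v_def circle_arg_cis)
  have "(\<integral>\<^sup>+z. ennreal (exp (v z)) \<partial>M) =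
      (\<integral>\<^sup>+z. ennreal (exp (v z)) \<partial>distr (density angle_measure (\<lambda>\<theta>. ennreal (w \<theta>))) borel cis)
       + (\<integral>\<^sup>+z. ennreal (exp (v z)) \<partial>\<mu>s)"
    by (rule nn_integral_add_measure) (use s add in auto)
  also have "(\<integral>\<^sup>+z. ennreal (exp (v z)) \<partial>distr (density angle_measure (\<lambda>\<theta>. ennreal (w \<theta>))) borel cis)
      = (\<integral>\<^sup>+\<theta>. ennreal (w \<theta>) * ennreal (exp (v (cis \<theta>))) \<partial>angle_measure)"
    by (subst nn_integral_distr) (auto simp: nn_integral_density)
  also have "\<dots> \<le> (\<integral>\<^sup>+\<theta>. ennreal (1 + exp (- L) * w \<theta>) \<partial>angle_measure)"
  proof (rule nn_integral_mono_AE)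
    show "AE \<theta> in angle_measure. ennreal (w \<theta>) * ennreal (exp (v (cis \<theta>))) \<le> ennreal (1 + exp (- L) * w \<theta>)"
      using AEv
    proof eventually_elim
      case (elim \<theta>)
      have "w \<theta> * exp (v (cis \<theta>)) = w \<theta> / clip_exp L (w \<theta>)"
        unfolding elim by (simp add: exp_minus clip_exp_pos divide_inverse)
      also have "\<dots> \<le> 1 + exp (- L) * w \<theta>" by (rule divide_clip_exp_le[OF w0])
      finally show ?case using w0[of \<theta>] by (simp add: ennreal_leI del: ennreal_plus flip: ennreal_mult)
    qed
  qed
  also have "\<dots> = ennreal (LINT \<theta>|angle_measure. 1 + exp (- L) * w \<theta>)"
    by (rule nn_integral_eq_integral) (use ac_density_integrable[OF ac] w0 in auto)
  also have "(LINT \<theta>|angle_measure. 1 + exp (- L) * w \<theta>) = 1 + exp (- L) * (LINT \<theta>|angle_measure. w \<theta>)"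
    using ac_density_integrable[OF ac] angle.prob_space by simp
  also have "(\<integral>\<^sup>+z. ennreal (exp (v z)) \<partial>\<mu>s) = (\<integral>\<^sup>+z. ennreal (exp (- L)) \<partial>\<mu>s)"
  proof (rule nn_integral_cong_AE)
    have "AE z in \<mu>s. z \<in> N"
      by (rule AE_I[of _ _ "- N"]) (use sN s in auto)
    thus "AE z in \<mu>s. ennreal (exp (v z)) = ennreal (exp (- L))"
      by eventually_elim (simp add: v_def)
  qed
  also have "\<dots> = ennreal (exp (- L)) * emeasure \<mu>s UNIV"
    using sets_eq_imp_space_eq[OF s] by simp
  also have "\<dots> \<le> ennreal (exp (- L)) * 1"
  proof (rule mult_left_mono)
    have "emeasure \<mu>s UNIV \<le> emeasure M UNIV" using add[of UNIV] by simp
    thus "emeasure \<mu>s UNIV \<le> 1" using emeasure_space_1 by simp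
  qed simp
  finally have "(\<integral>\<^sup>+z. ennreal (exp (v z)) \<partial>M) \<le>
      ennreal (1 + exp (- L) * (LINT \<theta>|angle_measure. w \<theta>)) + ennreal (exp (- L))"
    by (simp add: add_mono)
  also have "\<dots> \<le> ennreal (1 + 2 * exp (- L))"
  proof -
    have "0 \<le> (LINT \<theta>|angle_measure. w \<theta>)" using w0 by (intro Bochner_Integration.integral_nonneg) auto
    moreover have "exp (- L) * (LINT \<theta>|angle_measure. w \<theta>) \<le> exp (- L) * 1"
      by (intro mult_left_mono ac_density_integrable[OF ac]) auto
    ultimately have "ennreal (1 + exp (- L) * (LINT \<theta>|angle_measure. w \<theta>)) + ennreal (exp (- L)) =
        ennreal (1 + exp (- L) * (LINT \<theta>|angle_measure. w \<theta>) + exp (- L))"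
      by (intro ennreal_plus[symmetric]) auto
    also have "\<dots> \<le> ennreal (1 + 2 * exp (- L))"
      by (rule ennreal_leI) (use \<open>exp (- L) * (LINT \<theta>|angle_measure. w \<theta>) \<le> exp (- L) * 1\<close> in linarith)
    finally show ?thesis .
  qed
  finally have "(\<integral>\<^sup>+z. ennreal (exp (v z)) \<partial>M) \<le> ennreal (1 + 2 * exp (- L))" .
  moreover have "(\<integral>\<^sup>+z. ennreal (exp (v z)) \<partial>M) = ennreal (LINT z|M. exp (v z))"
  proof (rule nn_integral_eq_integral)
    show "integrable M (\<lambda>z. exp (v z))"
      by (rule integrable_on_circle[where C = "exp L"]) (use vL in \<open>auto simp: abs_le_iff\<close>)
  qed auto
  ultimately have "ennreal (LINT z|M. exp (v z)) \<le> ennreal (1 + 2 * exp (- L))" by (simp only:)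
  hence "(LINT z|M. exp (v z)) \<le> 1 + 2 * exp (- L)"
    by (subst (asm) ennreal_le_iff) (auto intro: add_nonneg_nonneg)
  moreover have "b * exp (LINT z|circle_lebesgue. v z) \<le> (LINT z|M. exp (v z))"
    by (rule integral_exp_bounded_ge[OF b _ v vL]) (use b0 in simp)
  moreover have "(LINT z|circle_lebesgue. v z) = - (LINT \<theta>|angle_measure. ln (clip_exp L (w \<theta>)))"
  proof -
    have "(LINT z|circle_lebesgue. v z) = (LINT \<theta>|angle_measure. v (cis \<theta>))"
      by (rule integral_circle_lebesgue[OF v])
    also have "\<dots> = (LINT \<theta>|angle_measure. - ln (clip_exp L (w \<theta>)))"
      by (rule integral_cong_AE[OF _ _ AEv]) auto
    finally show ?thesis by simp
  qed
  ultimately have "b * exp (- (LINT \<theta>|angle_measure. ln (clip_exp L (w \<theta>)))) \<le> 1 + 2 * exp (- L)"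
    by simp
  also have "1 + 2 * exp (- L) \<le> exp (2 * exp (- L))" by (rule exp_ge_add_one_self)
  finally have "b * exp (- (LINT \<theta>|angle_measure. ln (clip_exp L (w \<theta>)))) \<le> exp (2 * exp (- L))" .
  hence "ln (b * exp (- (LINT \<theta>|angle_measure. ln (clip_exp L (w \<theta>))))) \<le> ln (exp (2 * exp (- L)))"
    by (subst ln_le_cancel_iff) (use b0 in auto)
  thus ?thesis using b0 by (simp add: ln_mult)
qed

text \<open>The half of Szego's theorem that bounds the mean of \<open>ln w\<close> from below, together with the positivity
  of \<open>w\<close> almost everywhere.\<close>
theorem szego_log_integrable:
  assumes ac: "ac_density M w" and b: "\<And>n. b \<le> \<beta> n" and b0: "0 < b"
  shows "AE \<theta> in angle_measure. 0 < w \<theta>" "integrable angle_measure (\<lambda>\<theta>. ln (w \<theta>))"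
    "ln b \<le> (LINT \<theta>|angle_measure. ln (w \<theta>))"
proof -
  have w[measurable]: "w \<in> borel_measurable borel" and w0: "\<And>\<theta>. 0 \<le> w \<theta>"
    using ac unfolding ac_density_def by auto
  have intw: "integrable angle_measure w" by (rule ac_density_integrable[OF ac])
  let ?f = "\<lambda>n \<theta>. w \<theta> - ln (clip_exp (real n) (w \<theta>))"
  \<comment> \<open>the limit of the integrands; it is infinite where \<open>w\<close> vanishes, although \<open>ln 0 = 0\<close>\<close>
  define F where "F \<theta> = (if w \<theta> = 0 then \<infinity> else ennreal (w \<theta> - ln (w \<theta>)))" for \<theta>
  define I where "I = (LINT \<theta>|angle_measure. w \<theta>)"
  have lim: "(\<lambda>n. ennreal (?f n \<theta>)) \<longlonglongrightarrow> F \<theta>" for \<theta>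
  proof (cases "w \<theta> = 0")
    case True
    have "clip_exp (real n) 0 = exp (- real n)" for n by (simp add: clip_exp_def)
    hence "?f n \<theta> = real n" for n using True by simp
    thus ?thesis using True by (simp add: F_def ennreal_of_nat_eq_real_of_nat[symmetric] of_nat_tendsto_top_ennreal)
  next
    case False
    hence "0 < w \<theta>" using w0[of \<theta>] by simp
    from clip_exp_eventually_eq[OF this]
    have "\<forall>\<^sub>F n in sequentially. ennreal (?f n \<theta>) = F \<theta>"
      by eventually_elim (simp add: F_def False)
    thus ?thesis by (rule tendsto_eventually)
  qed
  have int_clip: "integrable angle_measure (\<lambda>\<theta>. ln (clip_exp (real n) (w \<theta>)))" for n
    by (rule angle.integrable_const_bound[where B = "real n"]) (use ln_clip_exp_bound in auto)
  have "(\<integral>\<^sup>+\<theta>. F \<theta> \<partial>angle_measure) = (\<integral>\<^sup>+\<theta>. liminf (\<lambda>n. ennreal (?f n \<theta>)) \<partial>angle_measure)"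
    using lim_imp_Liminf[OF sequentially_bot lim] by simp
  also have "\<dots> \<le> liminf (\<lambda>n. \<integral>\<^sup>+\<theta>. ennreal (?f n \<theta>) \<partial>angle_measure)"
    by (rule nn_integral_liminf) measurable
  also have "\<dots> \<le> liminf (\<lambda>n. ennreal (I - ln b + 2 * exp (- real n)))"
  proof (intro Liminf_mono always_eventually allI)
    fix n
    have "(\<integral>\<^sup>+\<theta>. ennreal (?f n \<theta>) \<partial>angle_measure) = ennreal (LINT \<theta>|angle_measure. ?f n \<theta>)"
      by (rule nn_integral_eq_integral) (use intw int_clip ln_clip_exp_le w0 in auto)
    also have "(LINT \<theta>|angle_measure. ?f n \<theta>) = I - (LINT \<theta>|angle_measure. ln (clip_exp (real n) (w \<theta>)))"
      using intw int_clip by (simp add: I_def)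
    also have "ennreal \<dots> \<le> ennreal (I - ln b + 2 * exp (- real n))"
      using integral_ln_clip_ge[OF ac b b0, of "real n"] by (intro ennreal_leI) simp
    finally show "(\<integral>\<^sup>+\<theta>. ennreal (?f n \<theta>) \<partial>angle_measure) \<le> ennreal (I - ln b + 2 * exp (- real n))" .
  qed
  also have "\<dots> = ennreal (I - ln b)"
  proof (rule lim_imp_Liminf)
    have "(\<lambda>n. exp (- real n)) \<longlonglongrightarrow> 0"
      by (intro filterlim_compose[OF exp_at_bot] filterlim_compose[OF filterlim_uminus_at_bot_at_top]
          filterlim_real_sequentially)
    hence "(\<lambda>n. I - ln b + 2 * exp (- real n)) \<longlonglongrightarrow> I - ln b + 2 * 0" by (intro tendsto_intros)
    thus "(\<lambda>n. ennreal (I - ln b + 2 * exp (- real n))) \<longlonglongrightarrow> ennreal (I - ln b)" by (intro tendsto_ennrealI) simp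
  qed simp
  finally have Fle: "(\<integral>\<^sup>+\<theta>. F \<theta> \<partial>angle_measure) \<le> ennreal (I - ln b)" .
  have Fm[measurable]: "F \<in> borel_measurable borel" unfolding F_def by measurable
  have "AE \<theta> in angle_measure. F \<theta> \<noteq> \<infinity>"
    by (rule nn_integral_PInf_AE) (use Fle in \<open>auto simp: top_unique\<close>)
  thus pos: "AE \<theta> in angle_measure. 0 < w \<theta>"
  proof eventually_elim
    case (elim \<theta>)
    thus ?case using w0[of \<theta>] by (auto simp: F_def split: if_splits)
  qed
  have nonneg: "AE \<theta> in angle_measure. 0 \<le> w \<theta> - ln (w \<theta>)"
    using pos
  proof eventually_elim
    case (elim \<theta>)
    thus ?case using ln_le_minus_one[of "w \<theta>"] by simp
  qed
  have eq: "(\<integral>\<^sup>+\<theta>. ennreal (w \<theta> - ln (w \<theta>)) \<partial>angle_measure) = (\<integral>\<^sup>+\<theta>. F \<theta> \<partial>angle_measure)"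
    by (rule nn_integral_cong_AE) (use pos in \<open>eventually_elim, simp add: F_def\<close>)
  have int: "integrable angle_measure (\<lambda>\<theta>. w \<theta> - ln (w \<theta>))"
    by (rule integrableI_nonneg) (use nonneg eq Fle in \<open>auto simp: order.strict_trans1\<close>)
  have "integrable angle_measure (\<lambda>\<theta>. w \<theta> - (w \<theta> - ln (w \<theta>)))" using intw int by (rule Bochner_Integration.integrable_diff)
  thus intln: "integrable angle_measure (\<lambda>\<theta>. ln (w \<theta>))" by simp
  have "ennreal (LINT \<theta>|angle_measure. w \<theta> - ln (w \<theta>)) \<le> ennreal (I - ln b)"
    using nn_integral_eq_integral[OF int nonneg] eq Fle by simp
  moreover have "0 \<le> I - ln b"
  proof -
    have "(LINT \<theta>|angle_measure. ln (clip_exp (real n) (w \<theta>))) \<le> I" for n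
      unfolding I_def by (intro integral_mono int_clip intw ln_clip_exp_le w0) simp
    hence le: "ln b - 2 * exp (- real n) \<le> I" for n
      using integral_ln_clip_ge[OF ac b b0, of "real n"] order_trans by fastforce
    have "(\<lambda>n. exp (- real n)) \<longlonglongrightarrow> 0"
      by (intro filterlim_compose[OF exp_at_bot] filterlim_compose[OF filterlim_uminus_at_bot_at_top]
          filterlim_real_sequentially)
    hence "(\<lambda>n. ln b - 2 * exp (- real n)) \<longlonglongrightarrow> ln b - 2 * 0" by (intro tendsto_intros)
    hence "ln b - 2 * 0 \<le> I" by (rule LIMSEQ_le_const2) (use le in auto)
    thus ?thesis by simp
  qed
  ultimately have "(LINT \<theta>|angle_measure. w \<theta> - ln (w \<theta>)) \<le> I - ln b" by (subst (asm) ennreal_le_iff)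
  thus "ln b \<le> (LINT \<theta>|angle_measure. ln (w \<theta>))" using intw intln by (simp add: I_def)
qed

end

section \<open>Fourier coefficients of the logarithm of a polynomial\<close>

text \<open>The polynomial has no zero in some disc of radius \<open>r > 1\<close>, on which it has a holomorphic logarithm;
  \<open>c\<close> are the Taylor coefficients of that logarithm.\<close>
lemma zero_free_poly_log_series:
  assumes nz: "\<And>z. cmod z \<le> 1 \<Longrightarrow> poly P z \<noteq> 0" and P0: "poly P 0 = 1"
  obtains c :: "nat \<Rightarrow> complex" where "summable (\<lambda>k. cmod (c k))" "c 0 = 0"
    "\<And>z. cmod z = 1 \<Longrightarrow> ln ((cmod (poly P z))\<^sup>2) = 2 * Re (\<Sum>k. c k * z ^ k)"
    "\<And>m. m \<ge> 1 \<Longrightarrow> of_nat m * c m = (fps_deriv (fps_of_poly P) * inverse (fps_of_poly P)) $ (m - 1)"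
proof -
  define Z where "Z = {z. poly P z = 0}"
  have "P \<noteq> 0" using P0 by auto
  hence finZ: "finite Z" unfolding Z_def by (rule poly_roots_finite)
  \<comment> \<open>the number \<open>2\<close> is only there for a polynomial without zeros\<close>
  define r where "r = Min (insert 2 (cmod ` Z))"
  have r: "1 < r"
  proof -
    have "1 < cmod z" if "z \<in> Z" for z
      using nz[of z] that by (simp add: Z_def) (meson not_le)
    thus ?thesis unfolding r_def using finZ by (subst Min_gr_iff) auto
  qed
  have nzr: "poly P z \<noteq> 0" if "z \<in> ball 0 r" for z
  proof
    assume "poly P z = 0"
    hence "r \<le> cmod z" unfolding r_def using finZ by (intro Min_le) (auto simp: Z_def)
    thus False using that by simp
  qed
  have "poly P holomorphic_on ball 0 r" by (intro holomorphic_intros)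
  then obtain g where g: "g holomorphic_on ball 0 r" "\<And>z. z \<in> ball 0 r \<Longrightarrow> exp (g z) = poly P z"
    using holomorphic_logarithm_exists[of "ball 0 r" "poly P" 0] nzr r by auto
  define G where "G z = g z - g 0" for z
  have Gh: "G holomorphic_on ball 0 r" unfolding G_def by (intro holomorphic_intros g)
  have Ge: "exp (G z) = poly P z" if "z \<in> ball 0 r" for z
    using g(2)[OF that] g(2)[of 0] r P0 by (simp add: G_def exp_diff)
  define F where "F = fps_expansion G 0"
  have GF: "G has_fps_expansion F"
    unfolding F_def by (rule has_fps_expansion_fps_expansion[OF _ _ Gh]) (use r in auto)
  define c where "c k = F $ k" for k
  have ck: "c k = (deriv ^^ k) G 0 / fact k" for k
    unfolding c_def by (rule fps_nth_fps_expansion[OF GF])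
  have sums: "(\<lambda>k. c k * z ^ k) sums G z" if "z \<in> ball 0 r" for z
    using holomorphic_power_series[OF Gh that] by (simp add: ck)
  define x where "x = (1 + r) / 2"
  have x: "1 < x" "x < r" using r by (auto simp: x_def)
  have "summable (\<lambda>k. c k * of_real x ^ k)"
    using sums[of "of_real x"] x by (auto simp: sums_iff)
  hence "summable (\<lambda>k. cmod (c k * 1 ^ k))"
    by (rule powser_insidea) (use x in simp)
  hence 1: "summable (\<lambda>k. cmod (c k))" by simp
  have 2: "c 0 = 0" by (simp add: ck G_def)
  have 3: "ln ((cmod (poly P z))\<^sup>2) = 2 * Re (\<Sum>k. c k * z ^ k)" if z: "cmod z = 1" for z
  proof -
    have zr: "z \<in> ball 0 r" using z r by simp
    have "(cmod (poly P z))\<^sup>2 = exp (2 * Re (G z))"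
      unfolding Ge[OF zr, symmetric] by (simp add: exp_double)
    thus ?thesis using sums[OF zr] by (simp add: sums_iff)
  qed
  have exp1: "(\<lambda>z. deriv G z * poly P z) has_fps_expansion fps_deriv F * fps_of_poly P"
    by (intro has_fps_expansion_mult has_fps_expansion_deriv GF)
      (simp add: has_fps_expansion_def)
  have exp2: "deriv (poly P) has_fps_expansion fps_deriv (fps_of_poly P)"
    by (intro has_fps_expansion_deriv) (simp add: has_fps_expansion_def)
  have ev: "eventually (\<lambda>z. deriv G z * poly P z = deriv (poly P) z) (nhds 0)"
  proof -
    have "eventually (\<lambda>z. z \<in> ball 0 r) (nhds (0::complex))"
      by (rule eventually_nhds_in_open) (use r in auto)
    thus ?thesis
    proof eventually_elim
      case (elim z)
      have "(G has_field_derivative deriv G z) (at z)"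
        using Gh elim by (intro holomorphic_derivI[of _ "ball 0 r"]) auto
      hence "((\<lambda>z. exp (G z)) has_field_derivative (exp (G z) * deriv G z)) (at z)"
        by (auto intro!: derivative_eq_intros)
      hence "(poly P has_field_derivative (exp (G z) * deriv G z)) (at z)"
        by (rule has_field_derivative_transform_within_open[of _ _ _ "ball 0 r"])
          (use elim Ge in auto)
      hence "deriv (poly P) z = exp (G z) * deriv G z" by (rule DERIV_imp_deriv)
      thus ?case using Ge[OF elim] by (simp add: mult.commute)
    qed
  qed
  have "deriv (poly P) has_fps_expansion fps_deriv F * fps_of_poly P"
    using exp1 has_fps_expansion_cong[OF ev refl] by simp
  hence "fps_deriv F * fps_of_poly P = fps_deriv (fps_of_poly P)"
    using exp2 by (rule fps_expansion_unique_complex)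
  hence "fps_deriv F * (fps_of_poly P * inverse (fps_of_poly P)) = fps_deriv (fps_of_poly P) * inverse (fps_of_poly P)"
    by (simp add: mult.assoc[symmetric])
  moreover have "fps_of_poly P * inverse (fps_of_poly P) = 1"
    using P0 by (intro inverse_mult_eq_1') (simp add: poly_0_coeff_0)
  ultimately have FP: "fps_deriv F = fps_deriv (fps_of_poly P) * inverse (fps_of_poly P)" by simp
  have 4: "of_nat m * c m = (fps_deriv (fps_of_poly P) * inverse (fps_of_poly P)) $ (m - 1)" if "m \<ge> 1" for m
    unfolding FP[symmetric] using that by (cases m) (auto simp: c_def)
  show ?thesis using that[OF 1 2 3 4] .
qed

lemma fourier_coeff_Re_power_series:
  fixes c :: "nat \<Rightarrow> complex"
  assumes c: "summable (\<lambda>k. cmod (c k))"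
  shows "integrable angle_measure (\<lambda>\<theta>. 2 * Re (\<Sum>k. c k * cis \<theta> ^ k))"
    and "(LINT \<theta>|angle_measure. cnj (cis \<theta>) ^ m * of_real (2 * Re (\<Sum>k. c k * cis \<theta> ^ k))) =
      c m + (if m = 0 then cnj (c 0) else 0)"
proof -
  have [measurable]: "(\<lambda>\<theta>. cnj (cis \<theta>)) \<in> borel_measurable borel"
    by (intro borel_measurable_continuous_onI continuous_intros)
  have intb: "integrable angle_measure (\<lambda>\<theta>. cnj (cis \<theta>) ^ i * f \<theta>)"
    if "f \<in> borel_measurable borel" "\<And>\<theta>. cmod (f \<theta>) \<le> C" for i f C
    by (rule angle.integrable_const_bound[where B = C]) (use that in \<open>auto simp: norm_mult norm_power\<close>)
  have sc: "summable (\<lambda>k. c k * cis \<theta> ^ k)" for \<theta>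
    by (rule summable_norm_cancel) (use c in \<open>simp add: norm_mult norm_power\<close>)
  have bound: "cmod (\<Sum>k. c k * cis \<theta> ^ k) \<le> (\<Sum>k. cmod (c k))" for \<theta>
    using summable_norm[of "\<lambda>k. c k * cis \<theta> ^ k"] c by (simp add: norm_mult norm_power)
  have meas[measurable]: "(\<lambda>\<theta>. \<Sum>k. c k * cis \<theta> ^ k) \<in> borel_measurable borel" by measurable
  have [measurable]: "cnj \<in> borel_measurable borel"
    by (intro borel_measurable_continuous_onI continuous_intros)
  have measc: "(\<lambda>\<theta>. cnj (\<Sum>k. c k * cis \<theta> ^ k)) \<in> borel_measurable borel" by measurable
  show "integrable angle_measure (\<lambda>\<theta>. 2 * Re (\<Sum>k. c k * cis \<theta> ^ k))"
  proof (rule angle.integrable_const_bound[where B = "2 * (\<Sum>k. cmod (c k))"])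
    have "\<bar>Re (\<Sum>k. c k * cis \<theta> ^ k)\<bar> \<le> (\<Sum>k. cmod (c k))" for \<theta>
      using abs_Re_le_cmod bound order_trans by blast
    thus "AE \<theta> in angle_measure. norm (2 * Re (\<Sum>k. c k * cis \<theta> ^ k)) \<le> 2 * (\<Sum>k. cmod (c k))"
      by (intro always_eventually allI) (simp add: abs_mult)
  qed simp
  have orth: "(LINT \<theta>|angle_measure. cnj (cis \<theta>) ^ i * cis \<theta> ^ k) = (if i = k then 1 else 0)" for i k
  proof (cases "i \<le> k")
    case True
    have "cnj (cis \<theta>) ^ i * cis \<theta> ^ k = cis \<theta> ^ (k - i)" for \<theta>
    proof -
      have "cnj (cis \<theta>) ^ i * cis \<theta> ^ k = (cis \<theta> * cnj (cis \<theta>)) ^ i * cis \<theta> ^ (k - i)"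
        using True by (simp add: power_mult_distrib mult_ac flip: power_add)
      thus ?thesis by (simp add: mult_cnj_self)
    qed
    thus ?thesis using integral_cis_power[of "k - i"] True by auto
  next
    case False
    have "cnj (cis \<theta>) ^ i * cis \<theta> ^ k = cnj (cis \<theta> ^ (i - k))" for \<theta>
    proof -
      have "cnj (cis \<theta>) ^ i = cnj (cis \<theta>) ^ (i - k) * cnj (cis \<theta>) ^ k"
        using False by (simp flip: power_add)
      hence "cnj (cis \<theta>) ^ i * cis \<theta> ^ k = cnj (cis \<theta>) ^ (i - k) * (cis \<theta> * cnj (cis \<theta>)) ^ k"
        by (simp add: power_mult_distrib mult_ac)
      thus ?thesis by (simp add: mult_cnj_self)
    qed
    hence "(LINT \<theta>|angle_measure. cnj (cis \<theta>) ^ i * cis \<theta> ^ k) = (LINT \<theta>|angle_measure. cnj (cis \<theta> ^ (i - k)))"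
      by (simp only:)
    also have "\<dots> = cnj (LINT \<theta>|angle_measure. cis \<theta> ^ (i - k))" by (rule Bochner_Integration.integral_cnj)
    also have "\<dots> = 0" using False by (simp add: integral_cis_power)
    finally show ?thesis using False by simp
  qed
  have coeff: "(LINT \<theta>|angle_measure. cnj (cis \<theta>) ^ i * (\<Sum>k. c k * cis \<theta> ^ k)) = c i" for i
  proof -
    have "(\<lambda>k. LINT \<theta>|angle_measure. cnj (cis \<theta>) ^ i * (c k * cis \<theta> ^ k)) sums
       (LINT \<theta>|angle_measure. (\<Sum>k. cnj (cis \<theta>) ^ i * (c k * cis \<theta> ^ k)))"
    proof (rule sums_integral)
      show "integrable angle_measure (\<lambda>\<theta>. cnj (cis \<theta>) ^ i * (c k * cis \<theta> ^ k))" for k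
        by (rule intb[where C = "cmod (c k)"]) (auto simp: norm_mult norm_power)
    qed (use c angle.prob_space in \<open>auto simp: norm_mult norm_power\<close>)
    also have "(LINT \<theta>|angle_measure. (\<Sum>k. cnj (cis \<theta>) ^ i * (c k * cis \<theta> ^ k))) =
        (LINT \<theta>|angle_measure. cnj (cis \<theta>) ^ i * (\<Sum>k. c k * cis \<theta> ^ k))"
      using sc by (simp add: suminf_mult)
    also have "(\<lambda>k. LINT \<theta>|angle_measure. cnj (cis \<theta>) ^ i * (c k * cis \<theta> ^ k)) = (\<lambda>k. if k = i then c k else 0)"
      unfolding mult.left_commute[of "_ ^ i"] by (auto simp: orth fun_eq_iff)
    finally show ?thesis using sums_single[of i c] sums_unique2 by blast
  qed
  have coeff': "(LINT \<theta>|angle_measure. cnj (cis \<theta>) ^ i * cnj (\<Sum>k. c k * cis \<theta> ^ k)) = (if i = 0 then cnj (c 0) else 0)" for i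
  proof -
    have "(\<lambda>k. LINT \<theta>|angle_measure. cnj (c k) * cnj (cnj (cis \<theta>) ^ 0 * cis \<theta> ^ (i + k))) sums
       (LINT \<theta>|angle_measure. (\<Sum>k. cnj (c k) * cnj (cnj (cis \<theta>) ^ 0 * cis \<theta> ^ (i + k))))"
    proof (rule sums_integral)
      show "integrable angle_measure (\<lambda>\<theta>. cnj (c k) * cnj (cnj (cis \<theta>) ^ 0 * cis \<theta> ^ (i + k)))" for k
        using intb[of "\<lambda>_. cnj (c k)" "cmod (c k)" "i + k"] by (simp add: mult.commute)
    qed (use c angle.prob_space in \<open>auto simp: norm_mult norm_power\<close>)
    also have "(LINT \<theta>|angle_measure. (\<Sum>k. cnj (c k) * cnj (cnj (cis \<theta>) ^ 0 * cis \<theta> ^ (i + k)))) =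
        (LINT \<theta>|angle_measure. cnj (cis \<theta>) ^ i * cnj (\<Sum>k. c k * cis \<theta> ^ k))"
    proof (intro arg_cong[where f = "integral\<^sup>L angle_measure"] ext)
      fix \<theta>
      have "(\<lambda>k. cnj (c k * cis \<theta> ^ k)) sums cnj (\<Sum>k. c k * cis \<theta> ^ k)"
        using sc[of \<theta>] by (subst sums_cnj) (rule summable_sums)
      hence "(\<lambda>k. cnj (cis \<theta>) ^ i * cnj (c k * cis \<theta> ^ k)) sums (cnj (cis \<theta>) ^ i * cnj (\<Sum>k. c k * cis \<theta> ^ k))"
        by (rule sums_mult)
      moreover have "cnj (cis \<theta>) ^ i * cnj (c k * cis \<theta> ^ k) =
          cnj (c k) * cnj (cnj (cis \<theta>) ^ 0 * cis \<theta> ^ (i + k))" for k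
        by (simp only: power_0 mult_1_left power_add complex_cnj_mult complex_cnj_power mult_ac)
      ultimately have "(\<lambda>k. cnj (c k) * cnj (cnj (cis \<theta>) ^ 0 * cis \<theta> ^ (i + k))) sums
          (cnj (cis \<theta>) ^ i * cnj (\<Sum>k. c k * cis \<theta> ^ k))"
        by (simp only:)
      thus "(\<Sum>k. cnj (c k) * cnj (cnj (cis \<theta>) ^ 0 * cis \<theta> ^ (i + k))) = cnj (cis \<theta>) ^ i * cnj (\<Sum>k. c k * cis \<theta> ^ k)"
        by (rule sums_unique[symmetric])
    qed
    also have "(\<lambda>k. LINT \<theta>|angle_measure. cnj (c k) * cnj (cnj (cis \<theta>) ^ 0 * cis \<theta> ^ (i + k))) =
       (\<lambda>k. if k = 0 then (if i = 0 then cnj (c 0) else 0) else 0)"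
      unfolding integral_mult_right_zero Bochner_Integration.integral_cnj orth by (auto simp: fun_eq_iff)
    finally show ?thesis using sums_single[of 0 "\<lambda>_. if i = 0 then cnj (c 0) else 0"] sums_unique2 by blast
  qed
  have "(LINT \<theta>|angle_measure. cnj (cis \<theta>) ^ m * of_real (2 * Re (\<Sum>k. c k * cis \<theta> ^ k))) =
     (LINT \<theta>|angle_measure. cnj (cis \<theta>) ^ m * (\<Sum>k. c k * cis \<theta> ^ k) + cnj (cis \<theta>) ^ m * cnj (\<Sum>k. c k * cis \<theta> ^ k))"
    by (simp only: complex_add_cnj[symmetric] distrib_left)
  also have "\<dots> = c m + (if m = 0 then cnj (c 0) else 0)"
    by (subst Bochner_Integration.integral_add)
      (auto simp: coeff coeff' bound measc intro!: intb[where C = "\<Sum>k. cmod (c k)"])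
  finally show "(LINT \<theta>|angle_measure. cnj (cis \<theta>) ^ m * of_real (2 * Re (\<Sum>k. c k * cis \<theta> ^ k))) =
      c m + (if m = 0 then cnj (c 0) else 0)" .
qed

text \<open>Convexity: the function \<open>exp x - 1 - x\<close> lies above its tangents at \<open>e\<close> and \<open>- e\<close>.\<close>
lemma abs_le_exp_defect:
  fixes x e :: real
  assumes e: "e > 0"
  shows "\<bar>x\<bar> \<le> e + (exp x - 1 - x) / (1 - exp (- e))"
proof -
  define h where "h = exp x - 1 - x"
  have h: "0 \<le> h" using exp_ge_add_one_self[of x] unfolding h_def by linarith
  have E: "0 < 1 - exp (- e)" using e by simp
  have tangent: "exp t * (1 + x - t) \<le> exp x" for t
  proof -
    have "exp t * (1 + (x - t)) \<le> exp t * exp (x - t)"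
      by (intro mult_left_mono exp_ge_add_one_self) auto
    thus ?thesis by (simp flip: exp_add add: algebra_simps)
  qed
  show ?thesis
  proof (cases "0 \<le> x")
    case True
    have "1 + e \<le> exp e" by (rule exp_ge_add_one_self)
    \<comment> \<open>the tangent at \<open>e\<close> has slope \<open>exp e - 1\<close>, which is at least \<open>1 - exp (- e)\<close>\<close>
    have "exp e * (1 + x - e) - 1 - x \<le> h" using tangent[of e] by (simp add: h_def)
    moreover have "(exp e - 1) * (x - e) = (exp e * (1 + x - e) - 1 - x) - (exp e - 1 - e)"
      by (simp add: algebra_simps)
    ultimately have "(exp e - 1) * (x - e) \<le> h" using \<open>1 + e \<le> exp e\<close> by linarith
    moreover have "1 - exp (- e) \<le> exp e - 1"
    proof -
      have "2 \<le> exp e + exp (- e)" using exp_ge_add_one_self[of e] exp_ge_add_one_self[of "- e"] by linarith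
      thus ?thesis by linarith
    qed
    ultimately have "x - e \<le> h / (1 - exp (- e))"
    proof (cases "x \<le> e")
      case False
      hence "(1 - exp (- e)) * (x - e) \<le> (exp e - 1) * (x - e)"
        using \<open>1 - exp (- e) \<le> exp e - 1\<close> by (intro mult_right_mono) auto
      hence "(1 - exp (- e)) * (x - e) \<le> h" using \<open>(exp e - 1) * (x - e) \<le> h\<close> by linarith
      thus ?thesis using E by (simp add: pos_le_divide_eq mult.commute)
    next
      case True
      have "0 \<le> h / (1 - exp (- e))" using h E by simp
      thus ?thesis using True by linarith
    qed
    thus ?thesis using True by (simp add: h_def)
  next
    case False
    \<comment> \<open>the tangent at \<open>- e\<close>\<close>
    have "exp (- e) * (1 + x + e) - 1 - x \<le> h" using tangent[of "- e"] by (simp add: h_def)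
    moreover have "(1 - exp (- e)) * (- x - e) = (exp (- e) * (1 + x + e) - 1 - x) + (1 - exp (- e) - e)"
      by (simp add: algebra_simps)
    moreover have "1 - exp (- e) - e \<le> 0" using exp_ge_add_one_self[of "- e"] by simp
    ultimately have "(1 - exp (- e)) * (- x - e) \<le> h" by linarith
    hence "- x - e \<le> h / (1 - exp (- e))" using E by (simp add: pos_le_divide_eq mult.commute)
    thus ?thesis using False by (simp add: h_def)
  qed
qed

section \<open>The coefficients of the logarithm of the density as limits\<close>

lemma log_coeff_alt:
  "log_coeff w m = (LINT \<theta>|angle_measure. cnj (cis \<theta>) ^ m * of_real (ln (w \<theta>)))"
proof -
  have "exp (- \<i> * of_nat m * of_real \<theta>) = cnj (cis \<theta>) ^ m" for \<theta>
  proof -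
    have "cnj (cis \<theta>) ^ m = cis (real m * (- \<theta>))"
      by (simp add: cis_cnj Complex.DeMoivre)
    thus ?thesis by (simp add: cis_conv_exp mult.assoc)
  qed
  thus ?thesis unfolding log_coeff_def by (simp only:)
qed

context nontrivial_circle_measure
begin

lemma log_coeff_near_poly_coeff:
  assumes ac: "ac_density M w" and b: "\<And>n. b \<le> \<beta> n" and b0: "0 < b"
    and m: "m \<ge> 1" and e: "e > 0"
  shows "cmod (log_coeff w m + (fps_deriv (fps_of_poly (\<Phi>s n)) * inverse (fps_of_poly (\<Phi>s n))) $ (m - 1) / of_nat m)
     \<le> e + (ln (\<beta> n) - ln b) / (1 - exp (- e))"
proof -
  have w[measurable]: "w \<in> borel_measurable borel" and w0: "\<And>\<theta>. 0 \<le> w \<theta>"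
    using ac unfolding ac_density_def by auto
  note szego = szego_log_integrable[OF ac b b0]
  obtain c where c: "summable (\<lambda>k. cmod (c k))" "c 0 = 0"
    "\<And>z. cmod z = 1 \<Longrightarrow> ln ((cmod (poly (\<Phi>s n) z))\<^sup>2) = 2 * Re (\<Sum>k. c k * z ^ k)"
    "\<And>m. m \<ge> 1 \<Longrightarrow> of_nat m * c m = (fps_deriv (fps_of_poly (\<Phi>s n)) * inverse (fps_of_poly (\<Phi>s n))) $ (m - 1)"
    by (rule zero_free_poly_log_series[of "\<Phi>s n"]) (use \<Phi>s_dominates in auto)
  define p where "p \<theta> = (cmod (poly (\<Phi>s n) (cis \<theta>)))\<^sup>2" for \<theta>
  have pm[measurable]: "p \<in> borel_measurable borel"
    unfolding p_def by (intro borel_measurable_continuous_onI continuous_intros)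
  have p0: "0 < p \<theta>" for \<theta> unfolding p_def using \<Phi>s_dominates[of "cis \<theta>" n] by simp
  have lnp: "ln (p \<theta>) = 2 * Re (\<Sum>k. c k * cis \<theta> ^ k)" for \<theta> unfolding p_def by (rule c(3)) simp
  have intp: "integrable angle_measure (\<lambda>\<theta>. ln (p \<theta>))"
    unfolding lnp by (rule fourier_coeff_Re_power_series[OF c(1)])
  have fourier: "(LINT \<theta>|angle_measure. cnj (cis \<theta>) ^ i * of_real (ln (p \<theta>))) = c i" for i
    unfolding lnp fourier_coeff_Re_power_series(2)[OF c(1)] using c(2) by simp
  have "complex_of_real (LINT \<theta>|angle_measure. ln (p \<theta>)) = 0"
    using fourier[of 0] c(2) by simp
  hence mean0: "(LINT \<theta>|angle_measure. ln (p \<theta>)) = 0" by simp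
  \<comment> \<open>\<open>exp g\<close> has mean at most \<open>1\<close>, and \<open>g\<close> has mean at least \<open>ln b - ln (\<beta> n)\<close>\<close>
  define g where "g \<theta> = ln (p \<theta>) + ln (w \<theta>) - ln (\<beta> n)" for \<theta>
  have intg: "integrable angle_measure g"
    unfolding g_def using intp szego(2) by auto
  have meang: "(LINT \<theta>|angle_measure. g \<theta>) = (LINT \<theta>|angle_measure. ln (w \<theta>)) - ln (\<beta> n)"
    unfolding g_def using intp szego(2) mean0 angle.prob_space by simp
  have "(\<integral>\<^sup>+\<theta>. ennreal (w \<theta> * p \<theta>) \<partial>angle_measure) =
      (\<integral>\<^sup>+\<theta>. ennreal (w \<theta>) * ennreal ((cmod (poly (\<Phi>s n) (cis \<theta>)))\<^sup>2) \<partial>angle_measure)"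
    using w0 by (intro nn_integral_cong) (simp add: p_def ennreal_mult)
  also have "\<dots> \<le> (\<integral>\<^sup>+z. ennreal ((cmod (poly (\<Phi>s n) z))\<^sup>2) \<partial>M)"
    by (rule ac_density_nn_integral_le[OF ac, of "\<lambda>z. ennreal ((cmod (poly (\<Phi>s n) z))\<^sup>2)"])
      (intro measurable_compose[OF _ measurable_ennreal] borel_measurable_continuous_onI continuous_intros)
  also have "\<dots> = ennreal (\<beta> n)"
    unfolding sqnorm_\<Phi>s[symmetric] sqnorm_def by (rule nn_integral_eq_integral) auto
  finally have le: "(\<integral>\<^sup>+\<theta>. ennreal (w \<theta> * p \<theta>) \<partial>angle_measure) \<le> ennreal (\<beta> n)" .
  have wp0: "0 \<le> w \<theta> * p \<theta>" for \<theta> using w0[of \<theta>] p0[of \<theta>] by simp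
  have intwp: "integrable angle_measure (\<lambda>\<theta>. w \<theta> * p \<theta>)"
    by (rule integrableI_nonneg) (use wp0 le in \<open>auto intro: order.strict_trans1\<close>)
  have "ennreal (LINT \<theta>|angle_measure. w \<theta> * p \<theta>) \<le> ennreal (\<beta> n)"
    using le nn_integral_eq_integral[OF intwp] wp0 by simp
  hence wple: "(LINT \<theta>|angle_measure. w \<theta> * p \<theta>) \<le> \<beta> n"
    using \<beta>_pos[of n] by (subst (asm) ennreal_le_iff) auto
  define q where "q \<theta> = w \<theta> * p \<theta> / \<beta> n" for \<theta>
  have intq: "integrable angle_measure q" unfolding q_def using intwp by simp
  have qle: "(LINT \<theta>|angle_measure. q \<theta>) \<le> 1" unfolding q_def using wple \<beta>_pos[of n] by simp
  have expg: "AE \<theta> in angle_measure. exp (g \<theta>) = q \<theta>"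
    using szego(1)
  proof eventually_elim
    case (elim \<theta>)
    show ?case unfolding g_def q_def exp_diff exp_add
      using elim p0[of \<theta>] \<beta>_pos[of n] by (simp add: mult.commute)
  qed
  have E: "0 < 1 - exp (- e)" using e by simp
  have "(LINT \<theta>|angle_measure. \<bar>g \<theta>\<bar>) \<le> (LINT \<theta>|angle_measure. e + (q \<theta> - 1 - g \<theta>) / (1 - exp (- e)))"
  proof (rule integral_mono_AE)
    show "AE \<theta> in angle_measure. \<bar>g \<theta>\<bar> \<le> e + (q \<theta> - 1 - g \<theta>) / (1 - exp (- e))"
      using expg
    proof eventually_elim
      case (elim \<theta>)
      show ?case using abs_le_exp_defect[OF e, of "g \<theta>"] unfolding elim .
    qed
  qed (use intg intq in auto)
  also have "\<dots> = e + ((LINT \<theta>|angle_measure. q \<theta>) - 1 - (LINT \<theta>|angle_measure. g \<theta>)) / (1 - exp (- e))"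
    using intg intq angle.prob_space by simp
  also have "\<dots> \<le> e + (ln (\<beta> n) - ln b) / (1 - exp (- e))"
    using qle szego(3) E by (intro add_left_mono divide_right_mono) (auto simp: meang)
  finally have L1: "(LINT \<theta>|angle_measure. \<bar>g \<theta>\<bar>) \<le> e + (ln (\<beta> n) - ln b) / (1 - exp (- e))" .
  have mcis[measurable]: "(\<lambda>\<theta>. cnj (cis \<theta>)) \<in> borel_measurable borel"
    by (intro borel_measurable_continuous_onI continuous_intros)
  have intc: "integrable angle_measure (\<lambda>\<theta>. cnj (cis \<theta>) ^ m * of_real (f \<theta>))"
    if "integrable angle_measure f" for f :: "real \<Rightarrow> real"
  proof (rule Bochner_Integration.integrable_bound[OF that])
    have [measurable]: "f \<in> borel_measurable borel"
      using that by (simp add: borel_measurable_integrable measurable_cong_sets[OF sets_angle_measure refl, symmetric])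
    show "(\<lambda>\<theta>. cnj (cis \<theta>) ^ m * complex_of_real (f \<theta>)) \<in> borel_measurable angle_measure" by measurable
  qed (auto simp: norm_mult norm_power)
  have "(LINT \<theta>|angle_measure. cnj (cis \<theta>) ^ m * of_real (g \<theta>)) =
      (LINT \<theta>|angle_measure. cnj (cis \<theta>) ^ m * of_real (ln (p \<theta>)) + cnj (cis \<theta>) ^ m * of_real (ln (w \<theta>))
         - of_real (ln (\<beta> n)) * (cnj (cis \<theta> ^ m)))"
    by (simp add: g_def algebra_simps)
  also have "\<dots> = c m + log_coeff w m - of_real (ln (\<beta> n)) * (LINT \<theta>|angle_measure. cnj (cis \<theta> ^ m))"
    unfolding log_coeff_alt fourier[symmetric]
    using intc[OF intp] intc[OF szego(2)] intc[of "\<lambda>_. 1"] by simp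
  also have "(LINT \<theta>|angle_measure. cnj (cis \<theta> ^ m)) = 0"
    unfolding Bochner_Integration.integral_cnj integral_cis_power using m by simp
  finally have "cmod (c m + log_coeff w m) = cmod (LINT \<theta>|angle_measure. cnj (cis \<theta>) ^ m * of_real (g \<theta>))" by simp
  also have "\<dots> \<le> (LINT \<theta>|angle_measure. cmod (cnj (cis \<theta>) ^ m * of_real (g \<theta>)))"
    by (rule integral_norm_bound)
  also have "\<dots> = (LINT \<theta>|angle_measure. \<bar>g \<theta>\<bar>)" by (simp add: norm_mult norm_power)
  finally have "cmod (c m + log_coeff w m) \<le> e + (ln (\<beta> n) - ln b) / (1 - exp (- e))" using L1 by linarith
  moreover have "c m = (fps_deriv (fps_of_poly (\<Phi>s n)) * inverse (fps_of_poly (\<Phi>s n))) $ (m - 1) / of_nat m"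
    unfolding c(4)[OF m, symmetric] using m by simp
  ultimately show ?thesis by (simp add: add.commute)
qed

text \<open>The quotient is the \<open>m\<close>-th Taylor coefficient of the logarithm of \<open>\<Phi>\<^sub>n\<^sup>*\<close>.\<close>
theorem log_coeff_limit:
  assumes ac: "ac_density M w" and b: "\<And>n. b \<le> \<beta> n" and b0: "0 < b" and lim: "\<beta> \<longlonglongrightarrow> b" and m: "m \<ge> 1"
  shows "(\<lambda>n. - (fps_deriv (fps_of_poly (\<Phi>s n)) * inverse (fps_of_poly (\<Phi>s n))) $ (m - 1) / of_nat m)
     \<longlonglongrightarrow> log_coeff w m"
proof -
  let ?t = "\<lambda>n. (fps_deriv (fps_of_poly (\<Phi>s n)) * inverse (fps_of_poly (\<Phi>s n))) $ (m - 1) / of_nat m"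
  have "(\<lambda>n. log_coeff w m + ?t n) \<longlonglongrightarrow> 0"
  proof (rule LIMSEQ_I)
    fix r :: real assume r: "r > 0"
    have "(\<lambda>n. r / 2 + (ln (\<beta> n) - ln b) / (1 - exp (- (r / 2)))) \<longlonglongrightarrow> r / 2 + (ln b - ln b) / (1 - exp (- (r / 2)))"
      using r b0 by (intro tendsto_intros lim) auto
    moreover have "r / 2 + (ln b - ln b) / (1 - exp (- (r / 2))) < r" using r by simp
    ultimately have "\<forall>\<^sub>F n in sequentially. r / 2 + (ln (\<beta> n) - ln b) / (1 - exp (- (r / 2))) < r"
      by (rule order_tendstoD)
    then obtain N where N: "\<And>n. n \<ge> N \<Longrightarrow> r / 2 + (ln (\<beta> n) - ln b) / (1 - exp (- (r / 2))) < r"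
      unfolding eventually_sequentially by blast
    have "cmod (log_coeff w m + ?t n - 0) < r" if "n \<ge> N" for n
      using log_coeff_near_poly_coeff[OF ac b b0 m, of "r / 2" n] N[OF that] r by simp
    thus "\<exists>N. \<forall>n\<ge>N. cmod (log_coeff w m + ?t n - 0) < r" by blast
  qed
  hence "(\<lambda>n. log_coeff w m - (log_coeff w m + ?t n)) \<longlonglongrightarrow> log_coeff w m - 0" by (intro tendsto_intros)
  thus ?thesis by simp
qed

text \<open>The power series of \<open>\<Phi>\<^sub>n / \<Phi>\<^sub>n\<^sup>*\<close> at the origin.\<close>
definition \<Phi>_ratio :: "nat \<Rightarrow> complex fps" where
  "\<Phi>_ratio n = fps_of_poly (\<Phi> n) * inverse (fps_of_poly (\<Phi>s n))"

lemma fps_\<Phi>s_inverse: "fps_of_poly (\<Phi>s n) * inverse (fps_of_poly (\<Phi>s n)) = 1"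
  using poly_\<Phi>s_0[of n] by (intro inverse_mult_eq_1') (simp add: poly_0_coeff_0)

lemma fps_\<Phi>s_Suc:
  "fps_of_poly (\<Phi>s (Suc n)) = fps_of_poly (\<Phi>s n) * (1 - fps_const (\<alpha> n) * fps_X * \<Phi>_ratio n)"
proof -
  have "fps_of_poly (\<Phi>s n) * (1 - fps_const (\<alpha> n) * fps_X * \<Phi>_ratio n) =
      fps_of_poly (\<Phi>s n) - fps_const (\<alpha> n) * fps_X * fps_of_poly (\<Phi> n) *
        (fps_of_poly (\<Phi>s n) * inverse (fps_of_poly (\<Phi>s n)))"
    unfolding \<Phi>_ratio_def by (simp only: right_diff_distrib mult_1_right mult_1_left mult_ac)
  also have "\<dots> = fps_of_poly (\<Phi>s (Suc n))"
    unfolding fps_\<Phi>s_inverse \<Phi>s_Suc by (simp add: fps_of_poly_diff fps_of_poly_smult fps_of_poly_pCons mult_ac)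
  finally show ?thesis ..
qed

lemma inverse_schur_iterates_\<Phi>_ratio: "inverse_schur_iterates \<alpha> \<Phi>_ratio"
  unfolding inverse_schur_iterates_def
proof (intro conjI allI)
  show "\<Phi>_ratio 0 = 1" by (simp add: \<Phi>_ratio_def)
  show "cmod (\<alpha> n) \<le> 1" for n using cmod_\<alpha>[of n] by simp
  fix n
  let ?v = "1 - fps_const (\<alpha> n) * fps_X * \<Phi>_ratio n"
  let ?p = "fps_of_poly (\<Phi>s n)"
  have v: "inverse ?v * ?v = 1" by (rule inverse_mult_eq_1) simp
  have "\<Phi>_ratio (Suc n) * ?v = fps_of_poly (\<Phi> (Suc n)) * (inverse ?p * inverse ?v) * ?v"
    unfolding \<Phi>_ratio_def[of "Suc n"] fps_\<Phi>s_Suc by (simp only: fps_inverse_mult)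
  also have "\<dots> = fps_of_poly (\<Phi> (Suc n)) * inverse ?p"
    using v by (simp only: mult.assoc mult_1_right)
  also have "\<dots> = fps_X * \<Phi>_ratio n - fps_const (cnj (\<alpha> n)) * (?p * inverse ?p)"
    unfolding \<Phi>_Suc \<Phi>_ratio_def
    by (simp only: fps_of_poly_diff fps_of_poly_smult fps_of_poly_pCons left_diff_distrib) (simp add: mult_ac)
  finally show "\<Phi>_ratio (Suc n) * ?v = fps_X * \<Phi>_ratio n - fps_const (cnj (\<alpha> n))"
    unfolding fps_\<Phi>s_inverse by simp
qed

lemma log_coeff_limit_increments:
  assumes ac: "ac_density M w" and s: "summable (\<lambda>k. (cmod (\<alpha> k))\<^sup>2)" and m: "m \<ge> 1"
  shows "(\<lambda>N. (\<Sum>n<N. log_increment \<alpha> \<Phi>_ratio n $ (m - 1)) / of_nat m) \<longlonglongrightarrow> log_coeff w m"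
proof -
  obtain b where b: "b > 0" "\<beta> \<longlonglongrightarrow> b" "\<And>n. b \<le> \<beta> n" using \<beta>_tendsto[OF s] by blast
  have "- (fps_deriv (fps_of_poly (\<Phi>s N)) * inverse (fps_of_poly (\<Phi>s N))) = (\<Sum>n<N. log_increment \<alpha> \<Phi>_ratio n)" for N
    by (rule log_derivative_telescope(2)[where P = "\<lambda>n. fps_of_poly (\<Phi>s n)"]) (simp_all add: fps_\<Phi>s_Suc)
  hence "(- (fps_deriv (fps_of_poly (\<Phi>s N)) * inverse (fps_of_poly (\<Phi>s N)))) $ (m - 1) =
      (\<Sum>n<N. log_increment \<alpha> \<Phi>_ratio n) $ (m - 1)" for N by (simp only:)
  hence "- (fps_deriv (fps_of_poly (\<Phi>s N)) * inverse (fps_of_poly (\<Phi>s N))) $ (m - 1) =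
      (\<Sum>n<N. log_increment \<alpha> \<Phi>_ratio n $ (m - 1))" for N by (simp only: fps_neg_nth fps_sum_nth)
  thus ?thesis using log_coeff_limit[OF ac b(3) b(1) b(2) m] by (simp only:)
qed

end

section \<open>The expansion of the Fourier coefficients\<close>

theorem theorem1p2:
  fixes m :: nat
  assumes "m \<ge> 1"
  shows "\<exists>C::real. \<forall>(\<mu> :: complex measure) (w :: real \<Rightarrow> real) (\<alpha> :: nat \<Rightarrow> complex).
           circle_prob_measure \<mu> \<and> nontrivial_measure \<mu> \<and> ac_density \<mu> w \<and>
           \<alpha> = verblunsky \<mu> \<and> summable (\<lambda>k. (cmod (\<alpha> k))\<^sup>2) \<longrightarrow>
           (\<exists>R::complex.
              log_coeff w m = \<alpha> (m - 1) - (\<Sum>k. \<alpha> (k + m) * cnj (\<alpha> k)) + R \<and>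
              cmod R \<le> C * ((\<Sum>k<m. (cmod (\<alpha> k))\<^sup>2) + (\<Sum>k. cmod (\<alpha> (k + m)) ^ 4)))"
proof -
  obtain C where C: "C \<ge> 0" "\<And>a B N. inverse_schur_iterates a B \<Longrightarrow> m \<le> N \<Longrightarrow>
     cmod ((\<Sum>n<N. log_increment a B n $ (m - 1)) / of_nat m
            - (a (m - 1) - (\<Sum>n=m..<N. a n * cnj (a (n - m)))))
       \<le> C * ((\<Sum>k<m. (cmod (a k))\<^sup>2) + (\<Sum>k=m..<N. cmod (a k) ^ 4))"
    using log_increment_sum_estimate[OF assms] by meson
  show ?thesis
  proof (intro exI[of _ C] allI impI)
    fix \<mu> :: "complex measure" and w :: "real \<Rightarrow> real" and \<alpha> :: "nat \<Rightarrow> complex"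
    assume A: "circle_prob_measure \<mu> \<and> nontrivial_measure \<mu> \<and> ac_density \<mu> w \<and>
           \<alpha> = verblunsky \<mu> \<and> summable (\<lambda>k. (cmod (\<alpha> k))\<^sup>2)"
    interpret \<mu>: nontrivial_circle_measure \<mu>
      using A unfolding nontrivial_circle_measure_def nontrivial_circle_measure_axioms_def
        circle_measure_def circle_measure_axioms_def circle_prob_measure_def by blast
    have \<alpha>: "\<mu>.\<alpha> = \<alpha>" using A by (auto simp: \<mu>.\<alpha>_def)
    have ac: "ac_density \<mu> w" and s: "summable (\<lambda>k. (cmod (\<alpha> k))\<^sup>2)" using A by auto
    have it: "inverse_schur_iterates \<alpha> \<mu>.\<Phi>_ratio"
      using \<mu>.inverse_schur_iterates_\<Phi>_ratio unfolding \<alpha> .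
    have le1: "cmod (\<alpha> k) \<le> 1" for k using \<mu>.cmod_\<alpha>[of k] unfolding \<alpha> by simp
    have sm: "summable (\<lambda>k. (cmod (\<alpha> (k + m)))\<^sup>2)" using s by (rule summable_ignore_initial_segment)
    have s4: "summable (\<lambda>k. cmod (\<alpha> (k + m)) ^ 4)"
    proof (rule summable_comparison_test'[OF sm])
      show "norm (cmod (\<alpha> (k + m)) ^ 4) \<le> (cmod (\<alpha> (k + m)))\<^sup>2" for k
        using le1[of "k + m"] by (simp add: power_decreasing)
    qed
    have s2: "summable (\<lambda>k. \<alpha> (k + m) * cnj (\<alpha> k))"
    proof (rule summable_comparison_test'[OF summable_add[OF sm s]])
      show "cmod (\<alpha> (k + m) * cnj (\<alpha> k)) \<le> (cmod (\<alpha> (k + m)))\<^sup>2 + (cmod (\<alpha> k))\<^sup>2" for k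
      proof -
        have "0 \<le> cmod (\<alpha> (k + m)) * cmod (\<alpha> k)" by simp
        thus ?thesis using sum_squares_bound[of "cmod (\<alpha> (k + m))" "cmod (\<alpha> k)"]
          unfolding norm_mult complex_mod_cnj by linarith
      qed
    qed
    define T where "T N = (\<Sum>n<N. log_increment \<alpha> \<mu>.\<Phi>_ratio n $ (m - 1)) / of_nat m" for N
    define S where "S = (\<Sum>k. \<alpha> (k + m) * cnj (\<alpha> k))"
    define bound where "bound = C * ((\<Sum>k<m. (cmod (\<alpha> k))\<^sup>2) + (\<Sum>k. cmod (\<alpha> (k + m)) ^ 4))"
    have "T \<longlonglongrightarrow> log_coeff w m"
      using \<mu>.log_coeff_limit_increments[OF ac s[folded \<alpha>] assms] unfolding T_def \<alpha> .
    hence T: "(\<lambda>N. T (N + m)) \<longlonglongrightarrow> log_coeff w m" by (rule LIMSEQ_ignore_initial_segment)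
    have "(\<lambda>N. \<Sum>k<N. \<alpha> (k + m) * cnj (\<alpha> k)) \<longlonglongrightarrow> S"
      unfolding S_def by (rule summable_LIMSEQ[OF s2])
    hence lim: "(\<lambda>N. cmod (T (N + m) - (\<alpha> (m - 1) - (\<Sum>k<N. \<alpha> (k + m) * cnj (\<alpha> k)))))
        \<longlonglongrightarrow> cmod (log_coeff w m - (\<alpha> (m - 1) - S))"
      by (intro tendsto_intros T)
    have "cmod (T (N + m) - (\<alpha> (m - 1) - (\<Sum>k<N. \<alpha> (k + m) * cnj (\<alpha> k)))) \<le> bound" for N
    proof -
      have shift: "(\<Sum>n=m..<N + m. f n) = (\<Sum>k<N. f (k + m))" for f :: "nat \<Rightarrow> 'b::comm_monoid_add"
        using sum.shift_bounds_nat_ivl[of f 0 m N] by (simp add: atLeast0LessThan)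
      have "cmod (T (N + m) - (\<alpha> (m - 1) - (\<Sum>k<N. \<alpha> (k + m) * cnj (\<alpha> k))))
          \<le> C * ((\<Sum>k<m. (cmod (\<alpha> k))\<^sup>2) + (\<Sum>k<N. cmod (\<alpha> (k + m)) ^ 4))"
        using C(2)[OF it, of "N + m"] unfolding shift T_def by simp
      also have "\<dots> \<le> bound"
        unfolding bound_def using s4 by (intro mult_left_mono add_left_mono sum_le_suminf C(1)) auto
      finally show ?thesis .
    qed
    hence "cmod (log_coeff w m - (\<alpha> (m - 1) - S)) \<le> bound"
      by (intro LIMSEQ_le_const2[OF lim]) auto
    thus "\<exists>R::complex.
              log_coeff w m = \<alpha> (m - 1) - (\<Sum>k. \<alpha> (k + m) * cnj (\<alpha> k)) + R \<and>
              cmod R \<le> C * ((\<Sum>k<m. (cmod (\<alpha> k))\<^sup>2) + (\<Sum>k. cmod (\<alpha> (k + m)) ^ 4))"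
      unfolding bound_def S_def
      by (intro exI[of _ "log_coeff w m - (\<alpha> (m - 1) - (\<Sum>k. \<alpha> (k + m) * cnj (\<alpha> k)))"] conjI) simp_all
  qed
qed

end
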